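(* Let $n\ge 1$, let $M$ be a smooth oriented $n$-manifold and let $(f,\xi)$, $f:M\to\mathbb{R}^{n+1}$, be a non-degenerate equiaffine immersion with affine shape operator $S$ satisfying $\det(S)\neq0$ at every point. Let $\nu:M\to(\mathbb{R}^{n+1})^*$ be its conormal map and $\sigma^-=(-\xi,\nu):M\to\mathbb{H}^{n+1,n}$. The following are equivalent: (i) $\sigma^-:M\to\mathbb{H}^{n+1,n}$ is maximal, i.e. its mean curvature $\mathbf{H}_{\sigma^-}$ vanishes identically; (ii) $\bar\sigma=\pi_-\circ\sigma^-:M\to\mathbb{H}^n_\tau$ is maximal; (iii) the dual immersion $\nu:M\to(\mathbb{R}^{n+1})^*$ is a proper affine sphere.
   Context: Everything is smooth. $D$ is the flat connection on $\mathbb{R}^{n+1}$ (or on its dual). Affine immersions. Let $f:M\to\mathbb{R}^{n+1}$ be an immersion with a vector field $\xi:M\to\mathbb{R}^{n+1}$ such that $\mathbb{R}^{n+1}=f_*(T_pM)\oplus\mathbb{R}\xi_p$ for all $p$. Write $D_Xf_*Y=f_*(\nabla_XY)+h(X,Y)\xi$ and $D_X\xi=-f_*(SX)+\tau(X)\xi$; $h$ is the affine metric, $S$ the affine shape operator. $(f,\xi)$ is equiaffine if $\tau=0$, non-degenerate if $h$ is non-degenerate, centroaffine if $\xi=f$. The conormal map $\nu:M\to(\mathbb{R}^{n+1})^*$ is defined by $\nu_p(\xi_p)=1$, $\nu_p(f_*X)=0$ for $X\in T_pM$; it is a centroaffine immersion into $(\mathbb{R}^{n+1})^*$ (with transversal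 field its position vector), non-degenerate when $h$ is non-degenerate and $\det S\ne0$. Proper affine spheres. A non-degenerate equiaffine $(f,\xi)$ is a Blaschke immersion if $\theta=\omega_h$ up to sign, where $\theta(X_1,\dots,X_n)=\det(f_*X_1,\dots,f_*X_n,\xi)$ and $\omega_h$ is the volume form of $h$; it is a proper affine sphere if moreover $S=-\lambda\,\mathrm{Id}$ with $\lambda$ a nowhere zero function. A centroaffine immersion $f$ is called a proper affine sphere if $(f,cf)$ is a proper affine sphere for some locally constant nowhere zero function $c$. The same definitions apply in $(\mathbb{R}^{n+1})^*$. Pseudohyperbolic space. $V=\mathbb{R}^{n+1}\oplus(\mathbb{R}^{n+1})^*$ with $\hat{\mathbf g}((v,\alpha),(w,\beta))=\tfrac12(\alpha(w)+\beta(v))$; $\mathbb{H}^{n+1,n}=\{(v,\alpha)\in V:\alpha(v)=-1\}$ with the restricted metric $g$ of signature $(n+1,n)$. At $z=(v,\alpha)$ let $\mathcal{H}_z=\{(w,\beta):\alpha(w)=0=\beta(v)\}\subset T_z\mathbb{H}^{n+1,n}$ (the orthogonal complement of $(v,-\alpha)$). Para-complex hyperbolic space. $\mathbb{R}$ acts freely and properly by isometries on $\mathbb{H}^{n+1,n}$ via $t\cdot(v,\alpha)=(e^tv,e^{-t}\alpha)$; $\pi_-:\mathbb{H}^{n+1,n}\to\mathbb{H}^n_\tau:=\mathbb{H}^{n+1,n}/\mathbb{R}$ is the quotient map and $\mathbb{H}^n_\tau$ carries the metric $\mathbf g$ of signature $(n,n)$ for which $d\pi_-:\mathcal{H}_z\to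 T_{\pi_-(z)}\mathbb{H}^n_\tau$ is an isometry for all $z$. An immersion into a pseudo-Riemannian manifold is non-degenerate if its induced metric is non-degenerate; it is then maximal if its mean curvature (trace of the second fundamental form with respect to the induced metric) vanishes identically. Under the hypotheses of the claim, $\sigma^-$ and $\bar\sigma$ are non-degenerate immersions. *)

theory Defs
  imports "HOL-Analysis.Analysis"
begin

section \<open>Smooth manifolds\<close>

text \<open>These notions are only applied to open sets. On a finite-dimensional domain,
  \<^term>\<open>Ck_on k\<close> is the usual class of k times continuously differentiable maps.\<close>

primrec Ck_on ::
  "nat \<Rightarrow> 'a::real_normed_vector set \<Rightarrow> ('a \<Rightarrow> 'b::real_normed_vector) \<Rightarrow> bool" where
  "Ck_on 0 = (\<lambda>U F. continuous_on U F)"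
| "Ck_on (Suc k) = (\<lambda>U F. (\<forall>x\<in>U. F differentiable (at x)) \<and>
     (\<forall>v. Ck_on k U (\<lambda>x. frechet_derivative F (at x) v)))"

definition smooth_on ::
  "'a::real_normed_vector set \<Rightarrow> ('a \<Rightarrow> 'b::real_normed_vector) \<Rightarrow> bool" where
  "smooth_on U F \<longleftrightarrow> (\<forall>k. Ck_on k U F)"

text \<open>A chart is a pair of a domain and a coordinate map; the coordinate map is meaningless
  outside the domain. A tangent vector at a point is represented by its coordinate vector
  in a chart around that point.\<close>

type_synonym ('m, 'a) chart = "'m set \<times> ('m \<Rightarrow> 'a)"

definition chart_inv :: "('m, 'a) chart \<Rightarrow> 'a \<Rightarrow> 'm" where
  "chart_inv c = inv_into (fst c) (snd c)"

record ('m, 'a) manifold =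
  mtop :: "'m topology"
  charts :: "('m, 'a) chart set"

definition charts_at :: "('m, 'a, 'z) manifold_scheme \<Rightarrow> 'm \<Rightarrow> ('m, 'a) chart set" where
  "charts_at M p = {c \<in> charts M. p \<in> fst c}"

text \<open>The atlas need not be maximal.\<close>

definition smooth_manifold :: "('m, 'a::euclidean_space, 'z) manifold_scheme \<Rightarrow> bool" where
  "smooth_manifold M \<longleftrightarrow>
     Hausdorff_space (mtop M) \<and> second_countable (mtop M) \<and>
     \<Union> (fst ` charts M) = topspace (mtop M) \<and>
     (\<forall>c\<in>charts M. openin (mtop M) (fst c) \<and> open (snd c ` fst c) \<and>
        homeomorphic_map (subtopology (mtop M) (fst c)) (top_of_set (snd c ` fst c)) (snd c)) \<and>
     (\<forall>c\<in>charts M. \<forall>d\<in>charts M.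
        smooth_on (snd c ` (fst c \<inter> fst d)) (snd d \<circ> chart_inv c))"

text \<open>\<^term>\<open>push c F p u\<close> is the derivative at \<open>p\<close> of \<open>F\<close> in the direction of the
  tangent vector with coordinates \<open>u\<close> in the chart \<open>c\<close>, and \<^term>\<open>push2 c F p u w\<close> is the
  derivative in the direction \<open>u\<close> of the derivative of \<open>F\<close> along the vector field with
  constant coordinates \<open>w\<close>.\<close>

definition push ::
  "('m, 'a::euclidean_space) chart \<Rightarrow> ('m \<Rightarrow> 'v::real_normed_vector) \<Rightarrow> 'm \<Rightarrow> 'a \<Rightarrow> 'v" where
  "push c F p u = frechet_derivative (F \<circ> chart_inv c) (at (snd c p)) u"

definition push2 ::
  "('m, 'a::euclidean_space) chart \<Rightarrow> ('m \<Rightarrow> 'v::real_normed_vector) \<Rightarrow> 'm \<Rightarrow> 'a \<Rightarrow> 'a \<Rightarrow> 'v" where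
  "push2 c F p u w = push c (\<lambda>q. push c F q w) p u"

text \<open>Orientation: the charts in the given atlas are the positively oriented ones.\<close>

definition oriented :: "('m, real^'n::finite, 'z) manifold_scheme \<Rightarrow> bool" where
  "oriented M \<longleftrightarrow>
     (\<forall>c\<in>charts M. \<forall>d\<in>charts M. \<forall>p \<in> fst c \<inter> fst d. det (matrix (push c (snd d) p)) > 0)"

definition smooth_vmap ::
  "('m, 'a::euclidean_space, 'z) manifold_scheme \<Rightarrow> ('m \<Rightarrow> 'v::real_normed_vector) \<Rightarrow> bool" where
  "smooth_vmap M F \<longleftrightarrow> (\<forall>c\<in>charts M. smooth_on (snd c ` fst c) (F \<circ> chart_inv c))"

definition smooth_map ::
  "('m, 'a::euclidean_space, 'z) manifold_scheme \<Rightarrow> ('x, 'b::euclidean_space, 'y) manifold_scheme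
    \<Rightarrow> ('m \<Rightarrow> 'x) \<Rightarrow> bool" where
  "smooth_map M N \<sigma> \<longleftrightarrow> continuous_map (mtop M) (mtop N) \<sigma> \<and>
     (\<forall>p\<in>topspace (mtop M). \<exists>c\<in>charts_at M p. \<exists>k\<in>charts_at N (\<sigma> p).
        smooth_on (snd c ` {q \<in> fst c. \<sigma> q \<in> fst k}) (snd k \<circ> \<sigma> \<circ> chart_inv c))"

section \<open>Maximal immersions into pseudo-Riemannian manifolds\<close>

text \<open>\<^term>\<open>pr_metric N k q u w\<close> is the value at the point \<open>q\<close> of the metric on the tangent vectors
  with coordinates \<open>u\<close> and \<open>w\<close> in the chart \<open>k\<close>.\<close>

record ('m, 'a) pr_manifold = "('m, 'a) manifold" +
  pr_metric :: "('m, 'a) chart \<Rightarrow> 'm \<Rightarrow> 'a \<Rightarrow> 'a \<Rightarrow> real"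

text \<open>Covariant derivative, for the Levi-Civita connection, of the vector field with constant
  coordinates \<open>w\<close> in the direction \<open>u\<close>, as given by the Koszul formula.\<close>

definition christoffel ::
  "('x, 'b::euclidean_space) pr_manifold \<Rightarrow> ('x, 'b) chart \<Rightarrow> 'x \<Rightarrow> 'b \<Rightarrow> 'b \<Rightarrow> 'b" where
  "christoffel N k q u w = (THE t. \<forall>z. pr_metric N k q t z =
     (push k (\<lambda>r. pr_metric N k r w z) q u + push k (\<lambda>r. pr_metric N k r u z) q w
       - push k (\<lambda>r. pr_metric N k r u w) q z) / 2)"

text \<open>In all the following, \<open>c\<close> is a chart of the source around \<open>p\<close>, and \<open>k\<close> is a chart of the
  target around the image of \<open>p\<close>, in which the vector-valued results are expressed.\<close>

definition induced_metric ::
  "('x, 'b::euclidean_space) pr_manifold \<Rightarrow> ('m, 'a::euclidean_space) chart \<Rightarrow> ('x, 'b) chart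
    \<Rightarrow> ('m \<Rightarrow> 'x) \<Rightarrow> 'm \<Rightarrow> 'a \<Rightarrow> 'a \<Rightarrow> real" where
  "induced_metric N c k \<sigma> p u w =
     pr_metric N k (\<sigma> p) (push c (snd k \<circ> \<sigma>) p u) (push c (snd k \<circ> \<sigma>) p w)"

definition covariant_along ::
  "('x, 'b::euclidean_space) pr_manifold \<Rightarrow> ('m, 'a::euclidean_space) chart \<Rightarrow> ('x, 'b) chart
    \<Rightarrow> ('m \<Rightarrow> 'x) \<Rightarrow> 'm \<Rightarrow> 'a \<Rightarrow> 'a \<Rightarrow> 'b" where
  "covariant_along N c k \<sigma> p u w = push2 c (snd k \<circ> \<sigma>) p u w +
     christoffel N k (\<sigma> p) (push c (snd k \<circ> \<sigma>) p u) (push c (snd k \<circ> \<sigma>) p w)"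

definition normal_part :: "('b::real_vector \<Rightarrow> 'b \<Rightarrow> real) \<Rightarrow> 'b set \<Rightarrow> 'b \<Rightarrow> 'b" where
  "normal_part b W t = (THE s. (\<forall>w\<in>W. b s w = 0) \<and> t - s \<in> W)"

definition second_fundamental_form ::
  "('x, 'b::euclidean_space) pr_manifold \<Rightarrow> ('m, 'a::euclidean_space) chart \<Rightarrow> ('x, 'b) chart
    \<Rightarrow> ('m \<Rightarrow> 'x) \<Rightarrow> 'm \<Rightarrow> 'a \<Rightarrow> 'a \<Rightarrow> 'b" where
  "second_fundamental_form N c k \<sigma> p u w =
     normal_part (pr_metric N k (\<sigma> p)) (range (push c (snd k \<circ> \<sigma>) p)) (covariant_along N c k \<sigma> p u w)"

definition gram :: "(real^'n \<Rightarrow> real^'n \<Rightarrow> real) \<Rightarrow> real^'n::finite^'n" where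
  "gram b = (\<chi> i j. b (axis i 1) (axis j 1))"

definition mean_curvature ::
  "('x, 'b::euclidean_space) pr_manifold \<Rightarrow> ('m, real^'n::finite) chart \<Rightarrow> ('x, 'b) chart
    \<Rightarrow> ('m \<Rightarrow> 'x) \<Rightarrow> 'm \<Rightarrow> 'b" where
  "mean_curvature N c k \<sigma> p =
     (\<Sum>i\<in>UNIV. \<Sum>j\<in>UNIV. matrix_inv (gram (induced_metric N c k \<sigma> p)) $ i $ j *\<^sub>R
        second_fundamental_form N c k \<sigma> p (axis i 1) (axis j 1))"

definition nondegenerate_form :: "('a::real_vector \<Rightarrow> 'a \<Rightarrow> real) \<Rightarrow> bool" where
  "nondegenerate_form b \<longleftrightarrow> (\<forall>u. (\<forall>w. b u w = 0) \<longrightarrow> u = 0)"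

definition nondegenerate_immersion ::
  "('m, 'a::euclidean_space) manifold \<Rightarrow> ('x, 'b::euclidean_space) pr_manifold
    \<Rightarrow> ('m \<Rightarrow> 'x) \<Rightarrow> bool" where
  "nondegenerate_immersion M N \<sigma> \<longleftrightarrow> smooth_map M N \<sigma> \<and>
     (\<forall>p\<in>topspace (mtop M). \<forall>c\<in>charts_at M p. \<forall>k\<in>charts_at N (\<sigma> p).
        inj (push c (snd k \<circ> \<sigma>) p) \<and> nondegenerate_form (induced_metric N c k \<sigma> p))"

definition maximal_immersion ::
  "('m, real^'n::finite) manifold \<Rightarrow> ('x, 'b::euclidean_space) pr_manifold
    \<Rightarrow> ('m \<Rightarrow> 'x) \<Rightarrow> bool" where
  "maximal_immersion M N \<sigma> \<longleftrightarrow> nondegenerate_immersion M N \<sigma> \<and>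
     (\<forall>p\<in>topspace (mtop M). \<forall>c\<in>charts_at M p. \<forall>k\<in>charts_at N (\<sigma> p).
        mean_curvature N c k \<sigma> p = 0)"

section \<open>Affine immersions\<close>

text \<open>The space of dimension n+1 that contains the immersed n-manifolds. Its dual is identified
  with the same type by means of the dual basis, so that the pairing of a covector and a vector
  is \<open>\<alpha> \<bullet> v\<close>, and the determinant on the dual is the one in dual coordinates.\<close>

type_synonym 'n rvec = "real^('n option)"

definition affine_immersion ::
  "('m, real^'n::finite) manifold \<Rightarrow> ('m \<Rightarrow> 'n rvec) \<Rightarrow> ('m \<Rightarrow> 'n rvec) \<Rightarrow> bool" where
  "affine_immersion M f \<xi> \<longleftrightarrow> smooth_vmap M f \<and> smooth_vmap M \<xi> \<and>
     (\<forall>p\<in>topspace (mtop M). \<forall>c\<in>charts_at M p.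
        inj (push c f p) \<and> (\<forall>v. \<exists>!(u, a). v = push c f p u + a *\<^sub>R \<xi> p))"

text \<open>The components of a vector \<open>v\<close> in the decomposition at \<open>p\<close> into a tangential vector and
  a multiple of \<open>\<xi> p\<close>.\<close>

definition tangential_part ::
  "('m, real^'n::finite) chart \<Rightarrow> ('m \<Rightarrow> 'n rvec) \<Rightarrow> ('m \<Rightarrow> 'n rvec) \<Rightarrow> 'm \<Rightarrow> 'n rvec \<Rightarrow> real^'n" where
  "tangential_part c f \<xi> p v = (THE u. \<exists>a. v = push c f p u + a *\<^sub>R \<xi> p)"

definition transversal_part ::
  "('m, real^'n::finite) chart \<Rightarrow> ('m \<Rightarrow> 'n rvec) \<Rightarrow> ('m \<Rightarrow> 'n rvec) \<Rightarrow> 'm \<Rightarrow> 'n rvec \<Rightarrow> real" where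
  "transversal_part c f \<xi> p v = (THE a. \<exists>u. v = push c f p u + a *\<^sub>R \<xi> p)"

definition affine_metric ::
  "('m, real^'n::finite) chart \<Rightarrow> ('m \<Rightarrow> 'n rvec) \<Rightarrow> ('m \<Rightarrow> 'n rvec) \<Rightarrow> 'm
    \<Rightarrow> real^'n \<Rightarrow> real^'n \<Rightarrow> real" where
  "affine_metric c f \<xi> p u w = transversal_part c f \<xi> p (push2 c f p u w)"

definition affine_shape ::
  "('m, real^'n::finite) chart \<Rightarrow> ('m \<Rightarrow> 'n rvec) \<Rightarrow> ('m \<Rightarrow> 'n rvec) \<Rightarrow> 'm
    \<Rightarrow> real^'n \<Rightarrow> real^'n" where
  "affine_shape c f \<xi> p u = - tangential_part c f \<xi> p (push c \<xi> p u)"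

definition transversal_form ::
  "('m, real^'n::finite) chart \<Rightarrow> ('m \<Rightarrow> 'n rvec) \<Rightarrow> ('m \<Rightarrow> 'n rvec) \<Rightarrow> 'm \<Rightarrow> real^'n \<Rightarrow> real" where
  "transversal_form c f \<xi> p u = transversal_part c f \<xi> p (push c \<xi> p u)"

definition equiaffine ::
  "('m, real^'n::finite) manifold \<Rightarrow> ('m \<Rightarrow> 'n rvec) \<Rightarrow> ('m \<Rightarrow> 'n rvec) \<Rightarrow> bool" where
  "equiaffine M f \<xi> \<longleftrightarrow> affine_immersion M f \<xi> \<and>
     (\<forall>p\<in>topspace (mtop M). \<forall>c\<in>charts_at M p. \<forall>u. transversal_form c f \<xi> p u = 0)"

definition nondegenerate_affine ::
  "('m, real^'n::finite) manifold \<Rightarrow> ('m \<Rightarrow> 'n rvec) \<Rightarrow> ('m \<Rightarrow> 'n rvec) \<Rightarrow> bool" where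
  "nondegenerate_affine M f \<xi> \<longleftrightarrow> affine_immersion M f \<xi> \<and>
     (\<forall>p\<in>topspace (mtop M). \<forall>c\<in>charts_at M p. nondegenerate_form (affine_metric c f \<xi> p))"

definition conormal ::
  "('m, real^'n::finite) manifold \<Rightarrow> ('m \<Rightarrow> 'n rvec) \<Rightarrow> ('m \<Rightarrow> 'n rvec) \<Rightarrow> 'm \<Rightarrow> 'n rvec" where
  "conormal M f \<xi> p =
     (THE \<alpha>. \<alpha> \<bullet> \<xi> p = 1 \<and> (\<forall>c\<in>charts_at M p. \<forall>u. \<alpha> \<bullet> push c f p u = 0))"

definition theta_form ::
  "('m, real^'n::finite) chart \<Rightarrow> ('m \<Rightarrow> 'n rvec) \<Rightarrow> ('m \<Rightarrow> 'n rvec) \<Rightarrow> 'm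
    \<Rightarrow> ('n \<Rightarrow> real^'n) \<Rightarrow> real" where
  "theta_form c f \<xi> p X =
     det (\<chi> i. case i of None \<Rightarrow> \<xi> p | Some j \<Rightarrow> push c f p (X j))"

definition volume_form ::
  "(real^'n::finite \<Rightarrow> real^'n \<Rightarrow> real) \<Rightarrow> ('n \<Rightarrow> real^'n) \<Rightarrow> real" where
  "volume_form b X = sqrt \<bar>det (gram b)\<bar> * det (\<chi> i. X i)"

text \<open>The two volume forms vanish nowhere, so the sign below is automatically locally constant;
  it may depend on the connected component.\<close>

definition blaschke ::
  "('m, real^'n::finite) manifold \<Rightarrow> ('m \<Rightarrow> 'n rvec) \<Rightarrow> ('m \<Rightarrow> 'n rvec) \<Rightarrow> bool" where
  "blaschke M f \<xi> \<longleftrightarrow> equiaffine M f \<xi> \<and> nondegenerate_affine M f \<xi> \<and>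
     (\<forall>p\<in>topspace (mtop M). \<forall>c\<in>charts_at M p. \<exists>\<epsilon>\<in>{1, -1}. \<forall>X.
        theta_form c f \<xi> p X = \<epsilon> * volume_form (affine_metric c f \<xi> p) X)"

definition proper_affine_sphere ::
  "('m, real^'n::finite) manifold \<Rightarrow> ('m \<Rightarrow> 'n rvec) \<Rightarrow> ('m \<Rightarrow> 'n rvec) \<Rightarrow> bool" where
  "proper_affine_sphere M f \<xi> \<longleftrightarrow> blaschke M f \<xi> \<and>
     (\<exists>l::'m \<Rightarrow> real. \<forall>p\<in>topspace (mtop M). l p \<noteq> 0 \<and>
        (\<forall>c\<in>charts_at M p. \<forall>u. affine_shape c f \<xi> p u = - (l p *\<^sub>R u)))"

definition locally_constant :: "'m topology \<Rightarrow> ('m \<Rightarrow> 'v) \<Rightarrow> bool" where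
  "locally_constant T F \<longleftrightarrow>
     (\<forall>p\<in>topspace T. \<exists>U. openin T U \<and> p \<in> U \<and> (\<forall>q\<in>U. F q = F p))"

definition centroaffine_proper_affine_sphere ::
  "('m, real^'n::finite) manifold \<Rightarrow> ('m \<Rightarrow> 'n rvec) \<Rightarrow> bool" where
  "centroaffine_proper_affine_sphere M f \<longleftrightarrow> affine_immersion M f f \<and>
     (\<exists>c::'m \<Rightarrow> real. locally_constant (mtop M) c \<and> (\<forall>p\<in>topspace (mtop M). c p \<noteq> 0) \<and>
        proper_affine_sphere M f (\<lambda>p. c p *\<^sub>R f p))"

section \<open>Pseudohyperbolic space and para-complex hyperbolic space\<close>

text \<open>All charts of the embedded submanifold \<open>S\<close>: the inverses of the local parametrisations that
  are smooth immersions into the ambient space and homeomorphisms onto open subsets of \<open>S\<close>.\<close>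

definition submanifold_charts ::
  "'v::euclidean_space set \<Rightarrow> ('v, 'a::euclidean_space) chart set" where
  "submanifold_charts S = {c. openin (top_of_set S) (fst c) \<and> open (snd c ` fst c) \<and>
     homeomorphic_map (top_of_set (fst c)) (top_of_set (snd c ` fst c)) (snd c) \<and>
     smooth_on (snd c ` fst c) (chart_inv c) \<and>
     (\<forall>z\<in>fst c. inj (push c (\<lambda>x. x) z))}"

text \<open>Since \<open>push c (\<lambda>x. x)\<close> is the differential of the inclusion, the metric here is the
  restriction of the bilinear form \<open>b\<close>.\<close>

definition pr_submanifold ::
  "('v::euclidean_space \<Rightarrow> 'v \<Rightarrow> real) \<Rightarrow> 'v set \<Rightarrow> ('v, 'a::euclidean_space) pr_manifold" where
  "pr_submanifold b S = \<lparr> mtop = top_of_set S, charts = submanifold_charts S,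
     pr_metric = (\<lambda>c z u w. b (push c (\<lambda>x. x) z u) (push c (\<lambda>x. x) z w)) \<rparr>"

definition ghat :: "('n::finite rvec \<times> 'n rvec) \<Rightarrow> ('n rvec \<times> 'n rvec) \<Rightarrow> real" where
  "ghat x y = (snd x \<bullet> fst y + snd y \<bullet> fst x) / 2"

definition hyp_set :: "('n::finite rvec \<times> 'n rvec) set" where
  "hyp_set = {(v, \<alpha>). \<alpha> \<bullet> v = -1}"

definition pseudohyperbolic ::
  "('n::finite rvec \<times> 'n rvec, (real^'n) \<times> (real^'n) \<times> real) pr_manifold" where
  "pseudohyperbolic = pr_submanifold ghat hyp_set"

definition horizontal :: "('n::finite rvec \<times> 'n rvec) \<Rightarrow> ('n rvec \<times> 'n rvec) set" where
  "horizontal z = {(w, \<beta>). snd z \<bullet> w = 0 \<and> \<beta> \<bullet> fst z = 0}"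

definition act :: "real \<Rightarrow> ('n::finite rvec \<times> 'n rvec) \<Rightarrow> ('n rvec \<times> 'n rvec)" where
  "act t z = (exp t *\<^sub>R fst z, exp (- t) *\<^sub>R snd z)"

text \<open>The quotient map, sending a point to its orbit.\<close>

definition pi_minus :: "('n::finite rvec \<times> 'n rvec) \<Rightarrow> ('n rvec \<times> 'n rvec) set" where
  "pi_minus z = range (\<lambda>t. act t z)"

definition sigma_minus ::
  "('m, real^'n::finite) manifold \<Rightarrow> ('m \<Rightarrow> 'n rvec) \<Rightarrow> ('m \<Rightarrow> 'n rvec)
    \<Rightarrow> 'm \<Rightarrow> ('n rvec \<times> 'n rvec)" where
  "sigma_minus M f \<xi> p = (- \<xi> p, conormal M f \<xi> p)"

definition quotient_topology :: "'x topology \<Rightarrow> ('x \<Rightarrow> 'y) \<Rightarrow> 'y topology" where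
  "quotient_topology T \<pi> =
     topology (\<lambda>U. U \<subseteq> \<pi> ` topspace T \<and> openin T {x \<in> topspace T. \<pi> x \<in> U})"

lemma openin_quotient_topology:
  "openin (quotient_topology T \<pi>) U \<longleftrightarrow>
     U \<subseteq> \<pi> ` topspace T \<and> openin T {x \<in> topspace T. \<pi> x \<in> U}"
proof -
  have "istopology (\<lambda>U. U \<subseteq> \<pi> ` topspace T \<and> openin T {x \<in> topspace T. \<pi> x \<in> U})"
    unfolding istopology_def
  proof (intro conjI allI impI)
    fix A B
    assume "A \<subseteq> \<pi> ` topspace T \<and> openin T {x \<in> topspace T. \<pi> x \<in> A}"
      and "B \<subseteq> \<pi> ` topspace T \<and> openin T {x \<in> topspace T. \<pi> x \<in> B}"
    moreover have "{x \<in> topspace T. \<pi> x \<in> A \<inter> B}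
        = {x \<in> topspace T. \<pi> x \<in> A} \<inter> {x \<in> topspace T. \<pi> x \<in> B}" by auto
    ultimately show "A \<inter> B \<subseteq> \<pi> ` topspace T" "openin T {x \<in> topspace T. \<pi> x \<in> A \<inter> B}"
      by auto
  next
    fix \<K>
    assume K: "\<forall>A\<in>\<K>. A \<subseteq> \<pi> ` topspace T \<and> openin T {x \<in> topspace T. \<pi> x \<in> A}"
    then show "\<Union> \<K> \<subseteq> \<pi> ` topspace T" by auto
    have "{x \<in> topspace T. \<pi> x \<in> \<Union> \<K>} = \<Union> ((\<lambda>A. {x \<in> topspace T. \<pi> x \<in> A}) ` \<K>)" by auto
    then show "openin T {x \<in> topspace T. \<pi> x \<in> \<Union> \<K>}" using K by auto
  qed
  then show ?thesis by (simp add: quotient_topology_def topology_inverse')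
qed

lemma topspace_quotient_topology: "topspace (quotient_topology T \<pi>) = \<pi> ` topspace T"
proof -
  have "{x \<in> topspace T. \<pi> x \<in> \<pi> ` topspace T} = topspace T" by auto
  then have "openin (quotient_topology T \<pi>) (\<pi> ` topspace T)"
    by (simp add: openin_quotient_topology)
  moreover have "topspace (quotient_topology T \<pi>) \<subseteq> \<pi> ` topspace T"
    using openin_topspace[of "quotient_topology T \<pi>"] unfolding openin_quotient_topology by blast
  ultimately show ?thesis by (meson openin_subset subset_antisym)
qed

text \<open>All charts of the unique smooth structure on the quotient for which the quotient map is
  a smooth submersion: the local homeomorphisms whose composition with the quotient map is
  a smooth submersion.\<close>

definition quotient_charts ::
  "('x, 'b::euclidean_space, 'z) manifold_scheme \<Rightarrow> ('x \<Rightarrow> 'y)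
    \<Rightarrow> ('y, 'a::euclidean_space) chart set" where
  "quotient_charts N \<pi> = {c.
     openin (quotient_topology (mtop N) \<pi>) (fst c) \<and> open (snd c ` fst c) \<and>
     homeomorphic_map (subtopology (quotient_topology (mtop N) \<pi>) (fst c))
       (top_of_set (snd c ` fst c)) (snd c) \<and>
     (\<forall>k\<in>charts N. smooth_on (snd k ` {z \<in> fst k. \<pi> z \<in> fst c}) (snd c \<circ> \<pi> \<circ> chart_inv k) \<and>
        (\<forall>z\<in>fst k. \<pi> z \<in> fst c \<longrightarrow> surj (push k (snd c \<circ> \<pi>) z)))}"

text \<open>The vector with coordinates \<open>x\<close> in the chart \<open>k\<close> around \<open>z\<close> is the horizontal lift of the
  tangent vector of the quotient with coordinates \<open>u\<close> in the chart \<open>c\<close> around \<open>pi_minus z\<close>.\<close>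

definition horizontal_lift ::
  "(('n::finite rvec \<times> 'n rvec) set, (real^'n) \<times> (real^'n)) chart
    \<Rightarrow> ('n rvec \<times> 'n rvec, (real^'n) \<times> (real^'n) \<times> real) chart
    \<Rightarrow> ('n rvec \<times> 'n rvec) \<Rightarrow> (real^'n) \<times> (real^'n) \<Rightarrow> (real^'n) \<times> (real^'n) \<times> real \<Rightarrow> bool" where
  "horizontal_lift c k z u x \<longleftrightarrow>
     push k (\<lambda>y. y) z x \<in> horizontal z \<and> push k (snd c \<circ> pi_minus) z x = u"

text \<open>The value of the metric at the orbit \<open>P\<close> is the common value of the metric upstairs on the
  horizontal lifts at all points of \<open>P\<close>.\<close>

definition para_hyperbolic ::
  "(('n::finite rvec \<times> 'n rvec) set, (real^'n) \<times> (real^'n)) pr_manifold" where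
  "para_hyperbolic = \<lparr> mtop = quotient_topology (mtop pseudohyperbolic) pi_minus,
     charts = quotient_charts pseudohyperbolic pi_minus,
     pr_metric = (\<lambda>c P u w. THE r. \<forall>z\<in>P. \<forall>k\<in>charts_at pseudohyperbolic z. \<forall>x y.
        horizontal_lift c k z u x \<and> horizontal_lift c k z w y \<longrightarrow>
          r = pr_metric pseudohyperbolic k z x y) \<rparr>"

end

theory Submission
  imports Defs
begin

text \<open>In a chart the pair \<open>(\<xi>, \<nu>)\<close> is dual: \<open>\<nu> \<bullet> \<xi> = 1\<close>, and each is annihilated by the differential
  of the other. The induced metric of \<open>\<sigma>\<^sup>-\<close> is \<open>G(u, w) = - d\<nu>(u) \<bullet> d\<xi>(w)\<close>, which is also the centroaffine
  metric of \<open>\<nu>\<close>, and by the symmetry of \<open>G\<close> the image of \<open>\<sigma>\<^sup>-\<close> is horizontal and Lagrangian.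
  Pseudohyperbolic space is a submanifold of a flat space, and so is its quotient, by means of
  \<open>(v, \<alpha>) \<mapsto> v \<otimes> \<alpha>\<close>; hence both second fundamental forms are found by differentiating twice in a
  vector space and taking normal components, and both are half the cubic form
  \<open>C(u, w, z) = d\<nu>(z) \<bullet> D\<^sup>2\<xi>(u, w) - D\<^sup>2\<nu>(u, w) \<bullet> d\<xi>(z)\<close>, up to sign. So (i) and (ii) both say that
  the trace of \<open>C\<close> with respect to \<open>G\<close> vanishes. On the other hand this trace is the logarithmic
  derivative of \<open>Q = det(\<nu>, d\<nu>) / det(\<xi>, - d\<xi>) = det(\<nu>, d\<nu>)\<^sup>2 / det G\<close>, and
  \<open>(\<nu>, r \<nu>)\<close> is a Blaschke immersion exactly if \<open>\<bar>Q\<bar> \<bar>r\<bar>\<^bsup>n+2\<^esup> = 1\<close>; so (iii) says that \<open>Q\<close> is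
  locally constant.\<close>

section \<open>Calculus of smooth maps\<close>

text \<open>The ingredients of mean curvature (Christoffel symbols, normal part, metric on orbits)
  are given by \<open>THE\<close> in arbitrary charts and are determined only through pairings. So
  the mean curvature vector is never computed: it is tested against normal vectors, where second
  derivatives in a vector space suffice. The horizontal normals are the images (d\<xi>(z),
  d\<nu>(z)) of the tangent vectors (-d\<xi>(z), d\<nu>(z)) under the para-complex structure.
  Pseudohyperbolic space has one further normal direction, along the orbit. The second derivative
  has no component there, because its pairings with \<xi> and with \<nu> both return G; this is why
  both targets lead to one condition. Q is used instead of det(\<nu>, d\<nu>) because a change of
  chart multiplies both its determinants by the same Jacobian, so that Q is a function on M. A
  separate obstacle is regularity: \<sigma> is visibly smooth in the flat space, while smoothness is
  defined in charts of the target. It is obtained by cancelling an immersion on the left of a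
  continuous map, which may go into a space of larger dimension.\<close>

abbreviation fd :: "('a::real_normed_vector \<Rightarrow> 'b::real_normed_vector) \<Rightarrow> 'a \<Rightarrow> 'a \<Rightarrow> 'b" where
  "fd F x \<equiv> frechet_derivative F (at x)"

lemma fd_works: "F differentiable (at x) \<Longrightarrow> (F has_derivative fd F x) (at x)"
  using frechet_derivative_works by blast

lemma fd_eq: "(F has_derivative F') (at x) \<Longrightarrow> fd F x = F'"
  using frechet_derivative_at by metis

text \<open>\<open>frechet_derivative\<close> is a choice among all derivatives. Equal germs have
  the same derivatives, hence the same choice, whether or not the point is one of
  differentiability.\<close>

lemma fd_cong: "open U \<Longrightarrow> x \<in> U \<Longrightarrow> (\<And>y. y \<in> U \<Longrightarrow> F y = G y) \<Longrightarrow> fd F x = fd G x"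
proof -
  assume U: "open U" "x \<in> U" "\<And>y. y \<in> U \<Longrightarrow> F y = G y"
  have "(F has_derivative F') (at x) \<longleftrightarrow> (G has_derivative F') (at x)" for F'
    using has_derivative_transform_within_open[OF _ U]
      has_derivative_transform_within_open[OF _ U(1,2), of G F' UNIV F] U(3) by auto
  then show ?thesis unfolding frechet_derivative_def by simp
qed

lemma differentiable_cong_open:
  "open U \<Longrightarrow> x \<in> U \<Longrightarrow> (\<And>y. y \<in> U \<Longrightarrow> F y = G y) \<Longrightarrow> F differentiable (at x) \<Longrightarrow> G differentiable (at x)"
  unfolding differentiable_def using has_derivative_transform_within_open by blast

lemma Ck_on_cong:
  "open U \<Longrightarrow> (\<And>x. x \<in> U \<Longrightarrow> F x = G x) \<Longrightarrow> Ck_on k U F \<Longrightarrow> Ck_on k U G"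
proof (induction k arbitrary: F G)
  case 0
  have "continuous_on U F" using 0(3) by simp
  from continuous_on_eq[OF this 0(2)] show ?case by simp
next
  case (Suc k)
  have "Ck_on k U (\<lambda>x. fd G x v)" for v
  proof (rule Suc.IH[OF Suc.prems(1)])
    show "fd F x v = fd G x v" if "x \<in> U" for x
      using fd_cong[OF Suc.prems(1) that Suc.prems(2)] by simp
    show "Ck_on k U (\<lambda>x. fd F x v)" using Suc.prems(3) by simp
  qed
  moreover have "G differentiable (at x)" if "x \<in> U" for x
  proof -
    have "F differentiable (at x)" using Suc.prems(3) that by simp
    from differentiable_cong_open[OF Suc.prems(1) that Suc.prems(2) this] show ?thesis .
  qed
  ultimately show ?case by simp
qed

lemma Ck_on_subset: "V \<subseteq> U \<Longrightarrow> Ck_on k U F \<Longrightarrow> Ck_on k V F"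
proof (induction k arbitrary: F)
  case 0
  then show ?case using continuous_on_subset by auto
qed auto

lemma Ck_on_imp_continuous_on: "Ck_on k U F \<Longrightarrow> continuous_on U F"
  by (cases k) (auto intro!: continuous_at_imp_continuous_on differentiable_imp_continuous_within)

lemma Ck_on_SucD: "Ck_on (Suc k) U F \<Longrightarrow> Ck_on k U F"
proof (induction k arbitrary: F)
  case 0
  then show ?case using Ck_on_imp_continuous_on[OF 0] by simp
qed auto

text \<open>Some maps are given by smooth formulas only near each point: the tensor embedding in a
  quotient chart, which needs a local section, and a locally constant multiple of the
  conormal.\<close>

lemma Ck_on_local:
  "(\<And>x. x \<in> U \<Longrightarrow> \<exists>V. open V \<and> x \<in> V \<and> Ck_on k V F) \<Longrightarrow> Ck_on k U F"
proof (induction k arbitrary: F)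
  case 0
  have "continuous (at x) F" if x: "x \<in> U" for x
  proof -
    obtain V where V: "open V" "x \<in> V" "Ck_on 0 V F" using 0[OF x] by blast
    then show ?thesis using continuous_on_eq_continuous_at by auto
  qed
  then show ?case by (simp add: continuous_at_imp_continuous_on)
next
  case (Suc k)
  have d: "F differentiable (at x)" if x: "x \<in> U" for x
  proof -
    obtain V where V: "open V" "x \<in> V" "Ck_on (Suc k) V F" using Suc.prems[OF x] by blast
    then show ?thesis by simp
  qed
  have "Ck_on k U (\<lambda>x. fd F x v)" for v
  proof (rule Suc.IH)
    fix x assume x: "x \<in> U"
    obtain V where V: "open V" "x \<in> V" "Ck_on (Suc k) V F" using Suc.prems[OF x] by blast
    then show "\<exists>V. open V \<and> x \<in> V \<and> Ck_on k V (\<lambda>x. fd F x v)" by (intro exI[of _ V]) simp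
  qed
  then show ?case using d by simp
qed

lemma Ck_on_const: "Ck_on k U (\<lambda>x. c)"
  by (induction k arbitrary: c) auto

lemma Ck_on_bounded_linear:
  "bounded_linear L \<Longrightarrow> open U \<Longrightarrow> Ck_on k U F \<Longrightarrow> Ck_on k U (\<lambda>x. L (F x))"
proof (induction k arbitrary: F)
  case 0
  then show ?case by (simp add: bounded_linear.continuous_on)
next
  case (Suc k)
  have d: "((\<lambda>x. L (F x)) has_derivative (\<lambda>v. L (fd F x v))) (at x)" if "x \<in> U" for x
    using Suc.prems that by (auto intro!: bounded_linear.has_derivative[OF Suc.prems(1)] fd_works)
  have "Ck_on k U (\<lambda>x. fd (\<lambda>x. L (F x)) x v)" for v
    by (rule Ck_on_cong[OF Suc.prems(2) _ Suc.IH[OF Suc.prems(1,2), of "\<lambda>x. fd F x v"]])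
      (use Suc.prems fd_eq[OF d] in auto)
  then show ?case using d by (auto simp: differentiable_def)
qed

lemma Ck_on_add: "open U \<Longrightarrow> Ck_on k U F \<Longrightarrow> Ck_on k U G \<Longrightarrow> Ck_on k U (\<lambda>x. F x + G x)"
proof (induction k arbitrary: F G)
  case 0
  then show ?case by (simp add: continuous_on_add)
next
  case (Suc k)
  have d: "((\<lambda>x. F x + G x) has_derivative (\<lambda>v. fd F x v + fd G x v)) (at x)" if "x \<in> U" for x
    using Suc.prems that by (auto intro!: has_derivative_add fd_works)
  have "Ck_on k U (\<lambda>x. fd (\<lambda>x. F x + G x) x v)" for v
    by (rule Ck_on_cong[OF Suc.prems(1) _ Suc.IH[of "\<lambda>x. fd F x v" "\<lambda>x. fd G x v"]])
      (use Suc.prems fd_eq[OF d] in auto)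
  then show ?case using d by (auto simp: differentiable_def)
qed

lemma Ck_on_sum:
  "open U \<Longrightarrow> (\<And>i. i \<in> I \<Longrightarrow> Ck_on k U (F i)) \<Longrightarrow> Ck_on k U (\<lambda>x. \<Sum>i\<in>I. F i x)"
  by (induction I rule: infinite_finite_induct) (auto intro: Ck_on_const Ck_on_add)

lemma Ck_on_bilinear:
  assumes "bounded_bilinear pr"
  shows "open U \<Longrightarrow> Ck_on k U F \<Longrightarrow> Ck_on k U G \<Longrightarrow> Ck_on k U (\<lambda>x. pr (F x) (G x))"
proof (induction k arbitrary: F G)
  case 0
  then show ?case by (simp add: bounded_bilinear.continuous_on[OF assms])
next
  case (Suc k)
  have d: "((\<lambda>x. pr (F x) (G x)) has_derivative (\<lambda>v. pr (F x) (fd G x v) + pr (fd F x v) (G x))) (at x)"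
    if "x \<in> U" for x
    using Suc.prems that by (auto intro!: bounded_bilinear.FDERIV[OF assms] fd_works)
  have "Ck_on k U (\<lambda>x. pr (F x) (fd G x v) + pr (fd F x v) (G x))" for v
    using Suc.prems by (intro Ck_on_add Suc.IH) (auto intro: Ck_on_SucD)
  then have "Ck_on k U (\<lambda>x. fd (\<lambda>x. pr (F x) (G x)) x v)" for v
    by (rule Ck_on_cong[OF Suc.prems(1), rotated]) (simp add: fd_eq[OF d])
  then show ?case using d by (auto simp: differentiable_def)
qed

lemma linear_eq_sum_Basis:
  fixes L :: "'a::euclidean_space \<Rightarrow> 'b::real_vector"
  assumes "linear L"
  shows "L v = (\<Sum>b\<in>Basis. (v \<bullet> b) *\<^sub>R L b)"
proof -
  have "L v = L (\<Sum>b\<in>Basis. (v \<bullet> b) *\<^sub>R b)" by (simp add: euclidean_representation)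
  then show ?thesis using assms by (simp add: linear_sum linear_cmul)
qed

lemma Ck_on_compose:
  fixes F :: "'a::real_normed_vector \<Rightarrow> 'b::euclidean_space" and G :: "'b \<Rightarrow> 'c::real_normed_vector"
  shows "open U \<Longrightarrow> F ` U \<subseteq> V \<Longrightarrow> Ck_on k U F \<Longrightarrow> Ck_on k V G \<Longrightarrow> Ck_on k U (\<lambda>x. G (F x))"
proof (induction k arbitrary: G)
  case 0
  then show ?case by (auto intro: continuous_on_compose2)
next
  case (Suc k)
  have d: "((\<lambda>x. G (F x)) has_derivative (\<lambda>v. fd G (F x) (fd F x v))) (at x)" if "x \<in> U" for x
    using Suc.prems that
    by (auto intro!: has_derivative_compose[where f=F] fd_works)
  \<comment> \<open>\<open>Ck_on\<close> controls derivatives along constant vectors only. The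
    direction \<open>fd F x v\<close> moves with \<open>x\<close>; expanding it in the basis of the
    middle space turns the chain rule into a sum of products.\<close>
  have e: "fd (\<lambda>x. G (F x)) x v = (\<Sum>b\<in>Basis. (fd F x v \<bullet> b) *\<^sub>R fd G (F x) b)" if "x \<in> U" for x v
  proof -
    have "linear (fd G (F x))" using Suc.prems that by (auto intro!: linear_frechet_derivative)
    then show ?thesis using fd_eq[OF d[OF that]] linear_eq_sum_Basis by metis
  qed
  have "Ck_on k U (\<lambda>x. \<Sum>b\<in>Basis. (fd F x v \<bullet> b) *\<^sub>R fd G (F x) b)" for v
  proof (intro Ck_on_sum Ck_on_bilinear[OF bounded_bilinear_scaleR])
    show "Ck_on k U (\<lambda>x. fd F x v \<bullet> b)" for b
      using Suc.prems by (intro Ck_on_bounded_linear[OF bounded_linear_inner_left]) auto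
    show "Ck_on k U (\<lambda>x. fd G (F x) b)" for b
      using Suc.prems by (intro Suc.IH) (auto intro: Ck_on_SucD)
  qed (use Suc.prems in auto)
  then have "Ck_on k U (\<lambda>x. fd (\<lambda>x. G (F x)) x v)" for v
    by (rule Ck_on_cong[OF Suc.prems(1), rotated]) (simp add: e)
  then show ?case using d by (auto simp: differentiable_def)
qed

lemma Ck_on_inverse:
  fixes F :: "'a::real_normed_vector \<Rightarrow> real"
  shows "open U \<Longrightarrow> (\<And>x. x \<in> U \<Longrightarrow> F x \<noteq> 0) \<Longrightarrow> Ck_on k U F \<Longrightarrow> Ck_on k U (\<lambda>x. inverse (F x))"
proof (induction k)
  case 0
  then show ?case by (auto intro: continuous_on_inverse)
next
  case (Suc k)
  have d: "((\<lambda>x. inverse (F x)) has_derivative (\<lambda>v. - (inverse (F x) * fd F x v * inverse (F x)))) (at x)"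
    if "x \<in> U" for x
    using Suc.prems that by (auto intro!: Deriv.has_derivative_inverse fd_works)
  have "Ck_on k U (\<lambda>x. - (inverse (F x) * fd F x v * inverse (F x)))" for v
    using Suc.prems(1,3) Suc.IH[OF Suc.prems(1,2) Ck_on_SucD[OF Suc.prems(3)]]
    by (intro Ck_on_bounded_linear[OF bounded_linear_minus[OF bounded_linear_ident]]
        Ck_on_bilinear[OF bounded_bilinear_mult]) auto
  from Ck_on_cong[OF Suc.prems(1) _ this]
  have "Ck_on k U (\<lambda>x. fd (\<lambda>x. inverse (F x)) x v)" for v
    using fd_eq[OF d] by (smt (verit))
  then show ?case using d by (auto simp: differentiable_def)
qed

section \<open>Cancelling immersions and injective linear maps\<close>

text \<open>A left inverse \<open>A\<close> of \<open>g'\<close> expresses the increment of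
  \<open>\<phi>\<close> by that of \<open>s\<close>, up to \<open>A\<close> applied to the remainder
  of \<open>g\<close>. That remainder is small only relative to the unknown increment of
  \<open>\<phi>\<close>. Hence a Lipschitz bound for \<open>\<phi>\<close> is obtained by absorption
  and then fed back into the estimate.\<close>

lemma has_derivative_left_factor:
  fixes \<phi> :: "'a::real_normed_vector \<Rightarrow> 'b::euclidean_space" and g :: "'b \<Rightarrow> 'c::euclidean_space"
  assumes g: "(g has_derivative g') (at (\<phi> x))" and inj: "inj g'"
    and cont: "continuous (at x) \<phi>" and s: "(s has_derivative s') (at x)"
    and T: "open T" "x \<in> T" "\<And>z. z \<in> T \<Longrightarrow> g (\<phi> z) = s z"
  shows "\<exists>\<phi>'. (\<phi> has_derivative \<phi>') (at x) \<and> (\<forall>u. g' (\<phi>' u) = s' u)"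
proof -
  have lin: "linear g'" using g has_derivative_linear by blast
  then obtain A where A: "linear A" "A \<circ> g' = id"
    using linear_injective_left_inverse inj by blast
  have Ag: "A (g' u) = u" for u using A(2) by (metis comp_apply id_apply)
  have blA: "bounded_linear A" using A(1) linear_conv_bounded_linear by blast
  obtain C where C: "C > 0" "\<And>y. norm (A y) \<le> C * norm y"
    using bounded_linear.pos_bounded[OF blA] by (auto simp: mult.commute)
  obtain K where K: "K > 0" "\<And>y. norm (s' y) \<le> K * norm y"
    using bounded_linear.pos_bounded[OF has_derivative_bounded_linear[OF s]] by (auto simp: mult.commute)
  have gest: "\<exists>d>0. \<forall>z. norm (z - x) < d \<longrightarrow>
      norm (g (\<phi> z) - g (\<phi> x) - g' (\<phi> z - \<phi> x)) \<le> e * norm (\<phi> z - \<phi> x)" if "e > 0" for e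
  proof -
    obtain d where d: "d > 0" "\<And>y. norm (y - \<phi> x) < d \<Longrightarrow> norm (g y - g (\<phi> x) - g' (y - \<phi> x)) \<le> e * norm (y - \<phi> x)"
      using conjunct2[OF g[unfolded has_derivative_at_alt], rule_format, OF \<open>e > 0\<close>] by auto
    obtain d' where d': "d' > 0" "\<And>z. norm (z - x) < d' \<Longrightarrow> norm (\<phi> z - \<phi> x) < d"
      using cont[unfolded continuous_at_eps_delta dist_norm, rule_format, OF d(1)] by auto
    show ?thesis by (intro exI[of _ d'] conjI allI impI d' d(2))
  qed
  have sest: "\<exists>d>0. \<forall>z. norm (z - x) < d \<longrightarrow> norm (s z - s x - s' (z - x)) \<le> e * norm (z - x)"
    if "e > 0" for e using conjunct2[OF s[unfolded has_derivative_at_alt], rule_format, OF that] .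
  obtain dT where dT: "dT > 0" "\<And>z. norm (z - x) < dT \<Longrightarrow> z \<in> T"
    using T(1,2) unfolding open_dist dist_norm by blast
  have key: "\<phi> z - \<phi> x - A (s' (z - x)) =
      A (s z - s x - s' (z - x)) - A (g (\<phi> z) - g (\<phi> x) - g' (\<phi> z - \<phi> x))" if "z \<in> T" for z
    using T(2,3) that by (simp add: linear_diff[OF A(1)] Ag)
  \<comment> \<open>\<open>A\<close> enlarges norms at most by \<open>C\<close>, so with this
    constant the remainder of \<open>g\<close> contributes at most half of
    \<open>norm (\<phi> z - \<phi> x)\<close> and can be moved to the other side.\<close>
  have "1 / (2 * C) > 0" using C by simp
  obtain d1 where d1: "d1 > 0" "\<And>z. norm (z - x) < d1 \<Longrightarrow>
      norm (g (\<phi> z) - g (\<phi> x) - g' (\<phi> z - \<phi> x)) \<le> 1 / (2 * C) * norm (\<phi> z - \<phi> x)"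
      using gest[OF \<open>1 / (2 * C) > 0\<close>] by auto
  obtain d2 where d2: "d2 > 0" "\<And>z. norm (z - x) < d2 \<Longrightarrow> norm (s z - s x - s' (z - x)) \<le> 1 * norm (z - x)"
    using sest[of 1] by auto
  define L where "L = 2 * C * (1 + K)"
  have Lp: "L > 0" using C K by (simp add: L_def)
  have lip: "norm (\<phi> z - \<phi> x) \<le> L * norm (z - x)" if "norm (z - x) < Min {dT, d1, d2}" for z
  proof -
    have z: "z \<in> T" "norm (z - x) < d1" "norm (z - x) < d2" using that dT by auto
    have "norm (\<phi> z - \<phi> x) = norm (A (s z - s x) - A (g (\<phi> z) - g (\<phi> x) - g' (\<phi> z - \<phi> x)))"
      using key[OF z(1)] by (simp add: linear_diff[OF A(1)])
    also have "\<dots> \<le> norm (A (s z - s x)) + norm (A (g (\<phi> z) - g (\<phi> x) - g' (\<phi> z - \<phi> x)))"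
      by (rule norm_triangle_ineq4)
    also have "\<dots> \<le> C * norm (s z - s x) + C * (1 / (2 * C) * norm (\<phi> z - \<phi> x))"
      using C d1(2)[OF z(2)] by (intro add_mono order_trans[OF C(2)] mult_left_mono) auto
    also have "C * (1 / (2 * C) * norm (\<phi> z - \<phi> x)) = norm (\<phi> z - \<phi> x) / 2" using C by simp
    finally have a: "norm (\<phi> z - \<phi> x) \<le> 2 * C * norm (s z - s x)" by simp
    have "norm (s z - s x) \<le> norm (s z - s x - s' (z - x)) + norm (s' (z - x))"
      by (metis diff_add_cancel norm_triangle_ineq)
    also have "\<dots> \<le> 1 * norm (z - x) + K * norm (z - x)" using d2(2)[OF z(3)] K by (intro add_mono) auto
    also have "\<dots> = (1 + K) * norm (z - x)" by (simp add: algebra_simps)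
    finally have "2 * C * norm (s z - s x) \<le> 2 * C * ((1 + K) * norm (z - x))"
      using C by (intro mult_left_mono) auto
    then show ?thesis using a by (simp add: L_def mult.assoc)
  qed
  have "(\<phi> has_derivative (\<lambda>u. A (s' u))) (at x)"
    unfolding has_derivative_at_alt
  proof (intro conjI allI impI)
    show "bounded_linear (\<lambda>u. A (s' u))"
      using bounded_linear_compose[OF blA has_derivative_bounded_linear[OF s]] .
    fix e :: real assume e: "e > 0"
    \<comment> \<open>Half of \<open>e\<close> for each remainder; the remainder of \<open>g\<close>
      is measured by the increment of \<open>\<phi>\<close>, so its half also pays for the Lipschitz
      constant \<open>L\<close>.\<close>
    have "e / (2 * C) > 0" "e / (2 * C * L) > 0" using e C Lp by auto
    obtain d3 where d3: "d3 > 0" "\<And>z. norm (z - x) < d3 \<Longrightarrow> norm (s z - s x - s' (z - x)) \<le> e / (2 * C) * norm (z - x)"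
      using sest[OF \<open>e / (2 * C) > 0\<close>] by auto
    obtain d4 where d4: "d4 > 0" "\<And>z. norm (z - x) < d4 \<Longrightarrow>
      norm (g (\<phi> z) - g (\<phi> x) - g' (\<phi> z - \<phi> x)) \<le> e / (2 * C * L) * norm (\<phi> z - \<phi> x)"
      using gest[OF \<open>e / (2 * C * L) > 0\<close>] by auto
    have "norm (\<phi> z - \<phi> x - A (s' (z - x))) \<le> e * norm (z - x)" if "norm (z - x) < Min {dT, d1, d2, d3, d4}" for z
    proof -
      have z: "z \<in> T" "norm (z - x) < d3" "norm (z - x) < d4" "norm (z - x) < Min {dT, d1, d2}" using that dT by auto
      have "norm (\<phi> z - \<phi> x - A (s' (z - x))) \<le>
          norm (A (s z - s x - s' (z - x))) + norm (A (g (\<phi> z) - g (\<phi> x) - g' (\<phi> z - \<phi> x)))"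
        unfolding key[OF z(1)] by (rule norm_triangle_ineq4)
      also have "\<dots> \<le> C * (e / (2 * C) * norm (z - x)) + C * (e / (2 * C * L) * (L * norm (z - x)))"
      proof (intro add_mono order_trans[OF C(2)] mult_left_mono)
        show "norm (g (\<phi> z) - g (\<phi> x) - g' (\<phi> z - \<phi> x)) \<le> e / (2 * C * L) * (L * norm (z - x))"
          by (rule order_trans[OF d4(2)[OF z(3)] mult_left_mono[OF lip[OF z(4)]]]) (use C Lp e in simp)
      qed (use C d3(2)[OF z(2)] in auto)
      also have "\<dots> = e * norm (z - x)" using C Lp by (simp add: field_simps)
      finally show ?thesis .
    qed
    then show "\<exists>d>0. \<forall>y. norm (y - x) < d \<longrightarrow> norm (\<phi> y - \<phi> x - A (s' (y - x))) \<le> e * norm (y - x)"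
      using dT d1 d2 d3 d4 by (intro exI[of _ "Min {dT, d1, d2, d3, d4}"]) auto
  qed
  \<comment> \<open>\<open>A\<close> inverts \<open>g'\<close> on one side only. That the values of
    \<open>s'\<close> lie in the range of \<open>g'\<close> comes from the uniqueness of the
    derivative of \<open>s\<close>.\<close>
  moreover from this have "((\<lambda>z. g (\<phi> z)) has_derivative (\<lambda>u. g' (A (s' u)))) (at x)"
    using has_derivative_compose g by blast
  then have "(s has_derivative (\<lambda>u. g' (A (s' u)))) (at x)"
    using has_derivative_transform_within_open T by blast
  then have "g' (A (s' u)) = s' u" for u using has_derivative_unique[OF s] by metis
  ultimately show ?thesis by blast
qed

text \<open>The injective map \<open>A y\<close> is bounded below by some \<open>m\<close>, and near
  \<open>y\<close> the map \<open>A x\<close> differs from it by less than \<open>m / 2\<close>. So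
  \<open>w x - w y\<close> is controlled by the residual of the old solution,
  \<open>b x - A x (w y)\<close>, which tends to 0.\<close>

lemma continuous_linear_solve:
  fixes A :: "'a::real_normed_vector \<Rightarrow> 'e::euclidean_space \<Rightarrow> 'c::euclidean_space"
  assumes lin: "\<And>x. x \<in> U \<Longrightarrow> linear (A x)" and inj: "\<And>x. x \<in> U \<Longrightarrow> inj (A x)"
    and U: "open U" and A: "\<And>e. continuous_on U (\<lambda>x. A x e)" and b: "continuous_on U b"
    and w: "\<And>x. x \<in> U \<Longrightarrow> A x (w x) = b x"
  shows "continuous_on U w"
proof (rule continuous_at_imp_continuous_on, rule)
  fix y assume y: "y \<in> U"
  have cA: "((\<lambda>x. A x e) \<longlongrightarrow> A y e) (at y)" for e
    using A[of e] y U by (simp add: continuous_on_eq_continuous_at isCont_def)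
  have cb: "(b \<longlongrightarrow> b y) (at y)" using b y U by (simp add: continuous_on_eq_continuous_at isCont_def)
  obtain m where m: "m > 0" "\<And>e. m * norm e \<le> norm (A y e)"
    using linear_inj_bounded_below_pos[OF lin[OF y] inj[OF y]] by blast
  define \<eta> where "\<eta> = (\<lambda>x. \<Sum>i\<in>Basis. norm (A x i - A y i))"
  define \<beta> where "\<beta> = (\<lambda>x. norm (b x - A x (w y)))"
  have \<eta>0: "(\<eta> \<longlongrightarrow> 0) (at y)" unfolding \<eta>_def
    by (intro tendsto_null_sum tendsto_norm_zero LIM_zero cA)
  have "((\<lambda>x. b x - A x (w y)) \<longlongrightarrow> b y - A y (w y)) (at y)" by (intro tendsto_diff cA cb)
  then have \<beta>0: "(\<beta> \<longlongrightarrow> 0) (at y)" unfolding \<beta>_def using w[OF y] tendsto_norm_zero by auto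
  have ev: "\<forall>\<^sub>F x in at y. x \<in> U \<and> \<eta> x < m / 2"
    using order_tendstoD(2)[OF \<eta>0, of "m/2"] m eventually_at_in_open'[OF U y]
    by (intro eventually_conj) auto
  have bound: "norm (w x - w y) \<le> 2 / m * \<beta> x" if x: "x \<in> U" "\<eta> x < m / 2" for x
  proof -
    let ?e = "w x - w y"
    have "norm (A x ?e - A y ?e) \<le> norm ?e * \<eta> x"
    proof -
      have "A x ?e - A y ?e = (\<Sum>i\<in>Basis. (?e \<bullet> i) *\<^sub>R (A x i - A y i))"
        using linear_eq_sum_Basis[OF lin[OF x(1)], of ?e] linear_eq_sum_Basis[OF lin[OF y], of ?e]
        by (simp add: scaleR_diff_right sum_subtractf)
      also have "norm \<dots> \<le> (\<Sum>i\<in>Basis. norm ?e * norm (A x i - A y i))"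
        by (rule sum_norm_le) (auto intro: mult_right_mono Basis_le_norm)
      finally show ?thesis by (simp add: \<eta>_def sum_distrib_left)
    qed
    moreover have "norm ?e * \<eta> x \<le> norm ?e * (m / 2)" using x(2) by (intro mult_left_mono) auto
    moreover have "m * norm ?e \<le> norm (A x ?e) + norm (A x ?e - A y ?e)"
      using m(2)[of ?e] norm_triangle_ineq4[of "A x ?e" "A x ?e - A y ?e"] by simp
    moreover have "norm (A x ?e) = \<beta> x"
      using linear_diff[OF lin[OF x(1)]] w[OF x(1)] by (simp add: \<beta>_def)
    ultimately have "m * norm ?e \<le> 2 * \<beta> x" by (simp add: mult.commute)
    then show ?thesis using m(1) by (simp add: field_simps)
  qed
  have "((\<lambda>x. w x - w y) \<longlongrightarrow> 0) (at y)"
  proof (rule Lim_null_comparison)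
    show "\<forall>\<^sub>F x in at y. norm (w x - w y) \<le> 2 / m * \<beta> x" using ev bound by (auto elim: eventually_mono)
    show "((\<lambda>x. 2 / m * \<beta> x) \<longlongrightarrow> 0) (at y)" using tendsto_mult_right_zero[OF \<beta>0, of "2 / m"] by simp
  qed
  then show "isCont w y" by (simp add: isCont_def LIM_zero_iff)
qed

text \<open>The map (x, e) \<mapsto> (x, A x e) has an injective derivative at (y, w y) and sends
  (x, w x) to (x, b x). It can therefore be cancelled.\<close>

lemma differentiable_linear_solve:
  fixes A :: "'a::euclidean_space \<Rightarrow> 'e::euclidean_space \<Rightarrow> 'c::euclidean_space"
  assumes lin: "\<And>x. x \<in> U \<Longrightarrow> linear (A x)" and inj: "\<And>x. x \<in> U \<Longrightarrow> inj (A x)"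
    and U: "open U" and A: "\<And>e. \<forall>x\<in>U. (\<lambda>x. A x e) differentiable (at x)"
    and b: "\<forall>x\<in>U. b differentiable (at x)"
    and w: "\<And>x. x \<in> U \<Longrightarrow> A x (w x) = b x" and y: "y \<in> U"
  shows "w differentiable (at y)"
proof -
  have "continuous_on U w"
    using A b
    by (intro continuous_linear_solve[OF lin inj U _ _ w])
      (auto intro!: continuous_at_imp_continuous_on differentiable_imp_continuous_within)
  then have cw: "isCont w y" using U y continuous_on_eq_continuous_at by blast
  define g where "g = (\<lambda>z::'a \<times> 'e. (fst z, \<Sum>i\<in>Basis. (snd z \<bullet> i) *\<^sub>R A (fst z) i))"
  define g' where "g' = (\<lambda>h::'a \<times> 'e. (fst h, \<Sum>i\<in>Basis. (w y \<bullet> i) *\<^sub>R fd (\<lambda>x. A x i) y (fst h) + (snd h \<bullet> i) *\<^sub>R A y i))"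
  have dA: "((\<lambda>z::'a \<times> 'e. A (fst z) i) has_derivative (\<lambda>h. fd (\<lambda>x. A x i) y (fst h))) (at (y, w y))" for i
    by (rule has_derivative_compose[where f=fst, of fst "(y, w y)" UNIV "\<lambda>x. A x i", simplified])
      (use A y in \<open>auto intro!: fd_works has_derivative_fst\<close>)
  have dg: "(g has_derivative g') (at ((\<lambda>x. (x, w x)) y))"
    unfolding g_def g'_def
    by (rule derivative_eq_intros dA refl)+ auto
  have ling: "linear g'" using dg has_derivative_linear by blast
  have "inj g'"
  proof (subst linear_injective_0[OF ling], intro allI impI)
    fix h assume "g' h = 0"
    then have h: "fst h = 0" "(\<Sum>i\<in>Basis. (w y \<bullet> i) *\<^sub>R fd (\<lambda>x. A x i) y (fst h) + (snd h \<bullet> i) *\<^sub>R A y i) = 0"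
      by (auto simp: g'_def zero_prod_def)
    have "fd (\<lambda>x. A x i) y 0 = 0" for i
      using A y by (intro linear_0 linear_frechet_derivative) auto
    then have "A y (snd h) = 0"
      using h linear_eq_sum_Basis[OF lin[OF y], of "snd h"] by simp
    then have "snd h = 0" using inj[OF y] linear_0[OF lin[OF y]] by (metis injD)
    then show "h = 0" using h(1) by (simp add: prod_eq_iff)
  qed
  have "((\<lambda>x. (x, b x)) has_derivative (\<lambda>h. (h, fd b y h))) (at y)"
    using b y by (intro has_derivative_Pair fd_works) auto
  moreover have "g ((\<lambda>x. (x, w x)) z) = (z, b z)" if "z \<in> U" for z
    using linear_eq_sum_Basis[OF lin[OF that], of "w z"] w[OF that] by (simp add: g_def)
  moreover have "isCont (\<lambda>x. (x, w x)) y" using cw by (intro continuous_Pair) auto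
  ultimately obtain \<phi>' where "((\<lambda>x. (x, w x)) has_derivative \<phi>') (at y)"
    using has_derivative_left_factor[where \<phi>="\<lambda>x. (x, w x)", OF dg \<open>inj g'\<close> _ _ U y] by meson
  from has_derivative_snd[OF this] show ?thesis by (auto simp: differentiable_def)
qed

text \<open>Differentiating \<open>A x (w x) = b x\<close> shows that \<open>fd w x v\<close> solves
  a system with the same \<open>A\<close> and a right-hand side with one derivative less, which is
  the induction step.\<close>

lemma Ck_on_linear_solve:
  fixes A :: "'a::euclidean_space \<Rightarrow> 'e::euclidean_space \<Rightarrow> 'c::euclidean_space"
  assumes lin: "\<And>x. x \<in> U \<Longrightarrow> linear (A x)" and inj: "\<And>x. x \<in> U \<Longrightarrow> inj (A x)" and U: "open U"
  shows "(\<And>e. Ck_on k U (\<lambda>x. A x e)) \<Longrightarrow> Ck_on k U b \<Longrightarrow> (\<And>x. x \<in> U \<Longrightarrow> A x (w x) = b x) \<Longrightarrow> Ck_on k U w"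
proof (induction k arbitrary: b w)
  case 0
  then show ?case using continuous_linear_solve[OF lin inj U] by simp
next
  case (Suc k)
  have dw: "w differentiable (at x)" if "x \<in> U" for x
    using Suc.prems that by (intro differentiable_linear_solve[OF lin inj U _ _ Suc.prems(3)]) auto
  have wk: "Ck_on k U w"
    by (rule Suc.IH[OF Ck_on_SucD[OF Suc.prems(1)] Ck_on_SucD[OF Suc.prems(2)] Suc.prems(3)])
  have eq: "A x (fd w x v) = fd b x v - (\<Sum>i\<in>Basis. (w x \<bullet> i) *\<^sub>R fd (\<lambda>x. A x i) x v)" if x: "x \<in> U" for x v
  proof -
    have dA: "((\<lambda>x. A x i) has_derivative fd (\<lambda>x. A x i) x) (at x)" for i
      using Suc.prems(1)[of i] x by (intro fd_works) auto
    have "((\<lambda>x. \<Sum>i\<in>Basis. (w x \<bullet> i) *\<^sub>R A x i) has_derivative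
        (\<lambda>v. \<Sum>i\<in>Basis. (w x \<bullet> i) *\<^sub>R fd (\<lambda>x. A x i) x v + (fd w x v \<bullet> i) *\<^sub>R A x i)) (at x)"
      by (intro has_derivative_sum has_derivative_scaleR dA has_derivative_inner_left fd_works dw x)
    moreover have "(\<Sum>i\<in>Basis. (w z \<bullet> i) *\<^sub>R A z i) = b z" if "z \<in> U" for z
      using linear_eq_sum_Basis[OF lin[OF that], of "w z"] Suc.prems(3)[OF that] by simp
    ultimately have "(b has_derivative
        (\<lambda>v. \<Sum>i\<in>Basis. (w x \<bullet> i) *\<^sub>R fd (\<lambda>x. A x i) x v + (fd w x v \<bullet> i) *\<^sub>R A x i)) (at x)"
      using has_derivative_transform_within_open[OF _ U x] by blast
    from fd_eq[OF this] show ?thesis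
      using linear_eq_sum_Basis[OF lin[OF x], of "fd w x v"] by (simp add: sum.distrib)
  qed
  have "Ck_on k U (\<lambda>x. fd w x v)" for v
  proof (rule Suc.IH[OF _ _ eq])
    have "Ck_on k U (\<lambda>x. fd b x v + (- 1) *\<^sub>R (\<Sum>i\<in>Basis. (w x \<bullet> i) *\<^sub>R fd (\<lambda>x. A x i) x v))"
    proof (intro Ck_on_add[OF U] Ck_on_sum[OF U] Ck_on_bilinear[OF bounded_bilinear_scaleR U]
        Ck_on_bounded_linear[OF bounded_linear_scaleR_right U] Ck_on_const)
      show "Ck_on k U (\<lambda>x. w x \<bullet> i)" for i
        using wk by (rule Ck_on_bounded_linear[OF bounded_linear_inner_left U])
      show "Ck_on k U (\<lambda>x. fd (\<lambda>x. A x i) x v)" for i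
        using Suc.prems(1)[of i] by simp
      show "Ck_on k U (\<lambda>x. fd b x v)" using Suc.prems(2) by simp
    qed
    then show "Ck_on k U (\<lambda>x. fd b x v - (\<Sum>i\<in>Basis. (w x \<bullet> i) *\<^sub>R fd (\<lambda>x. A x i) x v))" by simp
    show "Ck_on k U (\<lambda>x. A x e)" for e using Suc.prems(1) by (rule Ck_on_SucD)
  qed
  then show ?case using dw by simp
qed

text \<open>The derivative of \<open>\<phi>\<close> solves the injective linear system with
  coefficients \<open>fd g (\<phi> x)\<close>; the extra order of \<open>g\<close> pays for these
  coefficients. This passes from smoothness in the flat space to smoothness in a chart.\<close>

lemma Ck_on_left_factor:
  fixes \<phi> :: "'a::euclidean_space \<Rightarrow> 'b::euclidean_space" and g :: "'b \<Rightarrow> 'c::euclidean_space"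
  assumes U: "open U" and \<phi>U: "\<phi> ` U \<subseteq> V" and cont: "continuous_on U \<phi>"
    and inj: "\<And>y. y \<in> V \<Longrightarrow> inj (fd g y)" and eq: "\<And>x. x \<in> U \<Longrightarrow> g (\<phi> x) = s x"
  shows "Ck_on (Suc k) V g \<Longrightarrow> Ck_on k U s \<Longrightarrow> Ck_on k U \<phi>"
proof (induction k)
  case 0
  then show ?case using cont by simp
next
  case (Suc k)
  have \<phi>k: "Ck_on k U \<phi>" using Suc by (meson Ck_on_SucD)
  have ex: "\<exists>\<phi>'. (\<phi> has_derivative \<phi>') (at x) \<and> (\<forall>u. fd g (\<phi> x) (\<phi>' u) = fd s x u)" if x: "x \<in> U" for x
  proof (rule has_derivative_left_factor[OF fd_works inj _ fd_works U x eq])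
    show "isCont \<phi> x" using cont U x continuous_on_eq_continuous_at by blast
  qed (use Suc.prems \<phi>U x in auto)
  then have fd\<phi>: "fd g (\<phi> x) (fd \<phi> x v) = fd s x v" if "x \<in> U" for x v
    using that by (metis fd_eq)
  have "Ck_on k U (\<lambda>x. fd \<phi> x v)" for v
  proof (rule Ck_on_linear_solve[where A="\<lambda>x. fd g (\<phi> x)" and b="\<lambda>x. fd s x v", OF _ _ U])
    fix x assume "x \<in> U"
    then have "\<phi> x \<in> V" using \<phi>U by blast
    then have "g differentiable (at (\<phi> x))" using Suc.prems(1) by simp
    then show "linear (fd g (\<phi> x))" by (rule linear_frechet_derivative)
    show "inj (fd g (\<phi> x))" using \<open>\<phi> x \<in> V\<close> by (rule inj)
  next
    show "Ck_on k U (\<lambda>x. fd g (\<phi> x) e)" for e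
    proof -
      have "Ck_on (Suc k) V (\<lambda>y. fd g y e)" using Suc.prems(1) by simp
      from Ck_on_compose[OF U \<phi>U \<phi>k Ck_on_SucD[OF this]] show ?thesis .
    qed
    show "Ck_on k U (\<lambda>x. fd s x v)" using Suc.prems(2) by simp
    show "fd g (\<phi> x) (fd \<phi> x v) = fd s x v" if "x \<in> U" for x using that by (rule fd\<phi>)
  qed
  moreover have "\<phi> differentiable (at x)" if "x \<in> U" for x
    using ex[OF that] unfolding differentiable_def by blast
  ultimately show ?case by simp
qed

lemma smooth_onI: "(\<And>k. Ck_on k U F) \<Longrightarrow> smooth_on U F"
  by (simp add: smooth_on_def)

lemma smooth_onD: "smooth_on U F \<Longrightarrow> Ck_on k U F"
  by (simp add: smooth_on_def)

lemma smooth_on_differentiable: "smooth_on U F \<Longrightarrow> x \<in> U \<Longrightarrow> F differentiable (at x)"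
  using smooth_onD[of U F "Suc 0"] by simp

lemma smooth_on_works: "smooth_on U F \<Longrightarrow> x \<in> U \<Longrightarrow> (F has_derivative fd F x) (at x)"
  by (intro fd_works smooth_on_differentiable)

lemma smooth_on_linear_fd: "smooth_on U F \<Longrightarrow> x \<in> U \<Longrightarrow> linear (fd F x)"
  by (intro linear_frechet_derivative smooth_on_differentiable)

lemma smooth_on_fd: "smooth_on U F \<Longrightarrow> smooth_on U (\<lambda>x. fd F x v)"
  using smooth_onD[of U F "Suc k" for k] by (auto intro!: smooth_onI)

lemma smooth_on_continuous_on: "smooth_on U F \<Longrightarrow> continuous_on U F"
  using smooth_onD[of U F 0] by simp

lemma smooth_on_cong: "open U \<Longrightarrow> (\<And>x. x \<in> U \<Longrightarrow> F x = G x) \<Longrightarrow> smooth_on U F \<Longrightarrow> smooth_on U G"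
  by (rule smooth_onI, rule Ck_on_cong[OF _ _ smooth_onD])

lemma smooth_on_subset: "smooth_on U F \<Longrightarrow> V \<subseteq> U \<Longrightarrow> smooth_on V F"
  by (rule smooth_onI, rule Ck_on_subset[OF _ smooth_onD])

lemma smooth_on_local: "(\<And>x. x \<in> U \<Longrightarrow> \<exists>V. open V \<and> x \<in> V \<and> smooth_on V F) \<Longrightarrow> smooth_on U F"
  by (rule smooth_onI, rule Ck_on_local) (metis smooth_onD)

lemma smooth_on_const: "smooth_on U (\<lambda>x. c)"
  by (intro smooth_onI Ck_on_const)

lemma smooth_on_bounded_linear:
  "bounded_linear L \<Longrightarrow> open U \<Longrightarrow> smooth_on U F \<Longrightarrow> smooth_on U (\<lambda>x. L (F x))"
  by (rule smooth_onI, rule Ck_on_bounded_linear[OF _ _ smooth_onD])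

lemma smooth_on_ident: "open U \<Longrightarrow> smooth_on U (\<lambda>x. x)"
proof (rule smooth_onI)
  show "Ck_on k U (\<lambda>x. x)" for k by (cases k) (auto intro: Ck_on_const)
qed

lemma smooth_on_add: "open U \<Longrightarrow> smooth_on U F \<Longrightarrow> smooth_on U G \<Longrightarrow> smooth_on U (\<lambda>x. F x + G x)"
  by (rule smooth_onI, rule Ck_on_add[OF _ smooth_onD smooth_onD])

lemma smooth_on_bilinear:
  "bounded_bilinear pr \<Longrightarrow> open U \<Longrightarrow> smooth_on U F \<Longrightarrow> smooth_on U G \<Longrightarrow> smooth_on U (\<lambda>x. pr (F x) (G x))"
  by (rule smooth_onI, rule Ck_on_bilinear[OF _ _ smooth_onD smooth_onD])

lemma smooth_on_minus: "open U \<Longrightarrow> smooth_on U F \<Longrightarrow> smooth_on U (\<lambda>x. - F x)"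
  by (rule smooth_on_bounded_linear[OF bounded_linear_minus[OF bounded_linear_ident]])

lemma smooth_on_compose:
  fixes F :: "'a::real_normed_vector \<Rightarrow> 'b::euclidean_space" and G :: "'b \<Rightarrow> 'c::real_normed_vector"
  shows "open U \<Longrightarrow> F ` U \<subseteq> V \<Longrightarrow> smooth_on U F \<Longrightarrow> smooth_on V G \<Longrightarrow> smooth_on U (\<lambda>x. G (F x))"
  by (rule smooth_onI, rule Ck_on_compose[OF _ _ smooth_onD smooth_onD])

lemma smooth_on_inverse:
  fixes F :: "'a::real_normed_vector \<Rightarrow> real"
  shows "open U \<Longrightarrow> (\<And>x. x \<in> U \<Longrightarrow> F x \<noteq> 0) \<Longrightarrow> smooth_on U F \<Longrightarrow> smooth_on U (\<lambda>x. inverse (F x))"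
  by (rule smooth_onI, rule Ck_on_inverse[OF _ _ smooth_onD])

lemma smooth_on_Pair:
  assumes U: "open U" and F: "smooth_on U F" and G: "smooth_on U G"
  shows "smooth_on U (\<lambda>x. (F x, G x))"
proof -
  have "bounded_linear (\<lambda>y. (y, 0::'c))" "bounded_linear (\<lambda>y. (0::'b, y))"
    by (intro bounded_linear_Pair bounded_linear_ident bounded_linear_zero)+
  then have "smooth_on U (\<lambda>x. (F x, 0::'c) + (0::'b, G x))"
    by (intro smooth_on_add U) (rule smooth_on_bounded_linear[OF _ U F] smooth_on_bounded_linear[OF _ U G], assumption)+
  then show ?thesis by simp
qed

lemma smooth_on_fst: "open U \<Longrightarrow> smooth_on U F \<Longrightarrow> smooth_on U (\<lambda>x. fst (F x))"
  by (rule smooth_on_bounded_linear[OF bounded_linear_fst])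

lemma smooth_on_snd: "open U \<Longrightarrow> smooth_on U F \<Longrightarrow> smooth_on U (\<lambda>x. snd (F x))"
  by (rule smooth_on_bounded_linear[OF bounded_linear_snd])

lemmas smooth_on_scaleR = smooth_on_bilinear[OF bounded_bilinear_scaleR]
lemmas smooth_on_inner = smooth_on_bilinear[OF bounded_bilinear_inner]
lemmas smooth_on_mult = smooth_on_bilinear[OF bounded_bilinear_mult]

lemma smooth_on_linear_solve:
  fixes A :: "'a::euclidean_space \<Rightarrow> 'e::euclidean_space \<Rightarrow> 'c::euclidean_space"
  assumes "\<And>x. x \<in> U \<Longrightarrow> linear (A x)" and "\<And>x. x \<in> U \<Longrightarrow> inj (A x)" and "open U"
    and "\<And>e. smooth_on U (\<lambda>x. A x e)" and "smooth_on U b" and "\<And>x. x \<in> U \<Longrightarrow> A x (w x) = b x"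
  shows "smooth_on U w"
  by (rule smooth_onI, rule Ck_on_linear_solve[OF assms(1-3) smooth_onD smooth_onD assms(6)])
    (use assms in auto)

lemma smooth_on_left_factor:
  fixes \<phi> :: "'a::euclidean_space \<Rightarrow> 'b::euclidean_space" and g :: "'b \<Rightarrow> 'c::euclidean_space"
  assumes "open U" and "\<phi> ` U \<subseteq> V" and "continuous_on U \<phi>"
    and "\<And>y. y \<in> V \<Longrightarrow> inj (fd g y)" and "\<And>x. x \<in> U \<Longrightarrow> g (\<phi> x) = s x"
    and "smooth_on V g" and "smooth_on U s"
  shows "smooth_on U \<phi>"
  by (rule smooth_onI, rule Ck_on_left_factor[OF assms(1-5) smooth_onD[OF assms(6)] smooth_onD[OF assms(7)]])

lemma fd_compose:
  "F differentiable (at x) \<Longrightarrow> G differentiable (at (F x)) \<Longrightarrow> fd (\<lambda>x. G (F x)) x v = fd G (F x) (fd F x v)"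
  using fd_eq[OF has_derivative_compose[OF fd_works fd_works]] by metis

lemma fd_bilinear:
  assumes "bounded_bilinear pr" "F differentiable (at x)" "G differentiable (at x)"
  shows "fd (\<lambda>x. pr (F x) (G x)) x v = pr (F x) (fd G x v) + pr (fd F x v) (G x)"
  using fd_eq[OF bounded_bilinear.FDERIV[OF assms(1) fd_works[OF assms(2)] fd_works[OF assms(3)]]] by metis

lemmas fd_inner = fd_bilinear[OF bounded_bilinear_inner]

lemma fd_bounded_linear:
  "bounded_linear L \<Longrightarrow> F differentiable (at x) \<Longrightarrow> fd (\<lambda>x. L (F x)) x v = L (fd F x v)"
  using fd_eq[OF bounded_linear.has_derivative[OF _ fd_works]] by metis

section \<open>Symmetry of second derivatives\<close>

lemma has_field_derivative_along_line:
  assumes "F differentiable (at (a + s *\<^sub>R u))"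
  shows "((\<lambda>s. F (a + s *\<^sub>R u)) has_field_derivative (fd F (a + s *\<^sub>R u) u :: real)) (at s)"
proof -
  have "((\<lambda>s. a + s *\<^sub>R u) has_derivative (\<lambda>h. h *\<^sub>R u)) (at s)"
    by (auto intro!: derivative_eq_intros)
  from has_derivative_compose[OF this fd_works[OF assms]]
  have "((\<lambda>s. F (a + s *\<^sub>R u)) has_derivative (\<lambda>h. fd F (a + s *\<^sub>R u) (h *\<^sub>R u))) (at s)" .
  moreover have "fd F (a + s *\<^sub>R u) (h *\<^sub>R u) = fd F (a + s *\<^sub>R u) u * h" for h
    using linear_cmul[OF linear_frechet_derivative[OF assms], of h u] by (simp add: mult.commute)
  ultimately show ?thesis unfolding has_field_derivative_def by simp
qed

text \<open>The mean value theorem is applied to the difference of two translates of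
  \<open>G\<close> along \<open>u\<close>, and then to the derivative along \<open>w\<close>. The
  second difference thus becomes an exact value of a mixed derivative at a nearby point.\<close>

lemma second_difference_mvt:
  fixes G :: "'a::real_normed_vector \<Rightarrow> real"
  assumes h: "h > 0" and hr: "h * (norm u + norm w) < r"
    and dG: "\<And>y. y \<in> ball x r \<Longrightarrow> G differentiable (at y)"
    and dGu: "\<And>y. y \<in> ball x r \<Longrightarrow> (\<lambda>y. fd G y u) differentiable (at y)"
  shows "\<exists>y\<in>ball x r. G (x + h *\<^sub>R u + h *\<^sub>R w) - G (x + h *\<^sub>R u) - G (x + h *\<^sub>R w) + G x
    = h * h * fd (\<lambda>y. fd G y u) y w"
proof -
  have inb: "x + s *\<^sub>R u + t *\<^sub>R w \<in> ball x r" if "0 \<le> s" "s \<le> h" "0 \<le> t" "t \<le> h" for s t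
  proof -
    have "norm (s *\<^sub>R u + t *\<^sub>R w) \<le> s * norm u + t * norm w"
      using norm_triangle_ineq[of "s *\<^sub>R u" "t *\<^sub>R w"] that by simp
    also have "\<dots> \<le> h * norm u + h * norm w" using that by (intro add_mono mult_right_mono) auto
    also have "\<dots> < r" using hr by (simp add: algebra_simps)
    finally show ?thesis by (simp add: dist_norm algebra_simps norm_minus_commute)
  qed
  define g where "g = (\<lambda>s. G (x + h *\<^sub>R w + s *\<^sub>R u) - G (x + s *\<^sub>R u))"
  have "\<exists>z. 0 < z \<and> z < h \<and> g h - g 0 = (h - 0) * (fd G (x + h *\<^sub>R w + z *\<^sub>R u) u - fd G (x + z *\<^sub>R u) u)"
  proof (rule MVT2[OF h])
    fix s assume s: "0 \<le> s" "s \<le> h"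
    show "(g has_real_derivative fd G (x + h *\<^sub>R w + s *\<^sub>R u) u - fd G (x + s *\<^sub>R u) u) (at s)"
      unfolding g_def using inb[of s h] inb[of s 0] s h
      by (intro DERIV_diff has_field_derivative_along_line dG) (auto simp: algebra_simps)
  qed
  then obtain z where z: "0 < z" "z < h"
    "g h - g 0 = h * (fd G (x + h *\<^sub>R w + z *\<^sub>R u) u - fd G (x + z *\<^sub>R u) u)" by auto
  define k where "k = (\<lambda>t. fd G (x + z *\<^sub>R u + t *\<^sub>R w) u)"
  have "\<exists>t. 0 < t \<and> t < h \<and> k h - k 0 = (h - 0) * fd (\<lambda>y. fd G y u) (x + z *\<^sub>R u + t *\<^sub>R w) w"
  proof (rule MVT2[OF h])
    fix t assume t: "0 \<le> t" "t \<le> h"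
    show "(k has_real_derivative fd (\<lambda>y. fd G y u) (x + z *\<^sub>R u + t *\<^sub>R w) w) (at t)"
      unfolding k_def using inb[of z t] z t
      by (intro has_field_derivative_along_line dGu) auto
  qed
  then obtain t where t: "0 < t" "t < h" "k h - k 0 = h * fd (\<lambda>y. fd G y u) (x + z *\<^sub>R u + t *\<^sub>R w) w"
    by auto
  have "G (x + h *\<^sub>R u + h *\<^sub>R w) - G (x + h *\<^sub>R u) - G (x + h *\<^sub>R w) + G x = g h - g 0"
    by (simp add: g_def algebra_simps)
  also have "\<dots> = h * (k h - k 0)" using z(3) by (simp add: k_def algebra_simps)
  also have "\<dots> = h * h * fd (\<lambda>y. fd G y u) (x + z *\<^sub>R u + t *\<^sub>R w) w" using t(3) by simp
  finally show ?thesis using inb[of z t] z t by force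
qed

text \<open>The second difference is symmetric in \<open>u\<close> and \<open>w\<close>, so the two
  mixed derivatives take a common value at points arbitrarily near \<open>x\<close>, and both are
  continuous.\<close>

lemma second_derivative_symmetric_real:
  fixes G :: "'a::real_normed_vector \<Rightarrow> real"
  assumes U: "open U" "x \<in> U" and G: "smooth_on U G"
  shows "fd (\<lambda>y. fd G y u) x w = fd (\<lambda>y. fd G y w) x u"
proof (rule ccontr)
  let ?A = "\<lambda>y. fd (\<lambda>y. fd G y u) y w" and ?B = "\<lambda>y. fd (\<lambda>y. fd G y w) y u"
  assume neq: "?A x \<noteq> ?B x"
  define e where "e = \<bar>?A x - ?B x\<bar> / 2"
  have e: "e > 0" using neq by (simp add: e_def)
  have sA: "isCont ?A x" and sB: "isCont ?B x"
    using smooth_on_continuous_on[OF smooth_on_fd[OF smooth_on_fd[OF G]]] U continuous_on_eq_continuous_at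
    by blast+
  obtain r1 where r1: "r1 > 0" "\<And>y. dist y x < r1 \<Longrightarrow> dist (?A y) (?A x) < e"
    using sA[unfolded continuous_at_eps_delta, rule_format, OF e] by auto
  obtain r2 where r2: "r2 > 0" "\<And>y. dist y x < r2 \<Longrightarrow> dist (?B y) (?B x) < e"
    using sB[unfolded continuous_at_eps_delta, rule_format, OF e] by auto
  obtain r3 where r3: "r3 > 0" "ball x r3 \<subseteq> U" using U open_contains_ball by blast
  define r where "r = min r1 (min r2 r3)"
  have r: "r > 0" "ball x r \<subseteq> U" using r1 r2 r3 by (auto simp: r_def)
  \<comment> \<open>The added 1 keeps the denominator positive when \<open>u\<close> and
    \<open>w\<close> vanish; the factor 2 leaves room for the strict inequality
    \<open>hr\<close>.\<close>
  define h where "h = r / (2 * (norm u + norm w + 1))"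
  have n: "norm u + norm w + 1 > 0" by (simp add: add_nonneg_pos)
  have h: "h > 0" using r n by (simp add: h_def)
  have "h * (norm u + norm w) \<le> h * (norm u + norm w + 1)" using h by simp
  also have "\<dots> = r / 2" using n unfolding h_def by (simp add: divide_simps)
  finally have hr: "h * (norm u + norm w) < r" using r by simp
  have d: "G differentiable (at y)" "(\<lambda>y. fd G y v) differentiable (at y)" if "y \<in> ball x r" for y v
    using that r(2) G smooth_on_differentiable smooth_on_fd by blast+
  obtain y1 where y1: "y1 \<in> ball x r" "G (x + h *\<^sub>R u + h *\<^sub>R w) - G (x + h *\<^sub>R u) - G (x + h *\<^sub>R w) + G x = h * h * ?A y1"
    using second_difference_mvt[OF h hr d] by blast
  have hr': "h * (norm w + norm u) < r" using hr by (simp add: add.commute)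
  obtain y2 where y2: "y2 \<in> ball x r" "G (x + h *\<^sub>R w + h *\<^sub>R u) - G (x + h *\<^sub>R w) - G (x + h *\<^sub>R u) + G x = h * h * ?B y2"
    using second_difference_mvt[OF h hr' d] by blast
  have "G (x + h *\<^sub>R u + h *\<^sub>R w) = G (x + h *\<^sub>R w + h *\<^sub>R u)"
    by (simp add: add.commute add.left_commute)
  then have "h * h * ?A y1 = h * h * ?B y2" using y1(2) y2(2) by linarith
  then have "?A y1 = ?B y2" using h by simp
  moreover have "\<bar>?A y1 - ?A x\<bar> < e" "\<bar>?B y2 - ?B x\<bar> < e"
    using r1(2)[of y1] r2(2)[of y2] y1(1) y2(1) by (auto simp: r_def dist_commute dist_real_def)
  moreover have "\<bar>a - b\<bar> \<le> \<bar>c - a\<bar> + \<bar>c - b\<bar>" for a b c :: real by linarith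
  ultimately have "\<bar>?A x - ?B x\<bar> < e + e" by (smt (verit))
  then show False by (simp add: e_def)
qed

lemma second_derivative_symmetric:
  fixes F :: "'a::real_normed_vector \<Rightarrow> 'b::euclidean_space"
  assumes U: "open U" "x \<in> U" and F: "smooth_on U F"
  shows "fd (\<lambda>y. fd F y u) x w = fd (\<lambda>y. fd F y w) x u"
proof (rule euclidean_eqI)
  fix b :: 'b assume "b \<in> Basis"
  let ?G = "\<lambda>y. F y \<bullet> b"
  have G: "smooth_on U ?G" using F U by (intro smooth_on_inner smooth_on_const)
  have 1: "fd ?G y v = fd F y v \<bullet> b" if "y \<in> U" for y v
    by (rule fd_bounded_linear[OF bounded_linear_inner_left smooth_on_differentiable[OF F that]])
  have 2: "fd (\<lambda>y. fd ?G y u) x w = fd (\<lambda>y. fd F y u) x w \<bullet> b" for u w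
  proof -
    have "fd (\<lambda>y. fd ?G y u) x w = fd (\<lambda>y. fd F y u \<bullet> b) x w"
      using fd_cong[OF U, of "\<lambda>y. fd ?G y u" "\<lambda>y. fd F y u \<bullet> b"] 1 by simp
    also have "\<dots> = fd (\<lambda>y. fd F y u) x w \<bullet> b"
      by (rule fd_bounded_linear[OF bounded_linear_inner_left smooth_on_differentiable[OF smooth_on_fd[OF F] U(2)]])
    finally show ?thesis .
  qed
  show "fd (\<lambda>y. fd F y u) x w \<bullet> b = fd (\<lambda>y. fd F y w) x u \<bullet> b"
    using second_derivative_symmetric_real[OF U G, of u w] by (simp add: 2)
qed

section \<open>Local sections of submersions\<close>

text \<open>On the affine slice through \<open>x0\<close> given by a right inverse \<open>R\<close>
  of the derivative, \<open>g\<close> becomes a map between spaces of equal dimension whose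
  derivative at \<open>g x0\<close> is the identity. The inverse function theorem supplies
  \<open>k\<close>, and \<open>k\<close> is smooth because the immersion \<open>?h\<close> cancels
  in \<open>?h (k x) = x\<close>.\<close>

lemma submersion_local_section:
  fixes g :: "'a::euclidean_space \<Rightarrow> 'b::euclidean_space"
  assumes U: "open U" "x0 \<in> U" and g: "smooth_on U g" and surj: "surj (fd g x0)"
  shows "\<exists>V s. open V \<and> g x0 \<in> V \<and> smooth_on V s \<and> s ` V \<subseteq> U \<and> s (g x0) = x0 \<and> (\<forall>y\<in>V. g (s y) = y)"
proof -
  obtain R where R: "linear R" "fd g x0 \<circ> R = id"
    using linear_surjective_right_inverse[OF smooth_on_linear_fd[OF g U(2)] surj] by blast
  have blR: "bounded_linear R" using R(1) linear_conv_bounded_linear by blast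
  let ?a = "\<lambda>y. x0 + R (y - g x0)"
  let ?h = "\<lambda>y. g (?a y)"
  have sa: "smooth_on S ?a" if "open S" for S
  proof -
    have "smooth_on S (\<lambda>y. x0 + R (y + - g x0))"
      using that by (intro smooth_on_add smooth_on_bounded_linear[OF blR] smooth_on_const smooth_on_ident)
    then show ?thesis by simp
  qed
  have da: "(?a has_derivative R) (at y)" for y
  proof -
    have "((\<lambda>y. y - g x0) has_derivative (\<lambda>h. h)) (at y)" by (auto intro!: derivative_eq_intros)
    from has_derivative_add[OF has_derivative_const bounded_linear.has_derivative[OF blR this]]
    show ?thesis by simp
  qed
  define W where "W = ?a -` U"
  have W: "open W" unfolding W_def
    by (rule open_vimage[OF U(1) smooth_on_continuous_on[OF sa[OF open_UNIV]]])
  have hW: "smooth_on W ?h"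
    by (rule smooth_on_compose[OF W _ sa[OF W] g]) (auto simp: W_def)
  define f' where "f' = (\<lambda>y. Blinfun (fd ?h y))"
  have f': "blinfun_apply (f' y) = fd ?h y" if "y \<in> W" for y
    unfolding f'_def using smooth_on_linear_fd[OF hW that]
    by (intro bounded_linear_Blinfun_apply) (simp add: linear_conv_bounded_linear)
  have gW: "g x0 \<in> W" using U(2) R(1) by (simp add: W_def linear_0)
  have "fd ?h (g x0) = id"
  proof
    fix v
    have "fd ?h (g x0) v = fd g (?a (g x0)) (fd ?a (g x0) v)"
      using da R(1) U(2) smooth_on_differentiable[OF g]
      by (intro fd_compose) (auto simp: differentiable_def linear_0)
    also have "\<dots> = v" using fd_eq[OF da] R by (simp add: linear_0 o_def fun_eq_iff)
    finally show "fd ?h (g x0) v = id v" by simp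
  qed
  then have "id_blinfun o\<^sub>L f' (g x0) = id_blinfun"
    by (intro blinfun_eqI) (simp add: f'[OF gW])
  moreover have "continuous_on W f'"
  proof (rule continuous_on_blinfun_componentwise)
    fix i :: 'b
    show "continuous_on W (\<lambda>x. f' x i)"
      using smooth_on_continuous_on[OF smooth_on_fd[OF hW, of i]] by (rule continuous_on_eq) (simp add: f')
  qed
  ultimately obtain U' V k k' where k: "open U'" "U' \<subseteq> W" "g x0 \<in> U'" "open V" "?h (g x0) \<in> V"
    "homeomorphism U' V ?h k" "\<And>y. y \<in> V \<Longrightarrow> bij (blinfun_apply (f' (k y)))"
    using inverse_function_theorem[OF W _ _ gW, of ?h f' id_blinfun] smooth_on_works[OF hW] f'
    by (smt (verit, ccfv_threshold))
  have hg: "?h (g x0) = g x0" using R(1) by (simp add: linear_0)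
  have sk: "smooth_on V k"
  proof (rule smooth_on_left_factor[OF k(4)])
    show "k ` V \<subseteq> U'" "continuous_on V k" using k(6) by (auto simp: homeomorphism_def)
    show "inj (fd ?h y)" if "y \<in> U'" for y
    proof -
      have "?h y \<in> V" "k (?h y) = y" using k(6) that by (auto simp: homeomorphism_def)
      then have "bij (blinfun_apply (f' y))" using k(7)[of "?h y"] by simp
      then show ?thesis using f' k(2) that by (metis bij_is_inj subsetD)
    qed
    show "?h (k x) = x" if "x \<in> V" for x using k(6) that by (auto simp: homeomorphism_def)
    show "smooth_on U' ?h" using smooth_on_subset[OF hW k(2)] .
    show "smooth_on V (\<lambda>x. x)" using smooth_on_ident[OF k(4)] .
  qed
  have kg: "k (g x0) = g x0" using k(3,6) hg unfolding homeomorphism_def by metis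
  show ?thesis
  proof (intro exI conjI)
    show "open V" "g x0 \<in> V" using k hg by auto
    show "smooth_on V (\<lambda>y. ?a (k y))"
      by (rule smooth_on_compose[OF k(4) _ sk sa[OF open_UNIV]]) auto
    show "(\<lambda>y. ?a (k y)) ` V \<subseteq> U" using k(2,6) by (auto simp: homeomorphism_def W_def)
    show "?a (k (g x0)) = x0" using kg R(1) by (simp add: linear_0)
    show "\<forall>y\<in>V. g (?a (k y)) = y" using k(6) by (auto simp: homeomorphism_def)
  qed
qed

section \<open>Charts\<close>

text \<open>The common part of the three kinds of charts (source, pseudohyperbolic space, quotient)
  that is enough to compute with \<open>chart_inv\<close>.\<close>

definition regular_chart :: "('m, 'a::euclidean_space) chart \<Rightarrow> bool" where
  "regular_chart c \<longleftrightarrow> inj_on (snd c) (fst c) \<and> open (snd c ` fst c)"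

lemma chart_inv_left: "regular_chart c \<Longrightarrow> p \<in> fst c \<Longrightarrow> chart_inv c (snd c p) = p"
  by (simp add: regular_chart_def chart_inv_def)

lemma chart_inv_in: "x \<in> snd c ` fst c \<Longrightarrow> chart_inv c x \<in> fst c"
  by (simp add: chart_inv_def inv_into_into)

lemma chart_inv_right: "x \<in> snd c ` fst c \<Longrightarrow> snd c (chart_inv c x) = x"
  by (simp add: chart_inv_def f_inv_into_f)

lemma regular_chart_open: "regular_chart c \<Longrightarrow> open (snd c ` fst c)"
  by (simp add: regular_chart_def)

lemma regular_chart_manifold: "smooth_manifold M \<Longrightarrow> c \<in> charts M \<Longrightarrow> regular_chart c"
  unfolding smooth_manifold_def regular_chart_def
  using homeomorphic_imp_injective_map[of "subtopology (mtop M) (fst c)"] openin_subset[of "mtop M" "fst c"]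
  by (force simp: Int_absorb1)

lemma push_fd: "push c F p = fd (\<lambda>x. F (chart_inv c x)) (snd c p)"
  by (rule ext) (simp add: push_def o_def)

lemma push2_fd:
  assumes "regular_chart c" "p \<in> fst c"
  shows "push2 c F p u w = fd (\<lambda>x. fd (\<lambda>x. F (chart_inv c x)) x w) (snd c p) u"
proof -
  have "fd (\<lambda>x. push c F (chart_inv c x) w) (snd c p) = fd (\<lambda>x. fd (\<lambda>x. F (chart_inv c x)) x w) (snd c p)"
    by (rule fd_cong[OF regular_chart_open[OF assms(1)]]) (use assms in \<open>auto simp: push_fd chart_inv_left\<close>)
  then show ?thesis by (simp add: push2_def push_fd)
qed

section \<open>Maximality of immersions into submanifolds of a flat space\<close>

text \<open>The form is written as a Euclidean product with \<open>?A t\<close>; nondegeneracy makes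
  \<open>?A\<close> injective, hence surjective. This gives the existence of the solution of the
  Koszul equations and of orthogonal projections for indefinite metrics.\<close>

lemma nondegenerate_riesz:
  fixes b :: "'b::euclidean_space \<Rightarrow> 'b \<Rightarrow> real"
  assumes b1: "\<And>z. linear (\<lambda>t. b t z)" and b2: "\<And>t. linear (b t)"
    and nd: "\<And>u. (\<forall>w. b u w = 0) \<Longrightarrow> u = 0" and l: "linear l"
  shows "\<exists>t. \<forall>z. b t z = l z"
proof -
  let ?A = "\<lambda>t. \<Sum>i\<in>Basis. b t i *\<^sub>R i"
  have A: "?A t \<bullet> z = b t z" for t z
    using linear_eq_sum_Basis[OF b2, of t z] by (simp add: inner_sum_left mult.commute inner_commute[of z])
  have lin: "linear ?A"
    by (intro linear_compose_sum ballI linearI)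
      (auto simp: linear_add[OF b1] linear_cmul[OF b1] algebra_simps)
  have "inj ?A"
  proof (subst linear_injective_0[OF lin], intro allI impI)
    fix t assume "?A t = 0"
    then have "b t w = 0" for w using A[of t w] by simp
    then show "t = 0" using nd by blast
  qed
  then have "surj ?A" using linear_injective_imp_surjective lin by blast
  from surjD[OF this, of "\<Sum>i\<in>Basis. l i *\<^sub>R i"]
  obtain t where t: "(\<Sum>i\<in>Basis. l i *\<^sub>R i) = ?A t" by auto
  have "b t z = l z" for z
  proof -
    have "b t z = (\<Sum>i\<in>Basis. l i *\<^sub>R i) \<bullet> z" unfolding t by (rule A[symmetric])
    also have "\<dots> = l z"
      using linear_eq_sum_Basis[OF l, of z] by (simp add: inner_sum_left mult.commute inner_commute[of z])
    finally show ?thesis .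
  qed
  then show ?thesis by blast
qed

text \<open>One point and fixed charts, with \<open>T\<close> the coordinates that
  \<open>\<sigma>\<close> sends into the chart \<open>k\<close>. Below, \<open>\<psi>\<close>
  parametrises the target in the flat space, \<open>\<phi>\<close> is \<open>\<sigma>\<close> in
  coordinates, and \<open>s\<close> is their composition; the metric of the target is the first
  fundamental form of \<open>\<psi>\<close>.\<close>

locale flat_immersion =
  fixes N :: "('x, 'b::euclidean_space) pr_manifold"
    and c :: "('m, real^'n::finite) chart" and k :: "('x, 'b) chart"
    and \<sigma> :: "'m \<Rightarrow> 'x" and p :: 'm
    and \<iota> :: "'x \<Rightarrow> 'v::euclidean_space" and B :: "'v \<Rightarrow> 'v \<Rightarrow> real" and T :: "(real^'n) set"
  assumes c: "regular_chart c" "p \<in> fst c" and k: "regular_chart k"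
    and B: "bounded_bilinear B" and Bsym: "\<And>x y. B x y = B y x"
    and smooth_\<psi>: "smooth_on (snd k ` fst k) (\<lambda>y. \<iota> (chart_inv k y))"
    and metric: "\<And>q u w. q \<in> fst k \<Longrightarrow> pr_metric N k q u w =
      B (fd (\<lambda>y. \<iota> (chart_inv k y)) (snd k q) u) (fd (\<lambda>y. \<iota> (chart_inv k y)) (snd k q) w)"
    and nondeg: "\<And>u. (\<forall>w. pr_metric N k (\<sigma> p) u w = 0) \<Longrightarrow> u = 0"
    and T: "open T" "snd c p \<in> T" "T \<subseteq> snd c ` fst c"
    and T_k: "\<And>x. x \<in> T \<Longrightarrow> \<sigma> (chart_inv c x) \<in> fst k"
    and smooth_\<phi>: "smooth_on T (\<lambda>x. snd k (\<sigma> (chart_inv c x)))"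
begin

definition \<psi> where "\<psi> y = \<iota> (chart_inv k y)"
definition \<phi> where "\<phi> x = snd k (\<sigma> (chart_inv c x))"
definition s where "s x = \<iota> (\<sigma> (chart_inv c x))"
definition x0 where "x0 = snd c p"
definition y0 where "y0 = \<phi> x0"

interpretation B: bounded_bilinear B by (rule B)

lemma \<sigma>p: "chart_inv c x0 = p" "\<sigma> p \<in> fst k" "y0 = snd k (\<sigma> p)" "x0 \<in> T"
  using chart_inv_left[OF c] T_k[OF T(2)] T(2) by (auto simp: x0_def y0_def \<phi>_def)

lemma s\<psi>: "smooth_on (snd k ` fst k) \<psi>"
  using smooth_\<psi> unfolding \<psi>_def .

lemma s\<phi>: "smooth_on T \<phi>" using smooth_\<phi> unfolding \<phi>_def .

lemma \<phi>T: "\<phi> ` T \<subseteq> snd k ` fst k" using T_k by (auto simp: \<phi>_def)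

lemma y0k: "y0 \<in> snd k ` fst k" using \<phi>T \<sigma>p by (auto simp: y0_def)

lemma open_k: "open (snd k ` fst k)" using k regular_chart_open by blast

lemma \<psi>\<phi>: "x \<in> T \<Longrightarrow> \<psi> (\<phi> x) = s x"
  by (simp add: \<psi>_def \<phi>_def s_def T_k chart_inv_left[OF k])

lemma fd_s: "x \<in> T \<Longrightarrow> fd s x u = fd \<psi> (\<phi> x) (fd \<phi> x u)"
proof -
  assume x: "x \<in> T"
  have "fd s x = fd (\<lambda>x. \<psi> (\<phi> x)) x" by (rule fd_cong[OF T(1) x]) (simp add: \<psi>\<phi>)
  moreover have "\<phi> x \<in> snd k ` fst k" using \<phi>T x by blast
  ultimately show ?thesis
    by (simp add: fd_compose[OF smooth_on_differentiable[OF s\<phi> x] smooth_on_differentiable[OF s\<psi>]])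
qed

lemma lin\<psi>: "linear (fd \<psi> y0)" using smooth_on_linear_fd[OF s\<psi> y0k] .
lemma lin\<phi>: "linear (fd \<phi> x0)" using smooth_on_linear_fd[OF s\<phi> \<sigma>p(4)] .

definition g where "g u w = B (fd \<psi> y0 u) (fd \<psi> y0 w)"
text \<open>Full second derivatives in the flat space: tangential and normal components are not
  separated yet.\<close>

definition II\<psi> where "II\<psi> u w = fd (\<lambda>y. fd \<psi> y w) y0 u"
definition IIs where "IIs u w = fd (\<lambda>x. fd s x w) x0 u"

lemma metric_eq: "q \<in> fst k \<Longrightarrow> pr_metric N k q u w = B (fd \<psi> (snd k q) u) (fd \<psi> (snd k q) w)"
  using metric unfolding \<psi>_def .

lemma metric_g: "pr_metric N k (\<sigma> p) = g"
  using metric_eq[OF \<sigma>p(2)] \<sigma>p(3) by (intro ext) (simp add: g_def)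

lemma g_bilinear: "linear (\<lambda>u. g u w)" "linear (g u)"
  unfolding g_def
  by (auto intro!: linearI simp: linear_add[OF lin\<psi>] linear_cmul[OF lin\<psi>]
      B.add_left B.add_right B.scaleR_left B.scaleR_right)

lemma g_sym: "g u w = g w u" unfolding g_def by (rule Bsym)

lemma g_nondeg: "(\<And>w. g u w = 0) \<Longrightarrow> u = 0" using nondeg metric_g by simp

lemma II\<psi>_sym: "II\<psi> u w = II\<psi> w u"
  unfolding II\<psi>_def by (rule second_derivative_symmetric[OF open_k y0k s\<psi>])

lemma II\<psi>_linear: "linear (II\<psi> u)"
proof -
  have "linear (\<lambda>w. II\<psi> w u)" unfolding II\<psi>_def by (rule smooth_on_linear_fd[OF smooth_on_fd[OF s\<psi>] y0k])
  moreover have "II\<psi> u = (\<lambda>w. II\<psi> w u)" by (rule ext) (rule II\<psi>_sym)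
  ultimately show ?thesis by simp
qed

lemma push_metric:
  "push k (\<lambda>r. pr_metric N k r w z) (\<sigma> p) u = B (fd \<psi> y0 w) (II\<psi> u z) + B (II\<psi> u w) (fd \<psi> y0 z)"
proof -
  have "fd (\<lambda>y. pr_metric N k (chart_inv k y) w z) y0 = fd (\<lambda>y. B (fd \<psi> y w) (fd \<psi> y z)) y0"
    by (rule fd_cong[OF open_k y0k]) (simp add: metric_eq chart_inv_in chart_inv_right)
  then show ?thesis
    unfolding push_fd \<sigma>p(3)[symmetric] II\<psi>_def
    using fd_bilinear[OF B smooth_on_differentiable[OF smooth_on_fd[OF s\<psi>] y0k]
        smooth_on_differentiable[OF smooth_on_fd[OF s\<psi>] y0k]] by simp
qed

text \<open>The formula of Gauss. Each of the three derivatives of the metric has two terms; the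
  symmetry of \<open>II\<psi>\<close> cancels four of the six and makes the other two equal.\<close>

lemma christoffel: "g (christoffel N k (\<sigma> p) u w) z = B (II\<psi> u w) (fd \<psi> y0 z)"
proof -
  let ?P = "\<lambda>t. \<forall>z. g t z = B (II\<psi> u w) (fd \<psi> y0 z)"
  have "linear (\<lambda>z. B (II\<psi> u w) (fd \<psi> y0 z))"
    by (auto intro!: linearI simp: linear_add[OF lin\<psi>] linear_cmul[OF lin\<psi>] B.add_right B.scaleR_right)
  then obtain t where t: "?P t" using nondegenerate_riesz[of g] g_bilinear g_nondeg by blast
  have uniq: "t' = t" if "?P t'" for t'
  proof -
    have "g (t' - t) z = 0" for z using that t linear_diff[OF g_bilinear(1), of t' t z] by simp
    from g_nondeg[OF this] show ?thesis by simp
  qed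
  have the_t: "(THE t. ?P t) = t" using t by (rule the_equality) (rule uniq)
  have "(push k (\<lambda>r. pr_metric N k r w z) (\<sigma> p) u + push k (\<lambda>r. pr_metric N k r u z) (\<sigma> p) w
       - push k (\<lambda>r. pr_metric N k r u w) (\<sigma> p) z) / 2 = B (II\<psi> u w) (fd \<psi> y0 z)" for z
    unfolding push_metric II\<psi>_sym[of w u] II\<psi>_sym[of z w] II\<psi>_sym[of z u]
      Bsym[of "fd \<psi> y0 u"] Bsym[of "fd \<psi> y0 w"] by simp
  then have "christoffel N k (\<sigma> p) u w = t" unfolding christoffel_def metric_g by (simp only: the_t)
  then show ?thesis using t by blast
qed

lemma push_\<phi>: "push c (snd k \<circ> \<sigma>) p = fd \<phi> x0"
  unfolding push_fd x0_def \<phi>_def[abs_def] by simp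

lemma IIs_eq: "IIs u w = II\<psi> (fd \<phi> x0 u) (fd \<phi> x0 w) + fd \<psi> y0 (fd (\<lambda>x. fd \<phi> x w) x0 u)"
proof -
  let ?m = "\<lambda>x. fd \<phi> x w"
  have d\<phi>: "\<phi> differentiable (at x0)" and dm: "?m differentiable (at x0)"
    and d\<psi>: "(\<lambda>y. fd \<psi> y b) differentiable (at (\<phi> x0))" for b
    using smooth_on_differentiable s\<phi> smooth_on_fd s\<psi> y0k \<sigma>p(4) unfolding y0_def by blast+
  have e: "fd s x w = (\<Sum>b\<in>Basis. (?m x \<bullet> b) *\<^sub>R fd \<psi> (\<phi> x) b)" if "x \<in> T" for x
  proof -
    have "\<phi> x \<in> snd k ` fst k" using \<phi>T that by blast
    show ?thesis unfolding fd_s[OF that]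
      by (rule linear_eq_sum_Basis[OF smooth_on_linear_fd[OF s\<psi> \<open>\<phi> x \<in> snd k ` fst k\<close>]])
  qed
  have h: "((\<lambda>x. \<Sum>b\<in>Basis. (?m x \<bullet> b) *\<^sub>R fd \<psi> (\<phi> x) b) has_derivative
     (\<lambda>u. \<Sum>b\<in>Basis. (?m x0 \<bullet> b) *\<^sub>R fd (\<lambda>y. fd \<psi> y b) (\<phi> x0) (fd \<phi> x0 u) + (fd ?m x0 u \<bullet> b) *\<^sub>R fd \<psi> (\<phi> x0) b)) (at x0)"
    by (intro has_derivative_sum has_derivative_scaleR has_derivative_inner_left fd_works[OF dm]
        has_derivative_compose[OF fd_works[OF d\<phi>] fd_works[OF d\<psi>]])
  have "IIs u w = fd (\<lambda>x. \<Sum>b\<in>Basis. (?m x \<bullet> b) *\<^sub>R fd \<psi> (\<phi> x) b) x0 u"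
    unfolding IIs_def by (rule fun_cong[OF fd_cong[OF T(1) \<sigma>p(4) e]])
  also have "\<dots> = (\<Sum>b\<in>Basis. (?m x0 \<bullet> b) *\<^sub>R II\<psi> (fd \<phi> x0 u) b) + (\<Sum>b\<in>Basis. (fd ?m x0 u \<bullet> b) *\<^sub>R fd \<psi> y0 b)"
    unfolding fd_eq[OF h] by (simp add: sum.distrib II\<psi>_def y0_def)
  also have "\<dots> = II\<psi> (fd \<phi> x0 u) (?m x0) + fd \<psi> y0 (fd ?m x0 u)"
    by (simp only: linear_eq_sum_Basis[OF II\<psi>_linear[of "fd \<phi> x0 u"], of "?m x0", symmetric]
        linear_eq_sum_Basis[OF lin\<psi>, of "fd ?m x0 u", symmetric])
  finally show ?thesis .
qed

text \<open>The two terms of the second-order chain rule \<open>IIs_eq\<close> correspond to the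
  coordinate derivative and the Christoffel term of \<open>covariant_along\<close>. So the covariant
  derivative along \<open>\<sigma>\<close> is the component of the plain second derivative of
  \<open>s\<close> tangent to the target.\<close>

lemma covariant: "g (covariant_along N c k \<sigma> p u w) z = B (IIs u w) (fd \<psi> y0 z)"
proof -
  have "push2 c (snd k \<circ> \<sigma>) p u w = fd (\<lambda>x. fd \<phi> x w) x0 u"
    unfolding push2_fd[OF c] x0_def \<phi>_def[abs_def] by simp
  then have "g (covariant_along N c k \<sigma> p u w) z =
      g (fd (\<lambda>x. fd \<phi> x w) x0 u) z + B (II\<psi> (fd \<phi> x0 u) (fd \<phi> x0 w)) (fd \<psi> y0 z)"
    unfolding covariant_along_def push_\<phi> by (simp add: linear_add[OF g_bilinear(1)] christoffel)
  then show ?thesis unfolding IIs_eq by (simp add: B.add_left g_def[of "fd (\<lambda>x. fd \<phi> x w) x0 u"])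
qed

lemma induced: "induced_metric N c k \<sigma> p u w = B (fd s x0 u) (fd s x0 w)"
  unfolding induced_metric_def metric_g push_\<phi> g_def using fd_s[OF \<sigma>p(4)] by (simp add: y0_def)

context
  assumes ind_nondeg: "\<And>u. (\<forall>w. B (fd s x0 u) (fd s x0 w) = 0) \<Longrightarrow> u = 0"
begin

lemma g_s: "g (fd \<phi> x0 u) z = B (fd s x0 u) (fd \<psi> y0 z)"
  "B (fd s x0 u) (fd s x0 w) = g (fd \<phi> x0 u) (fd \<phi> x0 w)"
  unfolding g_def using fd_s[OF \<sigma>p(4)] by (simp_all add: y0_def)

text \<open>The metric may be indefinite, so the projection onto the tangent space of the immersion
  rests on the nondegeneracy of the induced metric.\<close>

lemma orth_decomp: "\<exists>e. \<forall>e'. g (z - fd \<phi> x0 e) (fd \<phi> x0 e') = 0"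
proof -
  have l: "linear (\<lambda>e. g (fd \<phi> x0 e) (fd \<phi> x0 e'))" "linear (\<lambda>e'. g v (fd \<phi> x0 e'))" for e' v
    using linear_compose[OF lin\<phi> g_bilinear(1)] linear_compose[OF lin\<phi> g_bilinear(2)]
    by (auto simp: o_def)
  have "\<exists>t. \<forall>e'. g (fd \<phi> x0 t) (fd \<phi> x0 e') = g z (fd \<phi> x0 e')"
    by (rule nondegenerate_riesz[OF l(1) l(2) _ l(2)]) (rule ind_nondeg, unfold g_s(2), assumption)
  then obtain t where "\<And>e'. g (fd \<phi> x0 t) (fd \<phi> x0 e') = g z (fd \<phi> x0 e')" by blast
  then have "g (z - fd \<phi> x0 t) (fd \<phi> x0 e') = 0" for e' by (simp add: linear_diff[OF g_bilinear(1)])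
  then show ?thesis by blast
qed

lemma normal_part:
  assumes "\<forall>e'. g (t - fd \<phi> x0 e) (fd \<phi> x0 e') = 0"
  shows "normal_part g (range (fd \<phi> x0)) t = t - fd \<phi> x0 e"
  unfolding normal_part_def
proof (rule the_equality)
  show "(\<forall>w\<in>range (fd \<phi> x0). g (t - fd \<phi> x0 e) w = 0) \<and> t - (t - fd \<phi> x0 e) \<in> range (fd \<phi> x0)"
    using assms by auto
  fix s' assume s': "(\<forall>w\<in>range (fd \<phi> x0). g s' w = 0) \<and> t - s' \<in> range (fd \<phi> x0)"
  then obtain e1 where e1: "t - s' = fd \<phi> x0 e1" by blast
  then have "s' = t - fd \<phi> x0 e1" by (simp add: algebra_simps)
  then have "fd \<phi> x0 (e1 - e) = (t - fd \<phi> x0 e) - s'" by (simp add: linear_diff[OF lin\<phi>])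
  then have "g (fd \<phi> x0 (e1 - e)) (fd \<phi> x0 e') = 0" for e'
    using assms s' by (simp add: linear_diff[OF g_bilinear(1)])
  then have "\<forall>w. B (fd s x0 (e1 - e)) (fd s x0 w) = 0" unfolding g_s(2) by blast
  then have "e1 - e = 0" by (rule ind_nondeg)
  then show "s' = t - fd \<phi> x0 e" using \<open>s' = t - fd \<phi> x0 e1\<close> by simp
qed

text \<open>Paired with a normal vector, the tangential correction in \<open>normal_part\<close>
  drops out and only the plain second derivative remains.\<close>

lemma second_fundamental_form:
  shows "g (second_fundamental_form N c k \<sigma> p u w) (fd \<phi> x0 e) = 0"
    and "(\<And>e. g z (fd \<phi> x0 e) = 0) \<Longrightarrow> g (second_fundamental_form N c k \<sigma> p u w) z = B (IIs u w) (fd \<psi> y0 z)"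
proof -
  let ?t = "covariant_along N c k \<sigma> p u w"
  obtain d where d: "\<forall>e'. g (?t - fd \<phi> x0 d) (fd \<phi> x0 e') = 0" using orth_decomp by blast
  have eq: "second_fundamental_form N c k \<sigma> p u w = ?t - fd \<phi> x0 d"
    unfolding second_fundamental_form_def metric_g push_\<phi> by (rule normal_part[OF d])
  show "g (second_fundamental_form N c k \<sigma> p u w) (fd \<phi> x0 e) = 0" using d eq by simp
  assume z: "\<And>e. g z (fd \<phi> x0 e) = 0"
  have "g (fd \<phi> x0 d) z = 0" using z g_sym by simp
  then show "g (second_fundamental_form N c k \<sigma> p u w) z = B (IIs u w) (fd \<psi> y0 z)"
    using covariant[of u w z] by (simp add: eq linear_diff[OF g_bilinear(1)])
qed

text \<open>The mean curvature is normal and every vector splits into a tangential and a normal one,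
  so by nondegeneracy it vanishes once it is orthogonal to all normals. On the right-hand side the
  chart of the target survives only in the tangent space
  \<open>range (fd \<psi> y0)\<close>.\<close>

lemma mean_curvature_zero_iff:
  "mean_curvature N c k \<sigma> p = 0 \<longleftrightarrow>
    (\<forall>X\<in>range (fd \<psi> y0). (\<forall>e. B X (fd s x0 e) = 0) \<longrightarrow>
      (\<Sum>i\<in>UNIV. \<Sum>j\<in>UNIV. matrix_inv (gram (\<lambda>u w. B (fd s x0 u) (fd s x0 w))) $ i $ j *
        B (IIs (axis i 1) (axis j 1)) X) = 0)" (is "_ \<longleftrightarrow> (\<forall>X\<in>_. _ \<longrightarrow> ?S X = 0)")
proof -
  let ?H = "mean_curvature N c k \<sigma> p"
  let ?II = "second_fundamental_form N c k \<sigma> p"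
  have ind: "induced_metric N c k \<sigma> p = (\<lambda>u w. B (fd s x0 u) (fd s x0 w))"
    by (intro ext) (rule induced)
  have gH: "g ?H z = (\<Sum>i\<in>UNIV. \<Sum>j\<in>UNIV. matrix_inv (gram (\<lambda>u w. B (fd s x0 u) (fd s x0 w))) $ i $ j *
      g (?II (axis i 1) (axis j 1)) z)" for z
    unfolding mean_curvature_def ind
    by (simp add: linear_sum[OF g_bilinear(1)] linear_cmul[OF g_bilinear(1)])
  have Ht: "g ?H (fd \<phi> x0 e) = 0" for e
    by (simp add: gH second_fundamental_form(1))
  have Hn: "g ?H z = ?S (fd \<psi> y0 z)" if "\<And>e. g z (fd \<phi> x0 e) = 0" for z
    by (simp add: gH second_fundamental_form(2)[OF that])
  have gB: "g z (fd \<phi> x0 e) = B (fd \<psi> y0 z) (fd s x0 e)" for z e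
    unfolding g_def using fd_s[OF \<sigma>p(4)] by (simp add: y0_def)
  show ?thesis
  proof
    assume H: "?H = 0"
    show "\<forall>X\<in>range (fd \<psi> y0). (\<forall>e. B X (fd s x0 e) = 0) \<longrightarrow> ?S X = 0"
    proof (intro ballI impI)
      fix X assume "X \<in> range (fd \<psi> y0)" and X: "\<forall>e. B X (fd s x0 e) = 0"
      then obtain z where z: "X = fd \<psi> y0 z" by blast
      have "g ?H z = 0" using H linear_0[OF g_bilinear(1)] by simp
      then show "?S X = 0" using Hn[of z] X z gB by simp
    qed
  next
    assume R: "\<forall>X\<in>range (fd \<psi> y0). (\<forall>e. B X (fd s x0 e) = 0) \<longrightarrow> ?S X = 0"
    have "g ?H z = 0" for z
    proof -
      obtain e where e: "\<forall>e'. g (z - fd \<phi> x0 e) (fd \<phi> x0 e') = 0" using orth_decomp by blast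
      have "g ?H (z - fd \<phi> x0 e) = 0"
        using Hn[of "z - fd \<phi> x0 e"] R e gB by simp
      then show ?thesis using Ht by (simp add: linear_diff[OF g_bilinear(2)])
    qed
    then show "?H = 0" by (rule g_nondeg)
  qed
qed

end

end

section \<open>Determinants\<close>

lemma sum_option: "(\<Sum>a\<in>(UNIV :: 'n::finite option set). h a) = h None + (\<Sum>i\<in>UNIV. h (Some i))"
  unfolding UNIV_option_conv by (simp add: sum.reindex)

lemma prod_option: "(\<Prod>a\<in>(UNIV :: 'n::finite option set). h a) = h None * (\<Prod>i\<in>UNIV. h (Some i))"
  unfolding UNIV_option_conv by (simp add: prod.reindex)

text \<open>The index \<open>None\<close> stands for the transversal direction. Both the pairing of
  two dual frames and a change of tangent basis have this shape.\<close>

definition block :: "real \<Rightarrow> real^'n::finite^'n \<Rightarrow> real^('n option)^('n option)" where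
  "block a X = (\<chi> i j. case i of None \<Rightarrow> (if j = None then a else 0)
      | Some i \<Rightarrow> (case j of None \<Rightarrow> 0 | Some j \<Rightarrow> X $ i $ j))"

lemma block_simps [simp]:
  "block a X $ None $ None = a" "block a X $ None $ Some j = 0"
  "block a X $ Some i $ None = 0" "block a X $ Some i $ Some j = X $ i $ j"
  by (simp_all add: block_def)

lemma block_mult: "block a X ** block b Y = block (a * b) (X ** Y)"
  unfolding vec_eq_iff
proof (intro allI)
  fix i j show "(block a X ** block b Y) $ i $ j = block (a * b) (X ** Y) $ i $ j"
    by (cases i; cases j) (simp_all add: matrix_matrix_mult_def sum_option)
qed

lemma block_mat_1: "block 1 (mat 1) = mat 1"
  unfolding vec_eq_iff
proof (intro allI)
  fix i j show "block 1 (mat 1) $ i $ j = mat 1 $ i $ j"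
    by (cases i; cases j) (simp_all add: mat_def)
qed

lemma transpose_block: "transpose (block a X) = block a (transpose X)"
  unfolding vec_eq_iff
proof (intro allI)
  fix i j show "transpose (block a X) $ i $ j = block a (transpose X) $ i $ j"
    by (cases i; cases j) (simp_all add: transpose_def)
qed

text \<open>In the formula of Leibniz only the permutations that fix \<open>None\<close> contribute,
  and these are exactly the \<open>map_option q\<close>.\<close>

lemma det_block:
  fixes X :: "real^'n::finite^'n"
  shows "det (block a X) = a * det X"
proof -
  let ?P = "{p. p permutes (UNIV :: 'n option set)}"
  let ?PN = "{p. p permutes (UNIV :: 'n option set) \<and> p None = None}"
  let ?Q = "{q. q permutes (UNIV :: 'n set)}"
  let ?t = "\<lambda>p. of_int (sign p) * (\<Prod>i\<in>UNIV. block a X $ i $ p i)"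
  \<comment> \<open>In this form the permutation is an extension of \<open>q\<close> along an
    injection, and such an extension keeps the sign.\<close>
  have map_perm: "map_option q = map_permutation UNIV Some q" for q :: "'n \<Rightarrow> 'n"
  proof
    fix x show "map_option q x = map_permutation UNIV Some q x"
      by (cases x) (auto simp: map_permutation_def restrict_id_def)
  qed
  have bij: "bij_betw map_option ?Q ?PN"
  proof (rule bij_betwI')
    fix q r :: "'n \<Rightarrow> 'n"
    show "(map_option q = map_option r) = (q = r)"
    proof
      assume eq: "map_option q = map_option r"
      show "q = r"
      proof
        fix x show "q x = r x" using fun_cong[OF eq, of "Some x"] by simp
      qed
    qed simp
  next
    fix q :: "'n \<Rightarrow> 'n" assume "q \<in> ?Q"
    then have "inj (map_option q)" by (intro option.inj_map permutes_inj) simp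
    then have "bij (map_option q)" by (intro bijI finite_UNIV_inj_surj) auto
    then show "map_option q \<in> ?PN" by (simp add: permutes_univ bij_iff)
  next
    fix p assume "p \<in> ?PN"
    then have p: "bij p" "p None = None" by (auto simp: permutes_bij)
    define q where "q = (\<lambda>x. the (p (Some x)))"
    have ps: "p (Some x) = Some (q x)" for x
    proof -
      have "p (Some x) \<noteq> None" using p by (metis bij_pointE option.distinct(1))
      then show ?thesis by (auto simp: q_def)
    qed
    have "p = map_option q"
    proof
      fix x show "p x = map_option q x" by (cases x) (auto simp: p ps)
    qed
    moreover have "bij q"
    proof (rule bijI)
      show "inj q" using p(1) ps by (metis bij_pointE injI option.inject)
      then show "surj q" by (rule finite_UNIV_inj_surj[rotated]) simp
    qed
    ultimately show "\<exists>q\<in>?Q. p = map_option q" by (auto simp: permutes_univ bij_iff)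
  qed
  have "det (block a X) = sum ?t ?P" by (simp only: det_def)
  also have "\<dots> = sum ?t ?PN"
  proof (rule sum.mono_neutral_right)
    show "\<forall>p\<in>?P - ?PN. ?t p = 0"
    proof
      fix p assume "p \<in> ?P - ?PN"
      then obtain j where "p None = Some j" by auto
      then show "?t p = 0" by (simp add: prod_option)
    qed
  qed (auto simp: finite_permutations)
  also have "\<dots> = (\<Sum>q\<in>?Q. ?t (map_option q))"
    by (rule sum.reindex_bij_betw[OF bij, symmetric])
  also have "\<dots> = (\<Sum>q\<in>?Q. a * (of_int (sign q) * (\<Prod>i\<in>UNIV. X $ i $ q i)))"
  proof (rule sum.cong[OF refl])
    fix q assume "q \<in> ?Q"
    then have "sign (map_option q) = sign q"
      unfolding map_perm by (intro sign_map_permutation) auto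
    then show "?t (map_option q) = a * (of_int (sign q) * (\<Prod>i\<in>UNIV. X $ i $ q i))"
      by (simp add: prod_option)
  qed
  also have "\<dots> = a * det X" by (simp add: det_def sum_distrib_left)
  finally show ?thesis .
qed

text \<open>For Jacobi's formula it is enough to differentiate the Leibniz formula at the identity.\<close>

lemma has_derivative_det_mat_1:
  fixes C :: "'a::real_normed_vector \<Rightarrow> real^'n::finite^'n"
  assumes C: "\<And>i j. ((\<lambda>y. C y $ i $ j) has_derivative (\<lambda>v. C' v $ i $ j)) (at x)" and Cx: "C x = mat 1"
  shows "((\<lambda>y. det (C y)) has_derivative (\<lambda>v. trace (C' v))) (at x)"
proof -
  let ?P = "{p. p permutes (UNIV :: 'n set)}"
  have "((\<lambda>y. det (C y)) has_derivative (\<lambda>v. \<Sum>p\<in>?P. of_int (sign p) *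
      (\<Sum>i\<in>UNIV. C' v $ i $ p i * (\<Prod>j\<in>UNIV - {i}. C x $ j $ p j)))) (at x)"
    unfolding det_def by (intro has_derivative_sum has_derivative_mult_right has_derivative_prod C)
  moreover have "(\<Sum>p\<in>?P. of_int (sign p) *
      (\<Sum>i\<in>UNIV. C' v $ i $ p i * (\<Prod>j\<in>UNIV - {i}. C x $ j $ p j))) = trace (C' v)" for v
  proof -
    let ?t = "\<lambda>p. of_int (sign p) * (\<Sum>i\<in>UNIV. C' v $ i $ p i * (\<Prod>j\<in>UNIV - {i}. C x $ j $ p j))"
    have "sum ?t ?P = sum ?t {id}"
    proof (rule sum.mono_neutral_right)
      show "\<forall>p\<in>?P - {id}. ?t p = 0"
      proof
        fix p assume p: "p \<in> ?P - {id}"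
        then obtain k where k: "p k \<noteq> k" by (auto simp: fun_eq_iff)
        \<comment> \<open>A permutation that moves \<open>k\<close> also moves \<open>p k\<close>.
          So a zero off the diagonal of the identity matrix remains after any one factor is
          omitted.\<close>
        have "(\<Prod>j\<in>UNIV - {i}. C x $ j $ p j) = 0" for i
        proof -
          have "p (p k) \<noteq> p k" using p k permutes_inj[of p UNIV] by (auto dest: injD)
          then have "C x $ p k $ p (p k) = 0" "C x $ k $ p k = 0"
            using k by (simp_all add: Cx mat_def)
          then have "\<exists>j\<in>UNIV - {i}. C x $ j $ p j = 0"
            using k by (cases "i = k") blast+
          then show ?thesis by (subst prod_zero_iff) auto
        qed
        then show "?t p = 0" by (simp only: mult_zero_right sum.neutral_const)
      qed
    qed (auto simp: finite_permutations permutes_id)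
    also have "\<dots> = trace (C' v)" by (simp add: Cx mat_def trace_def sign_id)
    finally show ?thesis .
  qed
  ultimately show ?thesis by simp
qed

lemma has_derivative_det:
  fixes A :: "'a::real_normed_vector \<Rightarrow> real^'n::finite^'n"
  assumes A: "\<And>i j. ((\<lambda>y. A y $ i $ j) has_derivative (\<lambda>v. A' v $ i $ j)) (at x)" and K: "A x ** K = mat 1"
  shows "((\<lambda>y. det (A y)) has_derivative (\<lambda>v. det (A x) * trace (A' v ** K))) (at x)"
proof -
  have "((\<lambda>y. (A y ** K) $ i $ j) has_derivative (\<lambda>v. (A' v ** K) $ i $ j)) (at x)" for i j
    by (simp add: matrix_matrix_mult_def) (intro has_derivative_sum has_derivative_mult_left A)
  from has_derivative_det_mat_1[OF this K]
  have "((\<lambda>y. det (A y ** K)) has_derivative (\<lambda>v. trace (A' v ** K))) (at x)" .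
  then have "((\<lambda>y. det (A x) * det (A y ** K)) has_derivative (\<lambda>v. det (A x) * trace (A' v ** K))) (at x)"
    by (rule has_derivative_mult_right)
  moreover have "det (A x) * det (A y ** K) = det (A y)" for y
  proof -
    have "det (A x) * det K = 1" using arg_cong[OF K, of det] by (simp add: det_mul)
    then show ?thesis by (simp add: det_mul algebra_simps)
  qed
  ultimately show ?thesis by simp
qed

definition frame :: "'a \<Rightarrow> ('n \<Rightarrow> 'a) \<Rightarrow> 'a^('n::finite option)" where
  "frame a r = (\<chi> i. case i of None \<Rightarrow> a | Some j \<Rightarrow> r j)"

lemma frame_simps [simp]: "frame a r $ None = a" "frame a r $ Some j = r j"
  by (simp_all add: frame_def)

text \<open>Changing the tangent vectors and rescaling the transversal one is left multiplication by
  a \<open>block\<close>. For arbitrary \<open>X\<close> this evaluates a volume form; for the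
  images of the basis under a transition map it compares two charts.\<close>

lemma det_frame:
  fixes L :: "real^'n \<Rightarrow> 'n::finite rvec"
  assumes L: "linear L"
  shows "det (frame (k *\<^sub>R a) (\<lambda>j. L (X j))) = k * det (\<chi> i. X i) * det (frame a (\<lambda>j. L (axis j 1)))"
proof -
  have "frame (k *\<^sub>R a) (\<lambda>j. L (X j)) = block k (\<chi> i. X i) ** frame a (\<lambda>j. L (axis j 1))"
    unfolding vec_eq_iff
  proof (intro allI)
    fix i :: "'n option" and b :: "'n option"
    show "frame (k *\<^sub>R a) (\<lambda>j. L (X j)) $ i $ b = (block k (\<chi> i. X i) ** frame a (\<lambda>j. L (axis j 1))) $ i $ b"
    proof (cases i)
      case None then show ?thesis by (simp add: matrix_matrix_mult_def sum_option)
    next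
      case (Some j)
      have "L (X j) = L (\<Sum>m\<in>UNIV. (X j $ m) *\<^sub>R axis m 1)"
        using basis_expansion[of "X j"] by (simp add: scalar_mult_eq_scaleR)
      also have "\<dots> = (\<Sum>m\<in>UNIV. (X j $ m) *\<^sub>R L (axis m 1))"
        by (simp add: linear_sum[OF L] linear_cmul[OF L])
      finally show ?thesis using Some by (simp add: matrix_matrix_mult_def sum_option)
    qed
  qed
  then show ?thesis by (simp add: det_mul det_block)
qed

lemma bilinear_eq_gram:
  fixes b :: "real^'n::finite \<Rightarrow> real^'n \<Rightarrow> real"
  assumes "linear (b u)"
  shows "b u w = (\<Sum>j\<in>UNIV. b u (axis j 1) * w $ j)"
proof -
  have "b u w = b u (\<Sum>m\<in>UNIV. (w $ m) *\<^sub>R axis m 1)"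
    using basis_expansion[of w] by (simp add: scalar_mult_eq_scaleR)
  also have "\<dots> = (\<Sum>m\<in>UNIV. b u (axis m 1) * w $ m)"
    by (simp add: linear_sum[OF assms] linear_cmul[OF assms] mult.commute)
  finally show ?thesis .
qed

lemma gram_invertible:
  fixes b :: "real^'n::finite \<Rightarrow> real^'n \<Rightarrow> real"
  assumes b1: "\<And>w. linear (\<lambda>u. b u w)" and b2: "\<And>u. linear (b u)"
    and nd: "\<And>w. (\<forall>u. b u w = 0) \<Longrightarrow> w = 0"
  shows "invertible (gram b)"
  unfolding invertible_left_inverse matrix_left_invertible_ker
proof (intro allI impI)
  fix w assume w: "gram b *v w = 0"
  have e: "b (axis i 1) w = 0" for i
  proof -
    have "(gram b *v w) $ i = b (axis i 1) w"
      using bilinear_eq_gram[where b=b and u="axis i 1" and w=w, OF b2] by (simp add: gram_def matrix_vector_mult_def)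
    then show ?thesis using w by simp
  qed
  have "b u w = (\<Sum>j\<in>UNIV. b (axis j 1) w * u $ j)" for u
    by (rule bilinear_eq_gram[where b="\<lambda>w u. b u w" and u=w and w=u, OF b1])
  then have "b u w = 0" for u using e by simp
  then show "w = 0" using nd by blast
qed

lemma matrix_inv:
  "invertible (A :: real^'n::finite^'n) \<Longrightarrow> A ** matrix_inv A = mat 1 \<and> matrix_inv A ** A = mat 1"
  unfolding invertible_def matrix_inv_def by (rule someI_ex)

section \<open>Dual pairs of hypersurfaces\<close>

text \<open>What is kept of (f, \<xi>) and its conormal in one chart. The vanishing pairings express
  that the immersion is equiaffine, together with the constancy of \<nu> \<bullet> \<xi>; the last
  assumption combines the nondegeneracy of the affine metric with that of the shape
  operator.\<close>

locale dual_pair =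
  fixes U :: "(real^'n::finite) set" and \<xi> \<nu> :: "real^'n \<Rightarrow> 'n rvec"
  assumes open_U: "open U" and smooth_\<xi>: "smooth_on U \<xi>" and smooth_\<nu>: "smooth_on U \<nu>"
    and \<nu>\<xi>: "\<And>x. x \<in> U \<Longrightarrow> \<nu> x \<bullet> \<xi> x = 1"
    and d\<nu>\<xi>: "\<And>x u. x \<in> U \<Longrightarrow> fd \<nu> x u \<bullet> \<xi> x = 0"
    and \<nu>d\<xi>: "\<And>x u. x \<in> U \<Longrightarrow> \<nu> x \<bullet> fd \<xi> x u = 0"
    and nondegenerate: "\<And>x w. x \<in> U \<Longrightarrow> (\<forall>u. fd \<nu> x u \<bullet> fd \<xi> x w = 0) \<Longrightarrow> w = 0"
begin

definition G :: "real^'n \<Rightarrow> real^'n \<Rightarrow> real^'n \<Rightarrow> real" where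
  "G x u w = - (fd \<nu> x u \<bullet> fd \<xi> x w)"

definition \<nu>2 where "\<nu>2 x u w = fd (\<lambda>y. fd \<nu> y w) x u"
definition \<xi>2 where "\<xi>2 x u w = fd (\<lambda>y. fd \<xi> y w) x u"

definition cubic :: "real^'n \<Rightarrow> real^'n \<Rightarrow> real^'n \<Rightarrow> real^'n \<Rightarrow> real" where
  "cubic x u w z = fd \<nu> x z \<bullet> \<xi>2 x u w - \<nu>2 x u w \<bullet> fd \<xi> x z"

definition trace_cubic :: "real^'n \<Rightarrow> real^'n \<Rightarrow> real" where
  "trace_cubic x z = (\<Sum>i\<in>UNIV. \<Sum>j\<in>UNIV. matrix_inv (gram (G x)) $ i $ j * cubic x (axis i 1) (axis j 1) z)"

text \<open>Frames dual to each other up to the metric. The sign in \<open>Ff\<close> compensates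
  the one in \<open>G\<close>, so that the pairings of their rows form
  \<open>block 1 (gram (G x))\<close>.\<close>

definition Nf where "Nf x = frame (\<nu> x) (\<lambda>j. fd \<nu> x (axis j 1))"
definition Ff where "Ff x = frame (\<xi> x) (\<lambda>j. - fd \<xi> x (axis j 1))"
definition Q where "Q x = det (Nf x) / det (Ff x)"

lemma lin: "x \<in> U \<Longrightarrow> linear (fd \<nu> x)" "x \<in> U \<Longrightarrow> linear (fd \<xi> x)"
  using smooth_on_linear_fd smooth_\<nu> smooth_\<xi> by blast+

lemma diff: "x \<in> U \<Longrightarrow> \<nu> differentiable (at x)" "x \<in> U \<Longrightarrow> \<xi> differentiable (at x)"
  "x \<in> U \<Longrightarrow> (\<lambda>y. fd \<nu> y u) differentiable (at x)" "x \<in> U \<Longrightarrow> (\<lambda>y. fd \<xi> y u) differentiable (at x)"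
  using smooth_on_differentiable smooth_on_fd smooth_\<nu> smooth_\<xi> by blast+

lemma \<nu>2_sym: "x \<in> U \<Longrightarrow> \<nu>2 x u w = \<nu>2 x w u"
  unfolding \<nu>2_def by (rule second_derivative_symmetric[OF open_U _ smooth_\<nu>])

lemma \<xi>2_sym: "x \<in> U \<Longrightarrow> \<xi>2 x u w = \<xi>2 x w u"
  unfolding \<xi>2_def by (rule second_derivative_symmetric[OF open_U _ smooth_\<xi>])

lemma fd_inner_const:
  assumes x: "x \<in> U" and c: "\<And>y. y \<in> U \<Longrightarrow> a y \<bullet> b y = (k::real)"
    and a: "a differentiable (at x)" and b: "b differentiable (at x)"
  shows "a x \<bullet> fd b x u + fd a x u \<bullet> b x = 0"
proof -
  have "fd (\<lambda>y. a y \<bullet> b y) x u = fd (\<lambda>y. k) x u"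
    by (rule fun_cong[OF fd_cong[OF open_U x c]])
  then show ?thesis using fd_inner[OF a b, of u] by simp
qed

text \<open>Differentiating \<open>fd \<nu> y w \<bullet> \<xi> y = 0\<close> trades the product of
  first derivatives for a second derivative of \<open>\<nu>\<close>, and the symmetry of
  \<open>G\<close> is inherited from it.\<close>

lemma G_\<nu>2: "x \<in> U \<Longrightarrow> G x w u = \<nu>2 x u w \<bullet> \<xi> x"
  using fd_inner_const[where a="\<lambda>y. fd \<nu> y w" and b=\<xi>, OF _ d\<nu>\<xi> diff(3) diff(2), of x u]
  by (simp add: G_def \<nu>2_def)

lemma G_sym: "x \<in> U \<Longrightarrow> G x u w = G x w u"
  using G_\<nu>2 \<nu>2_sym by metis

lemma G_bilinear: "x \<in> U \<Longrightarrow> linear (\<lambda>u. G x u w)" "x \<in> U \<Longrightarrow> linear (G x u)"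
  unfolding G_def
  by (auto intro!: linearI simp: linear_add[OF lin(1)] linear_add[OF lin(2)] linear_cmul[OF lin(1)]
      linear_cmul[OF lin(2)] inner_add_left inner_add_right algebra_simps)

lemma G_nondegenerate: "x \<in> U \<Longrightarrow> (\<forall>u. G x u w = 0) \<Longrightarrow> w = 0"
  using nondegenerate[of x w] by (simp add: G_def)

lemma gram_G_invertible: assumes x: "x \<in> U" shows "invertible (gram (G x))"
  by (rule gram_invertible) (fact G_bilinear[OF x] G_nondegenerate[OF x])+

lemma gram_G_inv: "x \<in> U \<Longrightarrow> gram (G x) ** matrix_inv (gram (G x)) = mat 1"
  using matrix_inv[OF gram_G_invertible] by blast

lemma transpose_gram_G: "x \<in> U \<Longrightarrow> transpose (gram (G x)) = gram (G x)"
  by (simp add: vec_eq_iff transpose_def gram_def G_sym)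

lemma Nf_Ff: assumes x: "x \<in> U" shows "Nf x ** transpose (Ff x) = block 1 (gram (G x))"
  unfolding vec_eq_iff
proof (intro allI)
  fix i j
  have "(Nf x ** transpose (Ff x)) $ i $ j = Nf x $ i \<bullet> Ff x $ j"
    by (simp add: matrix_matrix_mult_def transpose_def inner_vec_def)
  also have "\<dots> = block 1 (gram (G x)) $ i $ j"
    using x by (cases i; cases j) (simp_all add: Nf_def Ff_def \<nu>\<xi> d\<nu>\<xi> \<nu>d\<xi> gram_def G_def)
  finally show "(Nf x ** transpose (Ff x)) $ i $ j = block 1 (gram (G x)) $ i $ j" .
qed

lemma Ff_Nf: assumes x: "x \<in> U" shows "Ff x ** transpose (Nf x) = block 1 (gram (G x))"
  using arg_cong[OF Nf_Ff[OF x], of transpose]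
  by (simp add: matrix_transpose_mul transpose_transpose transpose_block transpose_gram_G[OF x])

lemma det_Nf_Ff: "x \<in> U \<Longrightarrow> det (Nf x) * det (Ff x) = det (gram (G x))"
  using arg_cong[OF Nf_Ff, of x det] by (simp add: det_mul det_block)

lemma det_G: "x \<in> U \<Longrightarrow> det (gram (G x)) \<noteq> 0"
  using gram_G_invertible invertible_det_nz by blast

lemma det_nz: assumes "x \<in> U" shows "det (Nf x) \<noteq> 0" "det (Ff x) \<noteq> 0" "Q x \<noteq> 0"
  using det_Nf_Ff[OF assms] det_G[OF assms] by (auto simp: Q_def)

text \<open>Differentiate the symmetry of the metric.\<close>

lemma cubic_sym:
  assumes x: "x \<in> U"
  shows "cubic x u w z = fd \<nu> x w \<bullet> \<xi>2 x z u - \<nu>2 x z u \<bullet> fd \<xi> x w"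
proof -
  have c: "fd \<nu> y w \<bullet> fd \<xi> y z = fd \<nu> y z \<bullet> fd \<xi> y w" if "y \<in> U" for y
    using G_sym[OF that, of w z] by (simp add: G_def)
  have "fd (\<lambda>y. fd \<nu> y w \<bullet> fd \<xi> y z) x u = fd (\<lambda>y. fd \<nu> y z \<bullet> fd \<xi> y w) x u"
    by (rule fun_cong[OF fd_cong[OF open_U x c]])
  then have "fd \<nu> x w \<bullet> \<xi>2 x u z + \<nu>2 x u w \<bullet> fd \<xi> x z = fd \<nu> x z \<bullet> \<xi>2 x u w + \<nu>2 x u z \<bullet> fd \<xi> x w"
    by (simp add: fd_inner diff x \<xi>2_def \<nu>2_def)
  then show ?thesis unfolding cubic_def \<xi>2_sym[OF x, of z u] \<nu>2_sym[OF x, of z u] by simp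
qed

lemma trace_mult_block:
  "trace (A ** transpose C ** block 1 K) = A $ None \<bullet> C $ None +
    (\<Sum>i\<in>UNIV. \<Sum>j\<in>UNIV. (A $ Some i \<bullet> C $ Some j) * K $ j $ i)"
  for A C :: "real^('k::finite option)^('k option)"
  by (simp add: trace_def matrix_matrix_mult_def sum_option transpose_def inner_vec_def)

text \<open>The inverse matrix in the formula of Jacobi is explicit: the transposed dual frame times
  a block with the inverse Gram matrix. This is applied to \<open>Nf\<close> with \<open>r\<close> =
  1 and to \<open>Ff\<close> with \<open>r\<close> = -1.\<close>

lemma has_derivative_log_det:
  assumes x: "x \<in> U" and a: "a differentiable (at x)" and da: "\<And>u. (\<lambda>y. fd a y u) differentiable (at x)"
    and A: "\<And>y. A y = frame (a y) (\<lambda>j. r *\<^sub>R fd a y (axis j 1))"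
    and AC: "A x ** transpose C = block 1 (gram (G x))"
  shows "((\<lambda>y. det (A y)) has_derivative (\<lambda>v. det (A x) * (fd a x v \<bullet> C $ None +
    (\<Sum>i\<in>UNIV. \<Sum>j\<in>UNIV. (r *\<^sub>R fd (\<lambda>y. fd a y (axis i 1)) x v \<bullet> C $ Some j) *
      matrix_inv (gram (G x)) $ j $ i)))) (at x)"
proof -
  let ?A' = "\<lambda>v. frame (fd a x v) (\<lambda>j. r *\<^sub>R fd (\<lambda>y. fd a y (axis j 1)) x v)"
  have row: "((\<lambda>y. A y $ i) has_derivative (\<lambda>v. ?A' v $ i)) (at x)" for i
  proof (cases i)
    case None then show ?thesis using fd_works[OF a] by (simp add: A)
  next
    case (Some j)
    then show ?thesis using has_derivative_scaleR_right[OF fd_works[OF da], of r] by (simp add: A)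
  qed
  have d: "((\<lambda>y. A y $ i $ j) has_derivative (\<lambda>v. ?A' v $ i $ j)) (at x)" for i j
    by (rule bounded_linear.has_derivative[OF bounded_linear_vec_nth row])
  have "A x ** (transpose C ** block 1 (matrix_inv (gram (G x)))) = mat 1"
    by (simp add: matrix_mul_assoc AC block_mult gram_G_inv[OF x] block_mat_1)
  from has_derivative_det[OF d this] show ?thesis
    by (simp add: matrix_mul_assoc trace_mult_block)
qed

text \<open>The transversal rows contribute nothing, by the duality relations. The tangent rows give
  second derivatives with \<open>z\<close> among their two directions; \<open>cubic_sym\<close>
  moves \<open>z\<close> into the last slot of the cubic form.\<close>

lemma has_derivative_Q:
  assumes x: "x \<in> U"
  shows "(Q has_derivative (\<lambda>z. Q x * trace_cubic x z)) (at x)"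
proof -
  let ?K = "matrix_inv (gram (G x))"
  let ?n = "\<lambda>z. \<Sum>i\<in>UNIV. \<Sum>j\<in>UNIV. (\<nu>2 x z (axis i 1) \<bullet> - fd \<xi> x (axis j 1)) * ?K $ j $ i"
  let ?f = "\<lambda>z. \<Sum>i\<in>UNIV. \<Sum>j\<in>UNIV. (- \<xi>2 x z (axis i 1) \<bullet> fd \<nu> x (axis j 1)) * ?K $ j $ i"
  have N: "((\<lambda>y. det (Nf y)) has_derivative (\<lambda>z. det (Nf x) * ?n z)) (at x)"
    using has_derivative_log_det[where a=\<nu> and A=Nf and r=1, OF x diff(1)[OF x] diff(3)[OF x] _ Nf_Ff[OF x]] d\<nu>\<xi>[OF x]
    by (simp add: Nf_def Ff_def \<nu>2_def)
  have F: "((\<lambda>y. det (Ff y)) has_derivative (\<lambda>z. det (Ff x) * ?f z)) (at x)"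
    using has_derivative_log_det[where a=\<xi> and A=Ff and r="-1", OF x diff(2)[OF x] diff(4)[OF x] _ Ff_Nf[OF x]] \<nu>d\<xi>[OF x]
    by (simp add: Nf_def Ff_def \<xi>2_def inner_commute)
  have "?n z - ?f z = trace_cubic x z" for z
  proof -
    have "?n z - ?f z = (\<Sum>i\<in>UNIV. \<Sum>j\<in>UNIV. cubic x (axis i 1) (axis j 1) z * ?K $ j $ i)"
      unfolding sum_subtractf[symmetric]
      by (intro sum.cong refl) (simp add: cubic_sym[OF x] algebra_simps inner_commute)
    \<comment> \<open>The indices of the inverse Gram matrix come out transposed. Exchanging the
      sums and using the symmetry of the cubic form in its first two arguments puts them
      right.\<close>
    also have "\<dots> = (\<Sum>j\<in>UNIV. \<Sum>i\<in>UNIV. cubic x (axis i 1) (axis j 1) z * ?K $ j $ i)"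
      by (rule sum.swap)
    also have "\<dots> = trace_cubic x z"
      unfolding trace_cubic_def
      by (intro sum.cong refl) (simp add: cubic_def \<xi>2_sym[OF x] \<nu>2_sym[OF x] mult.commute)
    finally show ?thesis .
  qed
  note tr = this
  have "((\<lambda>y. det (Nf y) / det (Ff y)) has_derivative
     (\<lambda>z. - det (Nf x) * (inverse (det (Ff x)) * (det (Ff x) * ?f z) * inverse (det (Ff x))) + det (Nf x) * ?n z / det (Ff x))) (at x)"
    by (rule has_derivative_divide[OF N F det_nz(2)[OF x]])
  moreover have "- det (Nf x) * (inverse (det (Ff x)) * (det (Ff x) * ?f z) * inverse (det (Ff x))) + det (Nf x) * ?n z / det (Ff x)
     = Q x * trace_cubic x z" for z
    unfolding tr[symmetric] using det_nz(2)[OF x] by (simp add: Q_def field_simps)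
  ultimately show ?thesis unfolding Q_def[abs_def] by simp
qed

lemma Q_locally_constant:
  assumes t: "\<forall>x\<in>U. \<forall>z. trace_cubic x z = 0" and x: "x \<in> U"
  shows "\<exists>V. open V \<and> x \<in> V \<and> V \<subseteq> U \<and> (\<forall>y\<in>V. Q y = Q x)"
proof -
  obtain r where r: "r > 0" "ball x r \<subseteq> U" using open_U x open_contains_ball by blast
  have d: "(Q has_derivative (\<lambda>h. 0)) (at y within ball x r)" if "y \<in> ball x r" for y
  proof -
    have "y \<in> U" using r that by blast
    then have "(Q has_derivative (\<lambda>h. 0)) (at y)" using has_derivative_Q[OF \<open>y \<in> U\<close>] t by simp
    then show ?thesis by (rule has_derivative_at_withinI)
  qed
  have xb: "x \<in> ball x r" using r(1) by simp
  have c: "\<forall>y\<in>ball x r. Q y = Q x"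
  proof
    fix y assume y: "y \<in> ball x r"
    show "Q y = Q x" by (rule has_derivative_zero_unique[OF convex_ball d y xb])
  qed
  show ?thesis by (intro exI[of _ "ball x r"] conjI open_ball xb r(2) c)
qed

lemma trace_cubic_zero:
  assumes x: "x \<in> U" and V: "open V" "x \<in> V" "\<And>y. y \<in> V \<Longrightarrow> Q y = Q x"
  shows "trace_cubic x z = 0"
proof -
  have "fd Q x = fd (\<lambda>y. Q x) x" by (rule fd_cong[OF V])
  then have "(\<lambda>z. Q x * trace_cubic x z) = (\<lambda>z. 0)" unfolding fd_eq[OF has_derivative_Q[OF x]] by simp
  then have "Q x * trace_cubic x z = 0" by (rule fun_cong)
  then show ?thesis using det_nz(3)[OF x] by simp
qed

end

section \<open>Immersions of manifolds into targets realised in a flat space\<close>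

lemma homeomorphic_chart_inv:
  assumes hom: "homeomorphic_map (subtopology X (fst c)) (top_of_set (snd c ` fst c)) (snd c)"
    and sub: "fst c \<subseteq> topspace X"
  shows "continuous_map (top_of_set (snd c ` fst c)) (subtopology X (fst c)) (chart_inv c)"
proof -
  have top: "topspace (subtopology X (fst c)) = fst c" using sub by (simp add: Int_absorb1)
  have inj: "inj_on (snd c) (fst c)" using homeomorphic_imp_injective_map[OF hom] unfolding top .
  obtain g where g: "homeomorphic_maps (subtopology X (fst c)) (top_of_set (snd c ` fst c)) (snd c) g"
    using hom homeomorphic_map_maps by blast
  have "g y = chart_inv c y" if y: "y \<in> topspace (top_of_set (snd c ` fst c))" for y
  proof -
    obtain q where q: "q \<in> fst c" "y = snd c q" using y by auto
    then have "g y = q" using g top unfolding homeomorphic_maps_def by blast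
    moreover have "chart_inv c y = q" using q inj by (simp add: chart_inv_def)
    ultimately show ?thesis by simp
  qed
  moreover have "continuous_map (top_of_set (snd c ` fst c)) (subtopology X (fst c)) g"
    using g by (simp add: homeomorphic_maps_def)
  ultimately show ?thesis by (rule continuous_map_eq[rotated])
qed

lemma open_chart_image:
  assumes hom: "homeomorphic_map (subtopology X (fst c)) (top_of_set (snd c ` fst c)) (snd c)"
    and "open (snd c ` fst c)" and "openin X S" and "S \<subseteq> fst c"
  shows "open (snd c ` S)"
proof -
  have "openin (subtopology X (fst c)) S" using assms(3,4) by (simp add: openin_subset_topspace_eq openin_subtopology_Int2 inf.absorb_iff2[symmetric] openin_subtopology) blast
  then have "openin (top_of_set (snd c ` fst c)) (snd c ` S)"
    using homeomorphic_imp_open_map[OF hom] unfolding open_map_def by blast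
  then show ?thesis using assms(2) openin_open_eq by blast
qed

lemma manifold_chartD:
  assumes "smooth_manifold M" "c \<in> charts M"
  shows "openin (mtop M) (fst c)" "fst c \<subseteq> topspace (mtop M)" "open (snd c ` fst c)"
    "homeomorphic_map (subtopology (mtop M) (fst c)) (top_of_set (snd c ` fst c)) (snd c)"
  using assms openin_subset unfolding smooth_manifold_def by blast+

text \<open>The global version of \<open>flat_immersion\<close>, with the requirements on the target
  alone. Pseudohyperbolic space satisfies it with the inclusion as \<open>\<iota>\<close>, the
  quotient with \<open>orbit_tens\<close>.\<close>

locale flat_target =
  fixes N :: "('x, 'b::euclidean_space) pr_manifold"
    and \<iota> :: "'x \<Rightarrow> 'v::euclidean_space" and B :: "'v \<Rightarrow> 'v \<Rightarrow> real"
  assumes B: "bounded_bilinear B" and Bsym: "\<And>x y. B x y = B y x"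
    and charts_nonempty: "\<And>q. q \<in> topspace (mtop N) \<Longrightarrow> charts_at N q \<noteq> {}"
    and chart_regular: "\<And>k. k \<in> charts N \<Longrightarrow> regular_chart k"
    and chart_open: "\<And>k. k \<in> charts N \<Longrightarrow> openin (mtop N) (fst k)"
    and chart_continuous: "\<And>k. k \<in> charts N \<Longrightarrow> continuous_map (subtopology (mtop N) (fst k)) euclidean (snd k)"
    and chart_smooth: "\<And>k. k \<in> charts N \<Longrightarrow> smooth_on (snd k ` fst k) (\<lambda>y. \<iota> (chart_inv k y))"
    and chart_immersion: "\<And>k y. k \<in> charts N \<Longrightarrow> y \<in> snd k ` fst k \<Longrightarrow> inj (fd (\<lambda>y. \<iota> (chart_inv k y)) y)"
    and metric: "\<And>k q u w. k \<in> charts N \<Longrightarrow> q \<in> fst k \<Longrightarrow> pr_metric N k q u w =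
      B (fd (\<lambda>y. \<iota> (chart_inv k y)) (snd k q) u) (fd (\<lambda>y. \<iota> (chart_inv k y)) (snd k q) w)"
    and metric_nondegenerate: "\<And>k q. k \<in> charts N \<Longrightarrow> q \<in> fst k \<Longrightarrow> nondegenerate_form (pr_metric N k q)"
begin

context
  fixes M :: "('m, real^'n::finite) manifold" and \<sigma> :: "'m \<Rightarrow> 'x"
  assumes M: "smooth_manifold M" and \<sigma>: "continuous_map (mtop M) (mtop N) \<sigma>"
    and \<iota>\<sigma>: "smooth_vmap M (\<lambda>p. \<iota> (\<sigma> p))"
    and nondeg: "\<And>p c u. p \<in> topspace (mtop M) \<Longrightarrow> c \<in> charts_at M p \<Longrightarrow>
      (\<forall>w. B (push c (\<lambda>p. \<iota> (\<sigma> p)) p u) (push c (\<lambda>p. \<iota> (\<sigma> p)) p w) = 0) \<Longrightarrow> u = 0"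
begin

lemma preimage_subset: "snd c ` {q \<in> fst c. \<sigma> q \<in> fst k} \<subseteq> snd c ` fst c"
  by auto

lemma preimage_open:
  assumes "c \<in> charts M" "k \<in> charts N"
  shows "open (snd c ` {q \<in> fst c. \<sigma> q \<in> fst k})"
proof (rule open_chart_image[OF manifold_chartD(4,3)[OF M assms(1)]])
  have "{q \<in> fst c. \<sigma> q \<in> fst k} = {q \<in> topspace (mtop M). \<sigma> q \<in> fst k} \<inter> fst c"
    using manifold_chartD(2)[OF M assms(1)] by auto
  moreover have "openin (mtop M) {q \<in> topspace (mtop M). \<sigma> q \<in> fst k}"
    by (rule openin_continuous_map_preimage[OF \<sigma> chart_open[OF assms(2)]])
  ultimately show "openin (mtop M) {q \<in> fst c. \<sigma> q \<in> fst k}"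
    using manifold_chartD(1)[OF M assms(1)] by (simp add: openin_Int)
qed auto

lemma preimage_in:
  assumes "c \<in> charts M" "x \<in> snd c ` {q \<in> fst c. \<sigma> q \<in> fst k}"
  shows "\<sigma> (chart_inv c x) \<in> fst k" "chart_inv c x \<in> fst c"
  using assms chart_inv_left[OF regular_chart_manifold[OF M assms(1)]] by auto

text \<open>In the chart \<open>k\<close> the map is a priori only continuous, but it becomes smooth
  after the immersion \<open>\<iota> (chart_inv k y)\<close>, which can be cancelled.\<close>

lemma smooth_in_chart:
  assumes c: "c \<in> charts M" and k: "k \<in> charts N"
  shows "smooth_on (snd c ` {q \<in> fst c. \<sigma> q \<in> fst k}) (\<lambda>x. snd k (\<sigma> (chart_inv c x)))"
    (is "smooth_on ?T _")
proof (rule smooth_on_left_factor[OF preimage_open[OF c k] _ _ chart_immersion[OF k] _ chart_smooth[OF k]])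
  show "(\<lambda>x. snd k (\<sigma> (chart_inv c x))) ` ?T \<subseteq> snd k ` fst k"
    using preimage_in(1)[OF c] by blast
  show "\<iota> (chart_inv k (snd k (\<sigma> (chart_inv c x)))) = \<iota> (\<sigma> (chart_inv c x))" if "x \<in> ?T" for x
    using chart_inv_left[OF chart_regular[OF k] preimage_in(1)[OF c that]] by simp
  show "smooth_on ?T (\<lambda>x. \<iota> (\<sigma> (chart_inv c x)))"
  proof (rule smooth_on_subset[OF _ preimage_subset])
    show "smooth_on (snd c ` fst c) (\<lambda>x. \<iota> (\<sigma> (chart_inv c x)))"
      using bspec[OF \<iota>\<sigma>[unfolded smooth_vmap_def] c] by (simp add: o_def)
  qed
  have "continuous_map (top_of_set ?T) (mtop M) (chart_inv c)"
    by (rule continuous_map_from_subtopology_mono[OF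
          continuous_map_into_fulltopology[OF homeomorphic_chart_inv[OF manifold_chartD(4,2)[OF M c]]]
          preimage_subset])
  from continuous_map_compose[OF this \<sigma>]
  have "continuous_map (top_of_set ?T) (subtopology (mtop N) (fst k)) (\<lambda>x. \<sigma> (chart_inv c x))"
    using preimage_in(1)[OF c] by (auto simp: continuous_map_in_subtopology o_def)
  from continuous_map_compose[OF this chart_continuous[OF k]]
  show "continuous_on ?T (\<lambda>x. snd k (\<sigma> (chart_inv c x)))" by (simp add: o_def)
qed

lemma flat_immersion:
  assumes p: "p \<in> topspace (mtop M)" and c: "c \<in> charts_at M p" and k: "k \<in> charts_at N (\<sigma> p)"
  shows "flat_immersion N c k \<sigma> p \<iota> B (snd c ` {q \<in> fst c. \<sigma> q \<in> fst k})"
proof -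
  have c': "c \<in> charts M" "p \<in> fst c" and k': "k \<in> charts N" "\<sigma> p \<in> fst k"
    using c k by (auto simp: charts_at_def)
  show ?thesis
  proof (rule flat_immersion.intro)
    show "regular_chart c" "p \<in> fst c" "regular_chart k"
      using regular_chart_manifold[OF M c'(1)] c'(2) chart_regular[OF k'(1)] .
    show "u = 0" if "\<forall>w. pr_metric N k (\<sigma> p) u w = 0" for u
      using metric_nondegenerate[OF k'] that unfolding nondegenerate_form_def by blast
    show "snd c p \<in> snd c ` {q \<in> fst c. \<sigma> q \<in> fst k}" using c'(2) k'(2) by blast
  qed (fact B Bsym chart_smooth[OF k'(1)] metric[OF k'(1)] preimage_open[OF c'(1) k'(1)] preimage_subset
      preimage_in(1)[OF c'(1)] smooth_in_chart[OF c'(1) k'(1)])+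
qed

lemma push_\<iota>\<sigma>: "push c (\<lambda>p. \<iota> (\<sigma> p)) p = fd (flat_immersion.s c \<sigma> \<iota>) (flat_immersion.x0 c p)"
  if "flat_immersion N c k \<sigma> p \<iota> B T"
  by (simp add: push_fd flat_immersion.s_def[OF that, abs_def] flat_immersion.x0_def[OF that])

text \<open>Nondegeneracy is tested on derivatives in the flat space. It implies injectivity, since
  a vector in the kernel of the differential is orthogonal to all others.\<close>

lemma nondegenerate_immersion: "nondegenerate_immersion M N \<sigma>"
  unfolding nondegenerate_immersion_def
proof (intro conjI ballI)
  show "smooth_map M N \<sigma>"
    unfolding smooth_map_def
  proof (intro conjI ballI \<sigma>)
    fix p assume p: "p \<in> topspace (mtop M)"
    then obtain c where c: "c \<in> charts M" "p \<in> fst c" using M unfolding smooth_manifold_def by blast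
    have "\<sigma> p \<in> topspace (mtop N)" using \<sigma> p by (simp add: continuous_map_def Pi_iff)
    from charts_nonempty[OF this] obtain k where k: "k \<in> charts N" "\<sigma> p \<in> fst k"
      unfolding charts_at_def by blast
    show "\<exists>c\<in>charts_at M p. \<exists>k\<in>charts_at N (\<sigma> p).
        smooth_on (snd c ` {q \<in> fst c. \<sigma> q \<in> fst k}) (snd k \<circ> \<sigma> \<circ> chart_inv c)"
      using smooth_in_chart[OF c(1) k(1)] c k
      by (intro bexI[of _ c] bexI[of _ k]) (simp_all add: charts_at_def o_def)
  qed
  fix p c k assume pck: "p \<in> topspace (mtop M)" "c \<in> charts_at M p" "k \<in> charts_at N (\<sigma> p)"
  interpret f: flat_immersion N c k \<sigma> p \<iota> B "snd c ` {q \<in> fst c. \<sigma> q \<in> fst k}"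
    by (rule flat_immersion[OF pck])
  have ps: "push c (\<lambda>p. \<iota> (\<sigma> p)) p = fd f.s f.x0"
    by (rule push_\<iota>\<sigma>[OF flat_immersion[OF pck]])
  have nd: "u = 0" if "\<forall>w. B (fd f.s f.x0 u) (fd f.s f.x0 w) = 0" for u
    using nondeg[OF pck(1,2)] that ps by simp
  then show "nondegenerate_form (induced_metric N c k \<sigma> p)"
    unfolding nondegenerate_form_def by (simp add: f.induced)
  show "inj (push c (snd k \<circ> \<sigma>) p)"
    unfolding f.push_\<phi>
  proof (subst linear_injective_0[OF f.lin\<phi>], intro allI impI)
    fix u assume "fd f.\<phi> f.x0 u = 0"
    then have "fd f.s f.x0 u = 0" using f.fd_s[OF f.\<sigma>p(4)] f.lin\<psi> by (simp add: f.y0_def linear_0)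
    then have "\<forall>w. B (fd f.s f.x0 u) (fd f.s f.x0 w) = 0" using B by (simp add: bounded_bilinear.zero_left)
    then show "u = 0" by (rule nd)
  qed
qed

text \<open>The chart \<open>k\<close> enters the criterion only through the tangent space of the
  target in the flat space. For each target it remains to describe this space without reference to
  \<open>k\<close>.\<close>

lemma maximal_immersion_iff:
  "maximal_immersion M N \<sigma> \<longleftrightarrow>
    (\<forall>p\<in>topspace (mtop M). \<forall>c\<in>charts_at M p. \<forall>k\<in>charts_at N (\<sigma> p).
      \<forall>X\<in>range (fd (\<lambda>y. \<iota> (chart_inv k y)) (snd k (\<sigma> p))).
        (\<forall>e. B X (push c (\<lambda>p. \<iota> (\<sigma> p)) p e) = 0) \<longrightarrow>
        (\<Sum>i\<in>UNIV. \<Sum>j\<in>UNIV.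
          matrix_inv (gram (\<lambda>u w. B (push c (\<lambda>p. \<iota> (\<sigma> p)) p u) (push c (\<lambda>p. \<iota> (\<sigma> p)) p w))) $ i $ j *
          B (push2 c (\<lambda>p. \<iota> (\<sigma> p)) p (axis i 1) (axis j 1)) X) = 0)"
  unfolding maximal_immersion_def
proof (simp only: nondegenerate_immersion simp_thms, intro ball_cong refl)
  fix p c k assume pck: "p \<in> topspace (mtop M)" "c \<in> charts_at M p" "k \<in> charts_at N (\<sigma> p)"
  interpret f: flat_immersion N c k \<sigma> p \<iota> B "snd c ` {q \<in> fst c. \<sigma> q \<in> fst k}"
    by (rule flat_immersion[OF pck])
  have ps: "push c (\<lambda>p. \<iota> (\<sigma> p)) p = fd f.s f.x0"
    by (rule push_\<iota>\<sigma>[OF flat_immersion[OF pck]])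
  have ps2: "push2 c (\<lambda>p. \<iota> (\<sigma> p)) p = f.IIs"
    by (intro ext) (simp add: push2_fd[OF f.c] f.IIs_def f.s_def[abs_def] f.x0_def)
  have nd: "u = 0" if "\<forall>w. B (fd f.s f.x0 u) (fd f.s f.x0 w) = 0" for u
    using nondeg[OF pck(1,2)] that ps by simp
  have y: "fd (\<lambda>y. \<iota> (chart_inv k y)) (snd k (\<sigma> p)) = fd f.\<psi> f.y0"
    by (simp add: f.\<psi>_def[abs_def] f.\<sigma>p(3))
  show "(mean_curvature N c k \<sigma> p = 0) = (\<forall>X\<in>range (fd (\<lambda>y. \<iota> (chart_inv k y)) (snd k (\<sigma> p))).
        (\<forall>e. B X (push c (\<lambda>p. \<iota> (\<sigma> p)) p e) = 0) \<longrightarrow>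
        (\<Sum>i\<in>UNIV. \<Sum>j\<in>UNIV.
          matrix_inv (gram (\<lambda>u w. B (push c (\<lambda>p. \<iota> (\<sigma> p)) p u) (push c (\<lambda>p. \<iota> (\<sigma> p)) p w))) $ i $ j *
          B (push2 c (\<lambda>p. \<iota> (\<sigma> p)) p (axis i 1) (axis j 1)) X) = 0)"
    unfolding ps ps2 y by (rule f.mean_curvature_zero_iff[OF nd])
qed

end

end

section \<open>Pseudohyperbolic space\<close>

lemma submanifold_chartD:
  assumes "k \<in> submanifold_charts S"
  shows "regular_chart k" "fst k \<subseteq> S" "openin (top_of_set S) (fst k)"
    "continuous_map (top_of_set (fst k)) euclidean (snd k)"
    "smooth_on (snd k ` fst k) (chart_inv k)"
    "y \<in> snd k ` fst k \<Longrightarrow> inj (fd (chart_inv k) y)"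
proof -
  have hom: "homeomorphic_map (top_of_set (fst k)) (top_of_set (snd k ` fst k)) (snd k)"
    and op: "open (snd k ` fst k)" and opS: "openin (top_of_set S) (fst k)"
    and sm: "smooth_on (snd k ` fst k) (chart_inv k)"
    and inj: "\<forall>z\<in>fst k. inj (push k (\<lambda>x. x) z)"
    using assms by (auto simp: submanifold_charts_def)
  have "inj_on (snd k) (fst k)" using homeomorphic_imp_injective_map[OF hom] by simp
  then show "regular_chart k" using op by (simp add: regular_chart_def)
  show "openin (top_of_set S) (fst k)" by (rule opS)
  then show "fst k \<subseteq> S" using openin_imp_subset by blast
  show "continuous_map (top_of_set (fst k)) euclidean (snd k)"
    using homeomorphic_imp_continuous_map[OF hom] continuous_map_into_fulltopology by blast
  show "smooth_on (snd k ` fst k) (chart_inv k)" by (rule sm)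
  show "inj (fd (chart_inv k) y)" if y: "y \<in> snd k ` fst k"
    using inj y by (auto simp: push_fd)
qed

lemma bounded_bilinear_ghat: "bounded_bilinear ghat"
  unfolding bilinear_conv_bounded_bilinear[symmetric] bilinear_def
  by (auto intro!: linearI simp: ghat_def algebra_simps add_divide_distrib)

lemma ghat_sym: "ghat x y = ghat y x"
  by (simp add: ghat_def add.commute)

lemma ghat_self: "z \<in> hyp_set \<Longrightarrow> ghat z z = - 1"
  by (auto simp: ghat_def hyp_set_def)

lemma tangent_hyp_set:
  assumes U: "open U" "x \<in> U" and F: "F differentiable (at x)" "\<And>y. y \<in> U \<Longrightarrow> F y \<in> hyp_set"
  shows "ghat (fd F x u) (F x) = 0"
proof -
  have "fd (\<lambda>y. ghat (F y) (F y)) x = fd (\<lambda>y. - 1) x"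
    by (rule fd_cong[OF U]) (simp add: ghat_self F(2))
  then have "ghat (F x) (fd F x u) + ghat (fd F x u) (F x) = 0"
    using fd_bilinear[OF bounded_bilinear_ghat F(1) F(1), of u] by simp
  then show ?thesis using ghat_sym[of "F x" "fd F x u"] by simp
qed

text \<open>One inclusion comes from differentiating the defining equation. Equality is a dimension
  count: the right-hand side is the Euclidean hyperplane orthogonal to
  \<open>(snd z, fst z)\<close>, of dimension 2n+1 like the coordinate space.\<close>

lemma tangent_pseudohyperbolic:
  fixes k :: "('n::finite rvec \<times> 'n rvec, (real^'n) \<times> (real^'n) \<times> real) chart"
  assumes k: "k \<in> submanifold_charts hyp_set" and z: "z \<in> fst k"
  shows "range (fd (chart_inv k) (snd k z)) = {X. ghat X z = 0}"
proof -
  let ?D = "fd (chart_inv k) (snd k z)" and ?U = "snd k ` fst k"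
  have kz: "chart_inv k (snd k z) = z" by (rule chart_inv_left[OF submanifold_chartD(1)[OF k] z])
  have y: "snd k z \<in> ?U" using z by blast
  have d: "chart_inv k differentiable (at (snd k z))"
    by (rule smooth_on_differentiable[OF submanifold_chartD(5)[OF k] y])
  have lin: "linear ?D" by (rule linear_frechet_derivative[OF d])
  have "ghat (?D u) z = 0" for u
    using tangent_hyp_set[OF regular_chart_open[OF submanifold_chartD(1)[OF k]] y d, of u]
      chart_inv_in[of _ k] submanifold_chartD(2)[OF k] unfolding kz by blast
  then have sub: "range ?D \<subseteq> {X. ghat X z = 0}" by blast
  have eq: "{X. ghat X z = 0} = {X. (snd z, fst z) \<bullet> X = 0}"
    by (auto simp: ghat_def inner_Pair_0 inner_prod_def inner_commute)
  have "snd z \<bullet> fst z = - 1" using z submanifold_chartD(2)[OF k] by (auto simp: hyp_set_def)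
  then have "(snd z, fst z) \<noteq> 0" by (auto simp: zero_prod_def)
  from dim_hyperplane[OF this] have dT: "dim {X. ghat X z = 0} = 2 * CARD('n) + 1"
    by (simp add: eq)
  have "dim (range ?D) = dim (UNIV :: ((real^'n) \<times> (real^'n) \<times> real) set)"
    using submanifold_chartD(6)[OF k y] by (intro dim_image_eq[OF lin]) (simp add: inj_on_subset)
  then have dR: "dim (range ?D) = 2 * CARD('n) + 1" by (simp add: dim_UNIV)
  show ?thesis
  proof (rule subspace_dim_equal[OF _ _ sub])
    show "subspace (range ?D)" using linear_subspace_image[OF lin subspace_UNIV] .
    show "subspace {X. ghat X z = 0}" unfolding eq by (rule subspace_hyperplane)
    show "dim {X. ghat X z = 0} \<le> dim (range ?D)" by (simp add: dT dR)
  qed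
qed

text \<open>Since \<open>ghat z z = -1\<close>, any vector becomes tangent after adding a multiple
  of \<open>z\<close>, and \<open>X\<close> is orthogonal to \<open>z\<close>. So \<open>X\<close>
  is orthogonal to the whole space.\<close>

lemma ghat_nondegenerate:
  assumes z: "z \<in> hyp_set" and X: "ghat X z = 0" and 0: "\<And>Y. ghat Y z = 0 \<Longrightarrow> ghat X Y = 0"
  shows "X = 0"
proof -
  interpret g: bounded_bilinear ghat by (rule bounded_bilinear_ghat)
  have "ghat X Y = 0" for Y
  proof -
    have "ghat (Y + ghat Y z *\<^sub>R z) z = 0" by (simp add: g.add_left g.scaleR_left ghat_self[OF z])
    from 0[OF this] show ?thesis by (simp add: g.add_right g.scaleR_right X)
  qed
  \<comment> \<open>With its components exchanged as second argument, \<open>ghat\<close> returns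
    half the Euclidean square norm of \<open>X\<close>.\<close>
  from this[of "(snd X, fst X)"] have "fst X \<bullet> fst X + snd X \<bullet> snd X = 0"
    by (simp add: ghat_def add.commute)
  then show "X = 0"
    by (metis add_nonneg_eq_0_iff inner_eq_zero_iff inner_ge_zero prod.collapse zero_prod_def)
qed

text \<open>Coordinates on the vectors and the covectors which are adapted to the direction of a given
  vector. The last coordinate of the covector is determined by the equation of pseudohyperbolic
  space wherever that of the vector does not vanish.\<close>

locale adapted_coordinates =
  fixes L :: "(real^'n::finite) \<times> real \<Rightarrow> 'n rvec" and L' :: "'n rvec \<Rightarrow> (real^'n) \<times> real"
  assumes lin_L: "linear L" and lin_L': "linear L'" and L'L: "\<And>x. L' (L x) = x" and LL': "\<And>y. L (L' y) = y"
    and inner_L: "\<And>x y. L x \<bullet> L y = x \<bullet> y"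
begin

definition coord :: "'n rvec \<times> 'n rvec \<Rightarrow> (real^'n) \<times> (real^'n) \<times> real" where
  "coord z = (fst (L' (fst z)), fst (L' (snd z)), snd (L' (fst z)))"

definition param :: "(real^'n) \<times> (real^'n) \<times> real \<Rightarrow> 'n rvec \<times> 'n rvec" where
  "param y = (L (fst y, snd (snd y)), L (fst (snd y), (- 1 - fst y \<bullet> fst (snd y)) * inverse (snd (snd y))))"

definition W :: "((real^'n) \<times> (real^'n) \<times> real) set" where "W = {y. snd (snd y) > 0}"
definition Dom :: "('n rvec \<times> 'n rvec) set" where "Dom = {z \<in> hyp_set. snd (L' (fst z)) > 0}"
definition hyp_chart where "hyp_chart = (Dom, coord)"

lemma bounded_linear_L: "bounded_linear L" "bounded_linear L'"
  using lin_L lin_L' linear_conv_bounded_linear by blast+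

lemma open_W: "open W"
  unfolding W_def by (intro open_Collect_less continuous_intros)

lemma param_Dom: "y \<in> W \<Longrightarrow> param y \<in> Dom"
  by (auto simp: W_def Dom_def param_def hyp_set_def L'L inner_L inner_prod_def inner_commute
      mult.left_commute[of "snd (snd y)"])

lemma coord_param: "y \<in> W \<Longrightarrow> coord (param y) = y"
  by (simp add: coord_def param_def L'L)

lemma coord_W: "z \<in> Dom \<Longrightarrow> coord z \<in> W"
  by (simp add: W_def Dom_def coord_def)

lemma hyp_coords:
  assumes "z \<in> hyp_set"
  shows "fst (L' (fst z)) \<bullet> fst (L' (snd z)) + snd (L' (fst z)) * snd (L' (snd z)) = - 1"
  using assms inner_L[of "L' (snd z)" "L' (fst z)"]
  by (simp add: LL' hyp_set_def case_prod_unfold inner_prod_def inner_commute mult.commute)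

lemma param_coord: assumes "z \<in> Dom" shows "param (coord z) = z"
proof -
  have z: "z \<in> hyp_set" "snd (L' (fst z)) > 0" using assms by (auto simp: Dom_def)
  have "(- 1 - fst (L' (fst z)) \<bullet> fst (L' (snd z))) * inverse (snd (L' (fst z))) = snd (L' (snd z))"
    using hyp_coords[OF z(1)] z(2) by (simp add: field_simps)
  then show ?thesis by (simp add: param_def coord_def LL' prod_eq_iff)
qed

lemma bounded_linear_coord: "bounded_linear coord"
  unfolding coord_def
  by (intro bounded_linear_Pair bounded_linear_compose[OF bounded_linear_fst] bounded_linear_compose[OF bounded_linear_snd]
      bounded_linear_compose[OF bounded_linear_L(2)] bounded_linear_fst bounded_linear_snd)

lemma smooth_param: "smooth_on W param"
  unfolding param_def
proof (intro smooth_on_Pair[OF open_W] smooth_on_bounded_linear[OF bounded_linear_L(1) open_W])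
  note I = smooth_on_ident[OF open_W]
  have t: "smooth_on W (\<lambda>y. snd (snd y))" by (intro smooth_on_snd open_W I)
  have a: "smooth_on W fst" by (intro smooth_on_fst open_W I)
  have b: "smooth_on W (\<lambda>y. fst (snd y))" by (intro smooth_on_fst smooth_on_snd open_W I)
  show "smooth_on W fst" "smooth_on W (\<lambda>y. snd (snd y))" "smooth_on W (\<lambda>y. fst (snd y))"
    by (fact a t b)+
  have i: "smooth_on W (\<lambda>y. inverse (snd (snd y)))"
    by (rule smooth_on_inverse[OF open_W _ t]) (auto simp: W_def)
  have "smooth_on W (\<lambda>y. - 1 + - (fst y \<bullet> fst (snd y)))"
    by (intro smooth_on_add smooth_on_minus smooth_on_inner smooth_on_const open_W a b)
  then have "smooth_on W (\<lambda>y. - 1 - fst y \<bullet> fst (snd y))" by simp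
  from smooth_on_mult[OF open_W this i]
  show "smooth_on W (\<lambda>y. (- 1 - fst y \<bullet> fst (snd y)) * inverse (snd (snd y)))" .
qed

lemma image_coord: "coord ` Dom = W"
  using coord_W coord_param param_Dom by (metis (no_types, lifting) image_eqI image_subsetI subsetI subset_antisym)

lemma inj_coord: "inj_on coord Dom"
  using param_coord by (metis inj_onI)

lemma hyp_chart_inv: "y \<in> W \<Longrightarrow> chart_inv hyp_chart y = param y"
  unfolding chart_inv_def hyp_chart_def
  using inv_into_f_f[OF inj_coord param_Dom] coord_param by fastforce

lemma hyp_chart_in: "hyp_chart \<in> submanifold_charts hyp_set"
  unfolding submanifold_charts_def
proof (intro CollectI conjI ballI)
  have fs: "fst hyp_chart = Dom" "snd hyp_chart = coord" by (simp_all add: hyp_chart_def)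
  have "open {z :: 'n rvec \<times> 'n rvec. snd (L' (fst z)) > 0}"
    using linear_continuous_on[OF bounded_linear_compose[OF bounded_linear_L(2) bounded_linear_fst], of UNIV]
    by (intro open_Collect_less continuous_intros) auto
  then have "openin (top_of_set hyp_set) (hyp_set \<inter> {z. snd (L' (fst z)) > 0})" by blast
  then show "openin (top_of_set hyp_set) (fst hyp_chart)"
    unfolding fs Dom_def by (simp add: Collect_conj_eq)
  show "open (snd hyp_chart ` fst hyp_chart)" unfolding fs image_coord by (rule open_W)
  have "homeomorphic_maps (top_of_set Dom) (top_of_set W) coord param"
    unfolding homeomorphic_maps_def
    using linear_continuous_on[OF bounded_linear_coord] smooth_on_continuous_on[OF smooth_param]
    by (auto simp: continuous_map_in_subtopology coord_W param_Dom coord_param param_coord)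
  then show "homeomorphic_map (top_of_set (fst hyp_chart)) (top_of_set (snd hyp_chart ` fst hyp_chart)) (snd hyp_chart)"
    unfolding fs image_coord using homeomorphic_map_maps by blast
  show "smooth_on (snd hyp_chart ` fst hyp_chart) (chart_inv hyp_chart)"
    unfolding fs image_coord
    by (rule smooth_on_cong[OF open_W _ smooth_param]) (simp add: hyp_chart_inv)
  fix z assume "z \<in> fst hyp_chart"
  then have y: "coord z \<in> W" using coord_W by (simp add: fs)
  have d: "param differentiable (at (coord z))" by (rule smooth_on_differentiable[OF smooth_param y])
  have "coord (fd param (coord z) u) = u" for u
  proof -
    have "fd (\<lambda>y. coord (param y)) (coord z) = fd (\<lambda>y. y) (coord z)"
      by (rule fd_cong[OF open_W y]) (simp add: coord_param)
    then show ?thesis using fd_bounded_linear[OF bounded_linear_coord d, of u] by simp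
  qed
  then have "inj (fd param (coord z))" by (metis injI)
  moreover have "push hyp_chart (\<lambda>x. x) z = fd param (coord z)"
    unfolding push_fd fs by (rule fd_cong[OF open_W y]) (simp add: hyp_chart_inv)
  ultimately show "inj (push hyp_chart (\<lambda>x. x) z)" by simp
qed

end

text \<open>A linear isometry is followed by an orthogonal transformation that takes the image of
  (0, 1) to the direction of \<open>v\<close>. The same isometry serves vectors and covectors, as
  their pairing is the inner product.\<close>

lemma adapted_coordinates_exist:
  fixes v :: "'n::finite rvec"
  assumes "v \<noteq> 0"
  shows "\<exists>L L'. adapted_coordinates L L' \<and> snd (L' v) > 0"
proof -
  have "DIM((real^'n) \<times> real) = DIM('n rvec)" by simp
  then obtain f :: "(real^'n) \<times> real \<Rightarrow> 'n rvec" and g where fg: "linear f" "linear g"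
    "\<And>x. norm (f x) = norm x" "\<And>y. norm (g y) = norm y" "\<And>x. g (f x) = x" "\<And>y. f (g y) = y"
    by (rule isomorphisms_UNIV_UNIV) (rule that)
  have "norm (f (0, 1)) = 1" by (simp add: fg(3))
  moreover have "norm (v /\<^sub>R norm v) = 1" using assms by simp
  ultimately obtain h where h: "orthogonal_transformation h" "h (f (0, 1)) = v /\<^sub>R norm v"
    using orthogonal_transformation_exists_1 by blast
  have bij: "bij h" using h(1) by (rule orthogonal_transformation_bij)
  have hi: "inv h (h x) = x" "h (inv h x) = x" for x
    using bij by (simp_all add: bij_is_inj inv_f_f bij_is_surj surj_f_inv_f)
  have "adapted_coordinates (h \<circ> f) (g \<circ> inv h)"
  proof (rule adapted_coordinates.intro)
    show "linear (h \<circ> f)" using fg(1) h(1) by (intro linear_compose) (auto simp: orthogonal_transformation_def)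
    show "linear (g \<circ> inv h)"
      using fg(2) orthogonal_transformation_inv[OF h(1)]
      by (intro linear_compose) (auto simp: orthogonal_transformation_def)
    show "(g \<circ> inv h) ((h \<circ> f) x) = x" for x by (simp add: hi fg(5))
    show "(h \<circ> f) ((g \<circ> inv h) y) = y" for y by (simp add: hi fg(6))
    show "(h \<circ> f) x \<bullet> (h \<circ> f) y = x \<bullet> y" for x y
    proof -
      have "(h \<circ> f) x \<bullet> (h \<circ> f) y = f x \<bullet> f y" using h(1) by (simp add: orthogonal_transformation_def)
      also have "\<dots> = ((norm (f (x + y)))\<^sup>2 - (norm (f x))\<^sup>2 - (norm (f y))\<^sup>2) / 2"
        by (simp add: linear_add[OF fg(1)] dot_norm)
      also have "\<dots> = x \<bullet> y" by (simp add: fg(3) dot_norm)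
      finally show ?thesis .
    qed
  qed
  moreover have "snd ((g \<circ> inv h) v) > 0"
  proof -
    have "v = norm v *\<^sub>R h (f (0, 1))" using assms by (simp add: h(2))
    also have "\<dots> = h (f (norm v *\<^sub>R (0, 1)))"
      by (simp only: linear_cmul[OF fg(1)] linear_cmul[OF orthogonal_transformation_linear[OF h(1)]])
    finally have v: "v = h (f (norm v *\<^sub>R (0, 1)))" .
    have "(g \<circ> inv h) v = norm v *\<^sub>R (0, 1)" by (subst v) (simp add: hi fg(5))
    then show ?thesis using assms by simp
  qed
  ultimately show ?thesis by blast
qed

lemma hyp_set_fst_nonzero: "z \<in> hyp_set \<Longrightarrow> fst z \<noteq> 0"
  by (auto simp: hyp_set_def)

lemma pseudohyperbolic_simps:
  "mtop pseudohyperbolic = top_of_set hyp_set" "charts pseudohyperbolic = submanifold_charts hyp_set"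
  "pr_metric pseudohyperbolic k z u w = ghat (push k (\<lambda>x. x) z u) (push k (\<lambda>x. x) z w)"
  by (simp_all add: pseudohyperbolic_def pr_submanifold_def)

text \<open>Maximality quantifies over all charts of the target around a point; this shows that the
  quantifier is not vacuous.\<close>

lemma pseudohyperbolic_charts_nonempty: "z \<in> hyp_set \<Longrightarrow> charts_at pseudohyperbolic z \<noteq> {}"
proof -
  assume z: "z \<in> hyp_set"
  obtain L L' where L: "adapted_coordinates L L'" "snd (L' (fst z)) > 0"
    using adapted_coordinates_exist[OF hyp_set_fst_nonzero[OF z]] by blast
  interpret adapted_coordinates L L' by (rule L)
  have "hyp_chart \<in> charts_at pseudohyperbolic z"
    using hyp_chart_in z L(2) by (simp add: charts_at_def pseudohyperbolic_simps hyp_chart_def Dom_def)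
  then show ?thesis by blast
qed

lemma flat_target_pseudohyperbolic: "flat_target pseudohyperbolic (\<lambda>z. z) ghat"
proof (rule flat_target.intro)
  show "charts_at pseudohyperbolic q \<noteq> {}" if "q \<in> topspace (mtop pseudohyperbolic)" for q
    using that pseudohyperbolic_charts_nonempty by (simp add: pseudohyperbolic_simps)
  fix k assume "k \<in> charts pseudohyperbolic"
  then have k: "k \<in> submanifold_charts hyp_set" by (simp add: pseudohyperbolic_simps)
  show "regular_chart k" "openin (mtop pseudohyperbolic) (fst k)"
    using submanifold_chartD[OF k] by (simp_all add: pseudohyperbolic_simps)
  show "continuous_map (subtopology (mtop pseudohyperbolic) (fst k)) euclidean (snd k)"
    using submanifold_chartD(2,4)[OF k] by (simp add: pseudohyperbolic_simps subtopology_subtopology Int_absorb1)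
  show "smooth_on (snd k ` fst k) (\<lambda>y. chart_inv k y)" using submanifold_chartD(5)[OF k] by simp
  show "inj (fd (\<lambda>y. chart_inv k y) y)" if "y \<in> snd k ` fst k" for y
    using submanifold_chartD(6)[OF k that] by simp
  show m: "pr_metric pseudohyperbolic k q u w = ghat (fd (\<lambda>y. chart_inv k y) (snd k q) u) (fd (\<lambda>y. chart_inv k y) (snd k q) w)"
    for q u w by (simp add: pseudohyperbolic_simps push_fd)
  show "nondegenerate_form (pr_metric pseudohyperbolic k q)" if q: "q \<in> fst k" for q
    unfolding nondegenerate_form_def m
  proof (intro allI impI)
    let ?D = "fd (\<lambda>y. chart_inv k y) (snd k q)"
    have R: "range ?D = {X. ghat X q = 0}" by (rule tangent_pseudohyperbolic[OF k q])
    fix u assume u: "\<forall>w. ghat (?D u) (?D w) = 0"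
    have "?D u = 0"
    proof (rule ghat_nondegenerate[of q])
      show "q \<in> hyp_set" using submanifold_chartD(2)[OF k] q by blast
      show "ghat (?D u) q = 0" using R by blast
      fix Y assume "ghat Y q = 0"
      then obtain w where "Y = ?D w" using R by blast
      then show "ghat (?D u) Y = 0" using u by blast
    qed
    moreover have "inj ?D" "linear ?D"
      using submanifold_chartD(6)[OF k] smooth_on_linear_fd[OF submanifold_chartD(5)[OF k]] q by auto
    ultimately show "u = 0" using linear_0 by (metis injD)
  qed
qed (fact bounded_bilinear_ghat ghat_sym)+

section \<open>Para-complex hyperbolic space\<close>

text \<open>The orbit of \<open>(v, \<alpha>)\<close> is determined by the tensor of \<open>v\<close> and \<open>\<alpha>\<close>. This embeds the quotient
  isometrically into the space of matrices with a multiple of the trace form.\<close>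

definition tens :: "'n rvec \<Rightarrow> 'n rvec \<Rightarrow> real^('n::finite option)^('n option)" where
  "tens v \<alpha> = (\<chi> i j. v $ i * \<alpha> $ j)"

definition tensz :: "'n rvec \<times> 'n rvec \<Rightarrow> real^('n::finite option)^('n option)" where
  "tensz z = tens (fst z) (snd z)"

definition orbit_tens :: "('n rvec \<times> 'n rvec) set \<Rightarrow> real^('n::finite option)^('n option)" where
  "orbit_tens P = tensz (SOME z. z \<in> P)"

text \<open>The 1/2 is the one of \<open>ghat\<close>; the sign is that of \<alpha>(v) = -1, which
  appears when the derivatives of v \<otimes> \<alpha> in horizontal directions are paired.\<close>

definition trace_form :: "real^('n::finite option)^('n option) \<Rightarrow> real^('n option)^('n option) \<Rightarrow> real" where
  "trace_form X Y = - (\<Sum>i\<in>UNIV. \<Sum>j\<in>UNIV. X $ i $ j * Y $ j $ i) / 2"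

lemma bounded_bilinear_trace_form: "bounded_bilinear trace_form"
  unfolding bilinear_conv_bounded_bilinear[symmetric] bilinear_def
  by (auto intro!: linearI simp: trace_form_def field_simps sum.distrib sum_distrib_left)

lemma trace_form_sym: "trace_form X Y = trace_form Y X"
  unfolding trace_form_def by (subst sum.swap) (simp add: mult.commute)

lemma bounded_bilinear_tens: "bounded_bilinear tens"
  unfolding bilinear_conv_bounded_bilinear[symmetric] bilinear_def
  by (auto intro!: linearI simp: tens_def vec_eq_iff algebra_simps)

interpretation tens: bounded_bilinear tens by (rule bounded_bilinear_tens)

interpretation trf: bounded_bilinear trace_form by (rule bounded_bilinear_trace_form)

lemma trace_form_tens: "trace_form (tens a b) (tens c d) = - (b \<bullet> c) * (a \<bullet> d) / 2"
proof -
  have "(\<Sum>i\<in>UNIV. \<Sum>j\<in>UNIV. tens a b $ i $ j * tens c d $ j $ i) = (a \<bullet> d) * (b \<bullet> c)"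
    unfolding inner_vec_def sum_product by (intro sum.cong refl) (simp add: tens_def)
  then show ?thesis by (simp add: trace_form_def)
qed

definition dtens :: "'n::finite rvec \<times> 'n rvec \<Rightarrow> 'n rvec \<times> 'n rvec \<Rightarrow> real^('n option)^('n option)" where
  "dtens z h = tens (fst h) (snd z) + tens (fst z) (snd h)"

lemma has_derivative_tensz: "(tensz has_derivative dtens z) (at z)"
proof -
  have "((\<lambda>z. tens (fst z) (snd z)) has_derivative (\<lambda>h. tens (fst z) (snd h) + tens (fst h) (snd z))) (at z)"
    by (intro tens.FDERIV has_derivative_fst has_derivative_snd has_derivative_ident)
  moreover have "dtens z = (\<lambda>h. tens (fst z) (snd h) + tens (fst h) (snd z))"
    by (simp add: fun_eq_iff dtens_def add.commute)
  ultimately show ?thesis unfolding tensz_def[abs_def] by simp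
qed

lemma smooth_tensz: "open U \<Longrightarrow> smooth_on U F \<Longrightarrow> smooth_on U (\<lambda>x. tensz (F x))"
  unfolding tensz_def
  by (intro smooth_on_bilinear[OF bounded_bilinear_tens] smooth_on_fst smooth_on_snd)

lemma linear_dtens: "linear (dtens z)"
  using has_derivative_linear[OF has_derivative_tensz] .

lemma horizontal_iff: "h \<in> horizontal z \<longleftrightarrow> snd z \<bullet> fst h = 0 \<and> snd h \<bullet> fst z = 0"
  by (cases h) (simp add: horizontal_def)

lemma trace_form_dtens:
  assumes z: "z \<in> hyp_set" and h: "h \<in> horizontal z" "h' \<in> horizontal z"
  shows "trace_form (dtens z h) (dtens z h') = ghat h h'"
proof -
  have "snd z \<bullet> fst z = - 1" using z by (auto simp: hyp_set_def)
  then show ?thesis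
    using h unfolding horizontal_iff dtens_def ghat_def
    by (simp add: trf.add_left trf.add_right trace_form_tens inner_commute)
qed

text \<open>Contraction with the vector on one side and with the covector on the other: each time
  horizontality removes one term and \<alpha>(v) = -1 isolates the other.\<close>

lemma dtens_horizontal_zero:
  assumes z: "z \<in> hyp_set" and h: "h \<in> horizontal z" and 0: "dtens z h = 0"
  shows "h = 0"
proof -
  have zz: "snd z \<bullet> fst z = - 1" using z by (auto simp: hyp_set_def)
  have e: "fst h $ i * snd z $ j + fst z $ i * snd h $ j = 0" for i j
    using 0 by (simp add: dtens_def tens_def vec_eq_iff)
  have "fst h $ i = 0" for i
  proof -
    have "0 = (\<Sum>j\<in>UNIV. (fst h $ i * snd z $ j + fst z $ i * snd h $ j) * fst z $ j)" by (simp add: e)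
    also have "\<dots> = fst h $ i * (snd z \<bullet> fst z) + fst z $ i * (snd h \<bullet> fst z)"
      by (simp add: inner_vec_def sum_distrib_left sum.distrib algebra_simps)
    finally show ?thesis using zz h by (simp add: horizontal_iff)
  qed
  moreover have "snd h $ j = 0" for j
  proof -
    have "0 = (\<Sum>i\<in>UNIV. snd z $ i * (fst h $ i * snd z $ j + fst z $ i * snd h $ j))" by (simp add: e)
    also have "\<dots> = (snd z \<bullet> fst h) * snd z $ j + (snd z \<bullet> fst z) * snd h $ j"
      unfolding inner_vec_def sum_distrib_right sum.distrib[symmetric]
      by (intro sum.cong refl) (simp add: algebra_simps)
    finally show ?thesis using zz h by (simp add: horizontal_iff)
  qed
  ultimately show ?thesis by (simp add: prod_eq_iff vec_eq_iff)
qed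

text \<open>The velocity of the orbit: the derivative of \<open>act t z\<close> at t = 0.\<close>

definition vertical :: "'n::finite rvec \<times> 'n rvec \<Rightarrow> 'n rvec \<times> 'n rvec" where
  "vertical z = (fst z, - snd z)"

lemma dtens_vertical: "dtens z (vertical z) = 0"
  by (simp add: dtens_def vertical_def tens.minus_right)

lemma horizontal_ghat: "h \<in> horizontal z \<Longrightarrow> ghat h z = 0" "h \<in> horizontal z \<Longrightarrow> ghat h (vertical z) = 0"
  by (simp_all add: horizontal_iff ghat_def vertical_def inner_commute)

text \<open>The covector component of \<open>vertical z\<close> has the value 1 on
  \<open>fst z\<close>, which determines the coefficient; tangency makes the same coefficient
  correct the vector component.\<close>

lemma tangent_decomposition:
  assumes z: "z \<in> hyp_set" and X: "ghat X z = 0"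
  shows "X - (snd X \<bullet> fst z) *\<^sub>R vertical z \<in> horizontal z"
proof -
  have "snd z \<bullet> fst z = - 1" using z by (auto simp: hyp_set_def)
  moreover have "snd z \<bullet> fst X = - (snd X \<bullet> fst z)" using X by (simp add: ghat_def)
  ultimately show ?thesis by (simp add: horizontal_iff vertical_def inner_diff_right inner_diff_left inner_add_left)
qed

lemma act_act: "act s (act t z) = act (s + t) z"
  by (simp add: act_def mult_exp_exp)

lemma act_0: "act 0 z = z"
  by (simp add: act_def)

lemma pi_minus_act: "pi_minus (act t z) = pi_minus z"
proof -
  have "act s z \<in> range (\<lambda>s. act (s + t) z)" for s by (rule range_eqI[of _ _ "s - t"]) simp
  then show ?thesis unfolding pi_minus_def act_act by blast
qed

lemma pi_minus_self: "z \<in> pi_minus z"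
  unfolding pi_minus_def using act_0 by (metis rangeI)

lemma pi_minus_eq: "z' \<in> pi_minus z \<Longrightarrow> pi_minus z' = pi_minus z"
proof -
  assume "z' \<in> pi_minus z"
  then obtain t where "z' = act t z" unfolding pi_minus_def by blast
  then show ?thesis by (simp add: pi_minus_act)
qed

lemma act_hyp: "z \<in> hyp_set \<Longrightarrow> act t z \<in> hyp_set"
  by (auto simp: act_def hyp_set_def exp_minus)

text \<open>\<open>orbit_tens\<close> and the quotient charts below are read off from a chosen
  representative; invariance under the action makes the choice immaterial.\<close>

lemma some_orbit:
  assumes "\<And>t. F (act t z) = F z"
  shows "F (SOME z'. z' \<in> pi_minus z) = F z"
proof -
  have "(SOME z'. z' \<in> pi_minus z) \<in> pi_minus z" using pi_minus_self by (rule someI)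
  then show ?thesis using assms by (auto simp: pi_minus_def)
qed

lemma orbit_tens_pi: "orbit_tens (pi_minus z) = tensz z"
  unfolding orbit_tens_def
  by (rule some_orbit) (simp add: tensz_def act_def tens.scaleR_left tens.scaleR_right exp_minus)

lemma para_hyperbolic_simps:
  "mtop para_hyperbolic = quotient_topology (top_of_set hyp_set) pi_minus"
  "charts para_hyperbolic = quotient_charts pseudohyperbolic pi_minus"
  "pr_metric para_hyperbolic = (\<lambda>c P u w. THE r. \<forall>z\<in>P. \<forall>k\<in>charts_at pseudohyperbolic z. \<forall>x y.
        horizontal_lift c k z u x \<and> horizontal_lift c k z w y \<longrightarrow>
          r = pr_metric pseudohyperbolic k z x y)"
  by (simp_all add: para_hyperbolic_def pseudohyperbolic_simps)

lemma continuous_map_pi_minus: "continuous_map (top_of_set hyp_set) (mtop para_hyperbolic) pi_minus"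
  unfolding continuous_map para_hyperbolic_simps topspace_quotient_topology
  by (auto simp: openin_quotient_topology)

lemma quotient_chartD:
  fixes c :: "(('n::finite rvec \<times> 'n rvec) set, (real^'n) \<times> (real^'n)) chart"
    and k :: "('n rvec \<times> 'n rvec, (real^'n) \<times> (real^'n) \<times> real) chart"
  assumes "c \<in> charts para_hyperbolic"
  shows "regular_chart c" "openin (mtop para_hyperbolic) (fst c)"
    "continuous_map (subtopology (mtop para_hyperbolic) (fst c)) euclidean (snd c)"
    "P \<in> fst c \<Longrightarrow> \<exists>z\<in>hyp_set. P = pi_minus z"
    "k \<in> submanifold_charts hyp_set \<Longrightarrow>
      smooth_on (snd k ` {z \<in> fst k. pi_minus z \<in> fst c}) (\<lambda>x. snd c (pi_minus (chart_inv k x)))"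
    "k \<in> submanifold_charts hyp_set \<Longrightarrow> z \<in> fst k \<Longrightarrow> pi_minus z \<in> fst c \<Longrightarrow>
      surj (fd (\<lambda>x. snd c (pi_minus (chart_inv k x))) (snd k z))"
proof -
  have c: "c \<in> quotient_charts pseudohyperbolic pi_minus" using assms by (simp add: para_hyperbolic_simps)
  have op: "openin (mtop para_hyperbolic) (fst c)" and opi: "open (snd c ` fst c)"
    and hom: "homeomorphic_map (subtopology (mtop para_hyperbolic) (fst c)) (top_of_set (snd c ` fst c)) (snd c)"
    and sm: "\<forall>k :: ('n rvec \<times> 'n rvec, (real^'n) \<times> (real^'n) \<times> real) chart\<in>submanifold_charts hyp_set.
      smooth_on (snd k ` {z \<in> fst k. pi_minus z \<in> fst c}) (snd c \<circ> pi_minus \<circ> chart_inv k) \<and>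
        (\<forall>z\<in>fst k. pi_minus z \<in> fst c \<longrightarrow> surj (push k (snd c \<circ> pi_minus) z))"
    using c unfolding quotient_charts_def para_hyperbolic_simps pseudohyperbolic_simps by simp_all
  have sub: "fst c \<subseteq> topspace (mtop para_hyperbolic)" using op openin_subset by blast
  have top: "topspace (subtopology (mtop para_hyperbolic) (fst c)) = fst c"
    using sub by (simp add: Int_absorb1)
  show "regular_chart c"
    using homeomorphic_imp_injective_map[OF hom] opi unfolding regular_chart_def top by simp
  show "openin (mtop para_hyperbolic) (fst c)" by (rule op)
  show "continuous_map (subtopology (mtop para_hyperbolic) (fst c)) euclidean (snd c)"
    using homeomorphic_imp_continuous_map[OF hom] continuous_map_into_fulltopology by blast
  show "\<exists>z\<in>hyp_set. P = pi_minus z" if "P \<in> fst c"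
    using sub that by (auto simp: para_hyperbolic_simps topspace_quotient_topology)
  show "smooth_on (snd k ` {z \<in> fst k. pi_minus z \<in> fst c}) (\<lambda>x. snd c (pi_minus (chart_inv k x)))"
    if "k \<in> submanifold_charts hyp_set" using sm that by (simp add: o_def)
  show "surj (fd (\<lambda>x. snd c (pi_minus (chart_inv k x))) (snd k z))"
    if "k \<in> submanifold_charts hyp_set" "z \<in> fst k" "pi_minus z \<in> fst c"
    using sm that by (simp add: o_def push_fd)
qed

text \<open>\<open>g\<close> is the quotient map in coordinates, a submersion, and
  \<open>\<psi>\<close> is the tensor embedding of the quotient in the chart \<open>c\<close>. The
  relation \<open>\<psi>_g\<close> transfers facts about \<open>tensz\<close> from pseudohyperbolic
  space to \<open>\<psi>\<close>.\<close>

locale quotient_point =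
  fixes c :: "(('n::finite rvec \<times> 'n rvec) set, (real^'n) \<times> (real^'n)) chart"
    and k :: "('n rvec \<times> 'n rvec, (real^'n) \<times> (real^'n) \<times> real) chart" and z :: "'n rvec \<times> 'n rvec"
  assumes c: "c \<in> charts para_hyperbolic" and k: "k \<in> submanifold_charts hyp_set"
    and zk: "z \<in> fst k" and zc: "pi_minus z \<in> fst c"
begin

definition T where "T = snd k ` {z \<in> fst k. pi_minus z \<in> fst c}"
definition g where "g x = snd c (pi_minus (chart_inv k x))"
definition \<psi> where "\<psi> y = orbit_tens (chart_inv c y)"
abbreviation D where "D \<equiv> fd (chart_inv k) (snd k z)"
abbreviation gD where "gD \<equiv> fd g (snd k z)"
abbreviation \<psi>D where "\<psi>D \<equiv> fd \<psi> (snd c (pi_minus z))"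

lemma z_hyp: "z \<in> hyp_set" using submanifold_chartD(2)[OF k] zk by blast

lemma regular: "regular_chart k" "regular_chart c"
  using submanifold_chartD(1)[OF k] quotient_chartD(1)[OF c] by blast+

lemma T_sub: "T \<subseteq> snd k ` fst k" by (auto simp: T_def)

lemma T_in: "x \<in> T \<Longrightarrow> chart_inv k x \<in> fst k" "x \<in> T \<Longrightarrow> pi_minus (chart_inv k x) \<in> fst c"
  using chart_inv_left[OF regular(1)] by (auto simp: T_def)

lemma zT: "snd k z \<in> T" using zk zc by (auto simp: T_def)

lemma kz: "chart_inv k (snd k z) = z" by (rule chart_inv_left[OF regular(1) zk])

lemma gz: "g (snd k z) = snd c (pi_minus z)" by (simp add: g_def kz)

lemma open_T: "open T"
proof -
  have hom: "homeomorphic_map (subtopology (top_of_set hyp_set) (fst k)) (top_of_set (snd k ` fst k)) (snd k)"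
    using k submanifold_chartD(2)[OF k]
    by (simp add: submanifold_charts_def subtopology_subtopology Int_absorb1)
  have "openin (top_of_set hyp_set) {z \<in> topspace (top_of_set hyp_set). pi_minus z \<in> fst c}"
    by (rule openin_continuous_map_preimage[OF continuous_map_pi_minus quotient_chartD(2)[OF c]])
  then have "openin (top_of_set hyp_set) ({z \<in> topspace (top_of_set hyp_set). pi_minus z \<in> fst c} \<inter> fst k)"
    using submanifold_chartD(3)[OF k] by (rule openin_Int)
  moreover have "{z \<in> topspace (top_of_set hyp_set). pi_minus z \<in> fst c} \<inter> fst k = {z \<in> fst k. pi_minus z \<in> fst c}"
    using submanifold_chartD(2)[OF k] by auto
  ultimately show ?thesis unfolding T_def
    by (intro open_chart_image[OF hom regular_chart_open[OF regular(1)]]) auto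
qed

lemma smooth_g: "smooth_on T g"
  using quotient_chartD(5)[OF c k] unfolding T_def g_def[abs_def] .

lemma surj_gD: "surj gD"
  using quotient_chartD(6)[OF c k zk zc] unfolding g_def[abs_def] .

lemma smooth_inv: "smooth_on T (chart_inv k)"
  using smooth_on_subset[OF submanifold_chartD(5)[OF k] T_sub] .

lemma \<psi>_g: "x \<in> T \<Longrightarrow> \<psi> (g x) = tensz (chart_inv k x)"
  by (simp add: \<psi>_def g_def chart_inv_left[OF regular(2)] T_in orbit_tens_pi)

text \<open>A local section \<open>s\<close> of the submersion \<open>g\<close> lifts the
  coordinates of the quotient; near the point, \<open>\<psi>\<close> is \<open>tensz\<close> after
  this lift.\<close>

lemma smooth_\<psi>: "\<exists>V. open V \<and> snd c (pi_minus z) \<in> V \<and> smooth_on V \<psi>"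
proof -
  obtain V s where V: "open V" "g (snd k z) \<in> V" "smooth_on V s" "s ` V \<subseteq> T" "\<forall>y\<in>V. g (s y) = y"
    using submersion_local_section[OF open_T zT smooth_g surj_gD] by blast
  have "smooth_on V (\<lambda>y. chart_inv k (s y))"
    by (rule smooth_on_compose[OF V(1,4,3) smooth_inv])
  then have sm: "smooth_on V (\<lambda>y. tensz (chart_inv k (s y)))" by (rule smooth_tensz[OF V(1)])
  have "smooth_on V \<psi>"
  proof (rule smooth_on_cong[OF V(1) _ sm])
    fix y assume y: "y \<in> V"
    then have "s y \<in> T" "g (s y) = y" using V(4,5) by blast+
    then show "tensz (chart_inv k (s y)) = \<psi> y" using \<psi>_g[of "s y"] by simp
  qed
  then show ?thesis using V(1,2) gz by auto
qed

lemma lin_D: "linear D" "inj D" and lin_gD: "linear gD" and lin_\<psi>D: "linear \<psi>D"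
proof -
  show "linear D" by (rule smooth_on_linear_fd[OF smooth_inv zT])
  show "inj D" using submanifold_chartD(6)[OF k] zk by blast
  show "linear gD" by (rule smooth_on_linear_fd[OF smooth_g zT])
  show "linear \<psi>D" using smooth_\<psi> smooth_on_linear_fd by blast
qed

lemma range_D: "range D = {X. ghat X z = 0}"
  by (rule tangent_pseudohyperbolic[OF k zk])

lemma \<psi>D_gD: "\<psi>D (gD x) = dtens z (D x)"
proof -
  have d\<psi>: "\<psi> differentiable (at (g (snd k z)))"
    using smooth_\<psi> smooth_on_differentiable unfolding gz by blast
  have "fd (\<lambda>x. \<psi> (g x)) (snd k z) = fd (\<lambda>x. tensz (chart_inv k x)) (snd k z)"
    by (rule fd_cong[OF open_T zT \<psi>_g])
  moreover have "fd (\<lambda>x. \<psi> (g x)) (snd k z) x = \<psi>D (gD x)"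
    using fd_compose[OF smooth_on_differentiable[OF smooth_g zT] d\<psi>] by (simp add: gz)
  moreover have "fd (\<lambda>x. tensz (chart_inv k x)) (snd k z) x = dtens z (D x)"
    using fd_compose[OF smooth_on_differentiable[OF smooth_inv zT], of tensz x] has_derivative_tensz[of z] fd_eq[OF has_derivative_tensz[of z]]
    by (auto simp: kz differentiable_def)
  ultimately show ?thesis by simp
qed

text \<open>The kernel of \<open>gD\<close> is not zero because the dimension drops. By
  \<open>\<psi>D_gD\<close> its image under \<open>D\<close> is annihilated by
  \<open>dtens z\<close>, which is injective on horizontal vectors, so this image is
  vertical.\<close>

lemma vertical_kernel: "\<exists>x. D x = vertical z \<and> gD x = 0"
proof -
  have "\<not> inj gD"
  proof
    assume i: "inj gD"
    have "dim (range gD) = dim (UNIV :: ((real^'n) \<times> (real^'n) \<times> real) set)"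
      by (rule dim_image_eq[OF lin_gD]) (use i in \<open>simp add: inj_on_subset\<close>)
    moreover have "dim (range gD) \<le> DIM((real^'n) \<times> (real^'n))" by (rule dim_subset_UNIV)
    ultimately show False by simp
  qed
  then obtain x where x: "gD x = 0" "x \<noteq> 0" using linear_injective_0[OF lin_gD] by blast
  have "ghat (D x) z = 0" using range_D by blast
  define a where "a = snd (D x) \<bullet> fst z"
  have h: "D x - a *\<^sub>R vertical z \<in> horizontal z"
    unfolding a_def by (rule tangent_decomposition[OF z_hyp \<open>ghat (D x) z = 0\<close>])
  have "dtens z (D x - a *\<^sub>R vertical z) = 0"
    using \<psi>D_gD[of x] x(1) linear_0[OF lin_\<psi>D]
    by (simp add: linear_diff[OF linear_dtens] linear_cmul[OF linear_dtens] dtens_vertical)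
  from dtens_horizontal_zero[OF z_hyp h this] have Dx: "D x = a *\<^sub>R vertical z" by simp
  have "D x \<noteq> 0" using x(2) lin_D linear_0[OF lin_D(1)] by (metis injD)
  then have "a \<noteq> 0" using Dx by auto
  then have "D (x /\<^sub>R a) = vertical z \<and> gD (x /\<^sub>R a) = 0"
    using Dx x(1) by (simp add: linear_cmul[OF lin_D(1)] linear_cmul[OF lin_gD])
  then show ?thesis by blast
qed

text \<open>Any preimage under \<open>gD\<close> is made horizontal by subtracting a multiple of the
  kernel vector just found, which does not change its image.\<close>

lemma horizontal_lift_exists: "\<exists>x. D x \<in> horizontal z \<and> gD x = u"
proof -
  obtain x where x: "u = gD x" using surj_gD by (rule surjE)
  obtain x1 where x1: "D x1 = vertical z" "gD x1 = 0" using vertical_kernel by blast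
  define a where "a = snd (D x) \<bullet> fst z"
  have "ghat (D x) z = 0" using range_D by blast
  then have "D x - a *\<^sub>R vertical z \<in> horizontal z"
    unfolding a_def by (rule tangent_decomposition[OF z_hyp])
  then have "D (x - a *\<^sub>R x1) \<in> horizontal z \<and> gD (x - a *\<^sub>R x1) = u"
    using x x1 by (simp add: linear_diff[OF lin_D(1)] linear_cmul[OF lin_D(1)] linear_diff[OF lin_gD] linear_cmul[OF lin_gD])
  then show ?thesis by blast
qed

lemma inj_\<psi>D: "inj \<psi>D"
proof (subst linear_injective_0[OF lin_\<psi>D], intro allI impI)
  fix u assume u: "\<psi>D u = 0"
  obtain x where x: "D x \<in> horizontal z" "gD x = u" using horizontal_lift_exists by blast
  then have "dtens z (D x) = 0" using \<psi>D_gD[of x] u by simp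
  then have "D x = 0" by (rule dtens_horizontal_zero[OF z_hyp x(1)])
  then have "x = 0" using lin_D linear_0[OF lin_D(1)] by (metis injD)
  then show "u = 0" using x(2) linear_0[OF lin_gD] by simp
qed

lemma range_\<psi>D: "range \<psi>D = dtens z ` horizontal z"
proof
  show "range \<psi>D \<subseteq> dtens z ` horizontal z"
  proof
    fix X assume "X \<in> range \<psi>D"
    then obtain u where u: "X = \<psi>D u" by blast
    obtain x where x: "D x \<in> horizontal z" "gD x = u" using horizontal_lift_exists by blast
    then show "X \<in> dtens z ` horizontal z" using \<psi>D_gD[of x] u by auto
  qed
  show "dtens z ` horizontal z \<subseteq> range \<psi>D"
  proof
    fix X assume "X \<in> dtens z ` horizontal z"
    then obtain h where h: "h \<in> horizontal z" "X = dtens z h" by blast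
    then obtain x where "h = D x" using range_D horizontal_ghat(1) by blast
    then show "X \<in> range \<psi>D" using \<psi>D_gD[of x] h(2) by (metis rangeI)
  qed
qed

lemma horizontal_lift_iff: "horizontal_lift c k z u x \<longleftrightarrow> D x \<in> horizontal z \<and> gD x = u"
  by (simp add: horizontal_lift_def push_fd g_def[abs_def])

text \<open>The right-hand side mentions neither \<open>k\<close> nor the lifts, and
  \<open>z\<close> only through its orbit. Hence the description that defines the quotient metric
  has a value.\<close>

lemma metric_lift:
  assumes "horizontal_lift c k z u x" "horizontal_lift c k z w y"
  shows "pr_metric pseudohyperbolic k z x y = trace_form (\<psi>D u) (\<psi>D w)"
  using assms trace_form_dtens[OF z_hyp, of "D x" "D y"] \<psi>D_gD[of x] \<psi>D_gD[of y]
  unfolding horizontal_lift_iff by (simp add: pseudohyperbolic_simps push_fd)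

lemma \<psi>D_nondegenerate:
  assumes "\<forall>w. trace_form (\<psi>D u) (\<psi>D w) = 0"
  shows "u = 0"
proof -
  obtain x where x: "D x \<in> horizontal z" "gD x = u" using horizontal_lift_exists by blast
  have 0: "ghat (D x) h = 0" if h: "h \<in> horizontal z" for h
  proof -
    obtain y where y: "h = D y" using range_D horizontal_ghat(1)[OF h] by blast
    have "ghat (D x) h = trace_form (\<psi>D (gD x)) (\<psi>D (gD y))"
      unfolding \<psi>D_gD y[symmetric] by (rule trace_form_dtens[OF z_hyp x(1) h, symmetric])
    then show ?thesis using assms x(2) by simp
  qed
  have "D x = 0"
  proof (rule ghat_nondegenerate[OF z_hyp horizontal_ghat(1)[OF x(1)]])
    fix Y assume Y: "ghat Y z = 0"
    interpret gh: bounded_bilinear ghat by (rule bounded_bilinear_ghat)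
    define a where "a = snd Y \<bullet> fst z"
    have "ghat (D x) (Y - a *\<^sub>R vertical z) = 0"
      unfolding a_def by (rule 0[OF tangent_decomposition[OF z_hyp Y]])
    then show "ghat (D x) Y = 0"
      using horizontal_ghat(2)[OF x(1)] by (simp add: gh.diff_right gh.scaleR_right)
  qed
  then have "x = 0" using lin_D linear_0[OF lin_D(1)] by (metis injD)
  then show "u = 0" using x(2) linear_0[OF lin_gD] by simp
qed

end

lemma quotient_point_exists:
  fixes z :: "'n::finite rvec \<times> 'n rvec"
  assumes c: "c \<in> charts para_hyperbolic" and P: "pi_minus z \<in> fst c" and z: "z \<in> hyp_set"
  shows "\<exists>k. quotient_point c k z"
proof -
  obtain k :: "('n rvec \<times> 'n rvec, (real^'n) \<times> (real^'n) \<times> real) chart"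
    where "k \<in> submanifold_charts hyp_set" "z \<in> fst k"
    using pseudohyperbolic_charts_nonempty[OF z] unfolding charts_at_def pseudohyperbolic_simps by blast
  then show ?thesis using c P by (intro exI[of _ k] quotient_point.intro)
qed

lemma para_hyperbolic_metric:
  assumes c: "c \<in> charts para_hyperbolic" and P: "P \<in> fst c"
  shows "pr_metric para_hyperbolic c P u w =
    trace_form (fd (\<lambda>y. orbit_tens (chart_inv c y)) (snd c P) u) (fd (\<lambda>y. orbit_tens (chart_inv c y)) (snd c P) w)"
proof -
  let ?\<psi> = "fd (\<lambda>y. orbit_tens (chart_inv c y)) (snd c P)"
  let ?R = "\<lambda>r. \<forall>z\<in>P. \<forall>k\<in>charts_at pseudohyperbolic z. \<forall>x y.
        horizontal_lift c k z u x \<and> horizontal_lift c k z w y \<longrightarrow> r = pr_metric pseudohyperbolic k z x y"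
  obtain z where z: "z \<in> hyp_set" "P = pi_minus z" using quotient_chartD(4)[OF c P] by blast
  have q: "quotient_point c k z'" if "z' \<in> P" "k \<in> charts_at pseudohyperbolic z'" for z' k
    using that c P pi_minus_eq[of z' z] z(2)
    by (auto intro!: quotient_point.intro simp: charts_at_def pseudohyperbolic_simps)
  have \<psi>: "?\<psi> = fd (quotient_point.\<psi> c) (snd c (pi_minus z'))" if "z' \<in> P" "k \<in> charts_at pseudohyperbolic z'" for z' k
    using quotient_point.\<psi>_def[OF q[OF that], abs_def] pi_minus_eq[of z' z] that(1) z(2) by simp
  have m: "pr_metric pseudohyperbolic k z' x y = trace_form (?\<psi> u) (?\<psi> w)"
    if "z' \<in> P" "k \<in> charts_at pseudohyperbolic z'" "horizontal_lift c k z' u x" "horizontal_lift c k z' w y" for z' k x y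
    using quotient_point.metric_lift[OF q[OF that(1,2)] that(3,4)] unfolding \<psi>[OF that(1,2)] .
  have "(THE r. ?R r) = trace_form (?\<psi> u) (?\<psi> w)"
  proof (rule the_equality)
    show "?R (trace_form (?\<psi> u) (?\<psi> w))" using m by simp
    fix r assume r: "?R r"
    \<comment> \<open>Uniqueness requires an actual point of the orbit, a chart and two lifts:
      without them every number would satisfy \<open>?R\<close>.\<close>
    have zP: "z \<in> P" unfolding z(2) by (rule pi_minus_self)
    obtain k where kz': "k \<in> charts_at pseudohyperbolic z" using pseudohyperbolic_charts_nonempty[OF z(1)] by blast
    interpret quotient_point c k z by (rule q[OF zP kz'])
    obtain x where x: "horizontal_lift c k z u x" using horizontal_lift_exists horizontal_lift_iff by blast
    obtain y where y: "horizontal_lift c k z w y" using horizontal_lift_exists horizontal_lift_iff by blast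
    have "r = pr_metric pseudohyperbolic k z x y" using r zP kz' x y by blast
    then show "r = trace_form (?\<psi> u) (?\<psi> w)" using m[OF zP kz' x y] by simp
  qed
  then show ?thesis unfolding para_hyperbolic_simps .
qed

section \<open>Charts of the quotient\<close>

context adapted_coordinates
begin

text \<open>Inhomogeneous coordinates: the vector is rescaled to have last coordinate 1 and the
  covector inversely, so that the action cancels.\<close>

definition qcoord :: "'n rvec \<times> 'n rvec \<Rightarrow> (real^'n) \<times> (real^'n)" where
  "qcoord z = (inverse (snd (L' (fst z))) *\<^sub>R fst (L' (fst z)), snd (L' (fst z)) *\<^sub>R fst (L' (snd z)))"

text \<open>The slice of points whose vector has last coordinate \<open>t\<close>; the entry -1 -
  ... is forced by the equation of the space. \<open>t\<close> = 1 gives a section over the chart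
  domain, and general \<open>t\<close> lets the slice pass through a prescribed point of
  \<open>Dom\<close>.\<close>

definition qsection :: "real \<Rightarrow> (real^'n) \<times> (real^'n) \<Rightarrow> 'n rvec \<times> 'n rvec" where
  "qsection t y = (t *\<^sub>R L (fst y, 1), inverse t *\<^sub>R L (snd y, - 1 - fst y \<bullet> snd y))"

definition quotient_chart where "quotient_chart = (pi_minus ` Dom, \<lambda>P. qcoord (SOME z. z \<in> P))"

lemma L_scaleR: "L (r *\<^sub>R x) = r *\<^sub>R L x" "L' (r *\<^sub>R y) = r *\<^sub>R L' y"
  using lin_L lin_L' by (simp_all add: linear_cmul)

lemma act_Dom: "z \<in> Dom \<Longrightarrow> act t z \<in> Dom"
  by (simp add: Dom_def act_hyp) (simp add: act_def L_scaleR)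

lemma qcoord_act: "qcoord (act t z) = qcoord z"
  by (simp add: qcoord_def act_def L_scaleR exp_minus)

lemma quotient_chart_pi: "snd quotient_chart (pi_minus z) = qcoord z"
  unfolding quotient_chart_def by (simp add: some_orbit[where F=qcoord] qcoord_act)

lemma qsection_hyp: "t \<noteq> 0 \<Longrightarrow> qsection t y \<in> hyp_set"
  by (simp add: qsection_def hyp_set_def inner_L inner_prod_def inner_commute)

lemma qsection_Dom: "t > 0 \<Longrightarrow> qsection t y \<in> Dom"
  by (simp add: Dom_def qsection_hyp) (simp add: qsection_def L_scaleR L'L)

lemma qcoord_qsection: "t > 0 \<Longrightarrow> qcoord (qsection t y) = y"
  by (simp add: qcoord_def qsection_def L_scaleR L'L)

lemma qsection_qcoord:
  assumes z: "z \<in> Dom"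
  shows "qsection (snd (L' (fst z))) (qcoord z) = z"
proof -
  let ?t = "snd (L' (fst z))"
  have t: "?t > 0" and h: "z \<in> hyp_set" using z by (auto simp: Dom_def)
  have tt: "?t * (inverse ?t * r) = r" for r using t by (simp add: mult.assoc[symmetric])
  have e: "?t * snd (L' (snd z)) = - 1 - fst (L' (fst z)) \<bullet> fst (L' (snd z))" using hyp_coords[OF h] by simp
  have "fst (qsection ?t (qcoord z)) = L (?t *\<^sub>R (inverse ?t *\<^sub>R fst (L' (fst z)), 1))"
    by (simp only: qsection_def qcoord_def fst_conv snd_conv L_scaleR)
  also have "\<dots> = L (L' (fst z))" using t by (intro arg_cong[of _ _ L]) (simp add: prod_eq_iff)
  finally have 1: "fst (qsection ?t (qcoord z)) = fst z" by (simp add: LL')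
  have "snd (qsection ?t (qcoord z)) =
      L (inverse ?t *\<^sub>R (?t *\<^sub>R fst (L' (snd z)), - 1 - fst (L' (fst z)) \<bullet> fst (L' (snd z))))"
    by (simp only: L_scaleR) (simp add: qsection_def qcoord_def tt)
  also have "\<dots> = L (L' (snd z))" using t unfolding e[symmetric] by (intro arg_cong[of _ _ L]) (simp add: prod_eq_iff)
  finally have 2: "snd (qsection ?t (qcoord z)) = snd z" by (simp add: LL')
  show ?thesis using 1 2 by (simp add: prod_eq_iff)
qed

lemma qsection_act: "t > 0 \<Longrightarrow> qsection t y = act (ln t) (qsection 1 y)"
  by (simp add: qsection_def act_def exp_minus)

lemma pi_qsection:
  assumes z: "z \<in> Dom"
  shows "pi_minus (qsection 1 (qcoord z)) = pi_minus z"
proof -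
  have "snd (L' (fst z)) > 0" using z by (simp add: Dom_def)
  from qsection_act[OF this, of "qcoord z"] have "z = act (ln (snd (L' (fst z)))) (qsection 1 (qcoord z))"
    unfolding qsection_qcoord[OF z] .
  from arg_cong[OF this, of pi_minus] show ?thesis unfolding pi_minus_act by (rule sym)
qed

text \<open>\<open>Dom\<close> is open only relative to \<open>hyp_set\<close>, while derivatives of
  \<open>qcoord\<close> are taken on an open set of the ambient space.\<close>

definition \<Omega> :: "('n rvec \<times> 'n rvec) set" where "\<Omega> = {z. snd (L' (fst z)) > 0}"

lemma bounded_linear_comps: "bounded_linear (\<lambda>z :: 'n rvec \<times> 'n rvec. L' (fst z))" "bounded_linear (\<lambda>z :: 'n rvec \<times> 'n rvec. L' (snd z))"
  by (intro bounded_linear_compose[OF bounded_linear_L(2)] bounded_linear_fst bounded_linear_snd)+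

lemma open_\<Omega>: "open \<Omega>"
  using linear_continuous_on[OF bounded_linear_comps(1), of UNIV]
  unfolding \<Omega>_def by (intro open_Collect_less continuous_intros) auto

lemma Dom_\<Omega>: "Dom = hyp_set \<inter> \<Omega>"
  by (auto simp: Dom_def \<Omega>_def)

lemma smooth_qcoord: "smooth_on \<Omega> qcoord"
proof -
  have a: "smooth_on \<Omega> (\<lambda>z. L' (fst z))" "smooth_on \<Omega> (\<lambda>z. L' (snd z))"
    by (intro smooth_on_bounded_linear[OF bounded_linear_L(2) open_\<Omega>] smooth_on_fst smooth_on_snd open_\<Omega> smooth_on_ident)+
  have t: "smooth_on \<Omega> (\<lambda>z. snd (L' (fst z)))" by (intro smooth_on_snd open_\<Omega> a)
  have i: "smooth_on \<Omega> (\<lambda>z. inverse (snd (L' (fst z))))"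
    by (rule smooth_on_inverse[OF open_\<Omega> _ t]) (simp add: \<Omega>_def)
  show ?thesis unfolding qcoord_def
    by (intro smooth_on_Pair[OF open_\<Omega>] smooth_on_scaleR[OF open_\<Omega>] t i smooth_on_fst[OF open_\<Omega>] a)
qed

lemma smooth_qsection: "smooth_on UNIV (qsection t)"
  unfolding qsection_def
proof (intro smooth_on_Pair[OF open_UNIV] smooth_on_scaleR[OF open_UNIV]
    smooth_on_bounded_linear[OF bounded_linear_L(1) open_UNIV] smooth_on_const)
  note I = smooth_on_ident[OF open_UNIV]
  show a: "smooth_on UNIV fst" by (intro smooth_on_fst open_UNIV I)
  show b: "smooth_on UNIV snd" by (intro smooth_on_snd open_UNIV I)
  have "smooth_on UNIV (\<lambda>y. - 1 + - (fst y \<bullet> snd y))"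
    by (intro smooth_on_add smooth_on_minus smooth_on_inner smooth_on_const open_UNIV a b)
  then show "smooth_on UNIV (\<lambda>y. - 1 - fst y \<bullet> snd y)" by simp
qed

lemma fst_quotient_chart: "fst quotient_chart = pi_minus ` Dom"
  by (simp add: quotient_chart_def)

text \<open>\<open>Dom\<close> is a union of orbits, since the action multiplies the last coordinate
  by a positive number. So its image is open in the quotient topology.\<close>

lemma pi_in_iff: "z \<in> hyp_set \<Longrightarrow> pi_minus z \<in> pi_minus ` Dom \<longleftrightarrow> z \<in> Dom"
proof
  assume "pi_minus z \<in> pi_minus ` Dom"
  then obtain z' where z': "z' \<in> Dom" "pi_minus z = pi_minus z'" by blast
  then have "z \<in> pi_minus z'" using pi_minus_self by metis
  then obtain t where "z = act t z'" unfolding pi_minus_def by blast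
  then show "z \<in> Dom" using act_Dom z'(1) by simp
qed auto

lemma openin_Dom: "openin (top_of_set hyp_set) Dom"
  unfolding Dom_\<Omega> using open_\<Omega> by blast

lemma openin_quotient_dom: "openin (mtop para_hyperbolic) (pi_minus ` Dom)"
proof -
  have "{z \<in> hyp_set. pi_minus z \<in> pi_minus ` Dom} = Dom" using pi_in_iff Dom_\<Omega> by blast
  then show ?thesis using openin_Dom Dom_\<Omega>
    unfolding para_hyperbolic_simps openin_quotient_topology by auto
qed

lemma continuous_qcoord_quotient:
  "continuous_map (subtopology (mtop para_hyperbolic) (pi_minus ` Dom)) euclidean (snd quotient_chart)"
proof -
  have top: "topspace (subtopology (mtop para_hyperbolic) (pi_minus ` Dom)) = pi_minus ` Dom"
    using openin_subset[OF openin_quotient_dom] by (simp add: Int_absorb1)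
  have "openin (mtop para_hyperbolic) {P \<in> pi_minus ` Dom. snd quotient_chart P \<in> O'}" if "open O'" for O'
  proof -
    have e: "{z \<in> hyp_set. pi_minus z \<in> {P \<in> pi_minus ` Dom. snd quotient_chart P \<in> O'}} = hyp_set \<inter> (\<Omega> \<inter> qcoord -` O')"
      using pi_in_iff Dom_\<Omega> by (auto simp: quotient_chart_pi)
    have "open (\<Omega> \<inter> qcoord -` O')"
      using continuous_open_preimage[OF smooth_on_continuous_on[OF smooth_qcoord] open_\<Omega> that] .
    then have "openin (top_of_set hyp_set) (hyp_set \<inter> (\<Omega> \<inter> qcoord -` O'))" by blast
    then show ?thesis
      unfolding para_hyperbolic_simps openin_quotient_topology topspace_euclidean_subtopology e
      using Dom_\<Omega> by auto
  qed
  then show ?thesis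
    unfolding continuous_map_def top
    using openin_quotient_dom by (auto simp: openin_open_subtopology)
qed

lemma qsection_continuous:
  "continuous_map euclidean (subtopology (mtop para_hyperbolic) (pi_minus ` Dom)) (\<lambda>y. pi_minus (qsection 1 y))"
proof -
  have "continuous_map euclidean (top_of_set hyp_set) (qsection 1)"
    using smooth_on_continuous_on[OF smooth_qsection] qsection_hyp by (auto simp: continuous_map_in_subtopology)
  from continuous_map_compose[OF this continuous_map_pi_minus]
  show ?thesis using qsection_Dom by (auto simp: continuous_map_in_subtopology o_def)
qed

lemma image_quotient_chart: "snd quotient_chart ` (pi_minus ` Dom) = UNIV"
proof -
  have "y \<in> snd quotient_chart ` (pi_minus ` Dom)" for y
    by (rule image_eqI[of _ _ "pi_minus (qsection 1 y)"]) (simp_all add: quotient_chart_pi qcoord_qsection qsection_Dom)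
  then show ?thesis by blast
qed

lemma quotient_chart_in: "quotient_chart \<in> charts para_hyperbolic"
  unfolding para_hyperbolic_simps(2) quotient_charts_def
proof (intro CollectI conjI ballI impI)
  show "openin (quotient_topology (mtop pseudohyperbolic) pi_minus) (fst quotient_chart)"
    using openin_quotient_dom by (simp add: fst_quotient_chart para_hyperbolic_simps pseudohyperbolic_simps)
  show "open (snd quotient_chart ` fst quotient_chart)"
    by (simp add: fst_quotient_chart image_quotient_chart)
  have top: "topspace (subtopology (mtop para_hyperbolic) (pi_minus ` Dom)) = pi_minus ` Dom"
    using openin_subset[OF openin_quotient_dom] by (simp add: Int_absorb1)
  have "homeomorphic_maps (subtopology (mtop para_hyperbolic) (pi_minus ` Dom)) euclidean
      (snd quotient_chart) (\<lambda>y. pi_minus (qsection 1 y))"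
    unfolding homeomorphic_maps_def top
    using continuous_qcoord_quotient qsection_continuous
    by (auto simp: quotient_chart_pi qcoord_qsection pi_qsection)
  then have "homeomorphic_map (subtopology (mtop para_hyperbolic) (pi_minus ` Dom)) euclidean (snd quotient_chart)"
    using homeomorphic_map_maps by blast
  then show "homeomorphic_map (subtopology (quotient_topology (mtop pseudohyperbolic) pi_minus) (fst quotient_chart))
     (top_of_set (snd quotient_chart ` fst quotient_chart)) (snd quotient_chart)"
    by (simp add: fst_quotient_chart image_quotient_chart para_hyperbolic_simps pseudohyperbolic_simps)
  fix k :: "('n rvec \<times> 'n rvec, (real^'n) \<times> (real^'n) \<times> real) chart" assume "k \<in> charts pseudohyperbolic"
  then have k: "k \<in> submanifold_charts hyp_set" by (simp add: pseudohyperbolic_simps)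
  note reg = submanifold_chartD(1)[OF k] and sub = submanifold_chartD(2)[OF k]
  define S where "S = snd k ` {z \<in> fst k. pi_minus z \<in> fst quotient_chart}"
  have Sk: "S \<subseteq> snd k ` fst k" by (auto simp: S_def)
  have S_eq: "S = snd k ` fst k \<inter> chart_inv k -` \<Omega>"
  proof -
    have "{z \<in> fst k. pi_minus z \<in> fst quotient_chart} = {z \<in> fst k. z \<in> \<Omega>}"
      using sub pi_in_iff Dom_\<Omega> unfolding fst_quotient_chart by blast
    then show ?thesis unfolding S_def using chart_inv_left[OF reg] by force
  qed
  have S: "open S" unfolding S_eq
    by (rule continuous_open_preimage[OF smooth_on_continuous_on[OF submanifold_chartD(5)[OF k]] regular_chart_open[OF reg] open_\<Omega>])
  have sm: "smooth_on S (\<lambda>x. qcoord (chart_inv k x))"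
  proof (rule smooth_on_compose[OF S _ _ smooth_qcoord])
    show "chart_inv k ` S \<subseteq> \<Omega>" using S_eq by blast
    show "smooth_on S (chart_inv k)" by (rule smooth_on_subset[OF submanifold_chartD(5)[OF k] Sk])
  qed
  have f: "snd quotient_chart \<circ> pi_minus \<circ> chart_inv k = (\<lambda>x. qcoord (chart_inv k x))"
    by (simp add: fun_eq_iff quotient_chart_pi)
  show "smooth_on (snd k ` {z \<in> fst k. pi_minus z \<in> fst quotient_chart}) (snd quotient_chart \<circ> pi_minus \<circ> chart_inv k)"
    unfolding f S_def[symmetric] by (rule sm)
  fix z assume zk: "z \<in> fst k" and "pi_minus z \<in> fst quotient_chart"
  then have zD: "z \<in> Dom" using pi_in_iff sub unfolding fst_quotient_chart by blast
  have kz: "chart_inv k (snd k z) = z" by (rule chart_inv_left[OF reg zk])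
  let ?D = "fd (chart_inv k) (snd k z)"
  have dk: "chart_inv k differentiable (at (snd k z))"
    using smooth_on_differentiable[OF submanifold_chartD(5)[OF k]] zk by blast
  have dq: "qcoord differentiable (at z)"
    using smooth_on_differentiable[OF smooth_qcoord] zD Dom_\<Omega> by blast
  define t where "t = snd (L' (fst z))"
  have t: "t > 0" using zD by (simp add: t_def Dom_def)
  have sz: "qsection t (qcoord z) = z" unfolding t_def by (rule qsection_qcoord[OF zD])
  have ds: "qsection t differentiable (at (qcoord z))" by (rule smooth_on_differentiable[OF smooth_qsection UNIV_I])
  show "surj (push k (snd quotient_chart \<circ> pi_minus) z)"
  \<comment> \<open>The slice through \<open>z\<close> is a section of \<open>qcoord\<close> inside
    pseudohyperbolic space. Its derivative is tangent there, hence expressible in the chart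
    \<open>k\<close>, and so yields a right inverse of the differential of the quotient
    chart.\<close>
  proof (rule surjI[of _ "\<lambda>u. SOME x. ?D x = fd (qsection t) (qcoord z) u"])
    fix u
    have "ghat (fd (qsection t) (qcoord z) u) (qsection t (qcoord z)) = 0"
      by (rule tangent_hyp_set[OF open_UNIV UNIV_I ds]) (use t qsection_hyp in simp)
    then have "fd (qsection t) (qcoord z) u \<in> range ?D"
      unfolding tangent_pseudohyperbolic[OF k zk] sz by simp
    then obtain x' where "fd (qsection t) (qcoord z) u = ?D x'" by (rule imageE)
    then have "\<exists>x. ?D x = fd (qsection t) (qcoord z) u" by (intro exI[of _ x']) (rule sym)
    then have x: "?D (SOME x. ?D x = fd (qsection t) (qcoord z) u) = fd (qsection t) (qcoord z) u"
      by (rule someI_ex)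
    let ?x = "SOME x. ?D x = fd (qsection t) (qcoord z) u"
    have "push k (snd quotient_chart \<circ> pi_minus) z ?x = fd (\<lambda>x. qcoord (chart_inv k x)) (snd k z) ?x"
      by (simp add: push_fd quotient_chart_pi)
    also have "\<dots> = fd qcoord z (fd (qsection t) (qcoord z) u)"
      using fd_compose[OF dk, of qcoord ?x] dq x by (simp add: kz)
    also have "\<dots> = fd (\<lambda>y. qcoord (qsection t y)) (qcoord z) u"
      using fd_compose[OF ds, of qcoord u] dq by (simp add: sz)
    also have "\<dots> = u" by (simp add: qcoord_qsection[OF t])
    finally show "push k (snd quotient_chart \<circ> pi_minus) z ?x = u" .
  qed
qed

end

lemma flat_target_para_hyperbolic: "flat_target para_hyperbolic orbit_tens trace_form"
proof (rule flat_target.intro)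
  fix P :: "('n::finite rvec \<times> 'n rvec) set" assume "P \<in> topspace (mtop para_hyperbolic)"
  then obtain z where z: "z \<in> hyp_set" "P = pi_minus z"
    by (auto simp: para_hyperbolic_simps topspace_quotient_topology)
  obtain L L' where L: "adapted_coordinates L L'" "snd (L' (fst z)) > 0"
    using adapted_coordinates_exist[OF hyp_set_fst_nonzero[OF z(1)]] by blast
  interpret adapted_coordinates L L' by (rule L)
  have "quotient_chart \<in> charts_at para_hyperbolic P"
    using quotient_chart_in z L(2) by (simp add: charts_at_def fst_quotient_chart Dom_def)
  then show "charts_at para_hyperbolic P \<noteq> {}" by blast
next
  fix c :: "(('n::finite rvec \<times> 'n rvec) set, (real^'n) \<times> (real^'n)) chart"
  assume c: "c \<in> charts para_hyperbolic"
  show "regular_chart c" "openin (mtop para_hyperbolic) (fst c)"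
    "continuous_map (subtopology (mtop para_hyperbolic) (fst c)) euclidean (snd c)"
    using quotient_chartD(1-3)[OF c] .
  have qp: "\<exists>z k. P = pi_minus z \<and> quotient_point c k z" if "P \<in> fst c" for P
    using quotient_chartD(4)[OF c that] quotient_point_exists[OF c] that by blast
  show "smooth_on (snd c ` fst c) (\<lambda>y. orbit_tens (chart_inv c y))"
  proof (rule smooth_on_local)
    fix y assume "y \<in> snd c ` fst c"
    then obtain z k where y: "y = snd c (pi_minus z)" and q: "quotient_point c k z" using qp by blast
    show "\<exists>V. open V \<and> y \<in> V \<and> smooth_on V (\<lambda>y. orbit_tens (chart_inv c y))"
      using quotient_point.smooth_\<psi>[OF q] unfolding y quotient_point.\<psi>_def[OF q, abs_def] .
  qed
  show "inj (fd (\<lambda>y. orbit_tens (chart_inv c y)) y)" if "y \<in> snd c ` fst c" for y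
  proof -
    obtain z k where y: "y = snd c (pi_minus z)" and q: "quotient_point c k z" using qp \<open>y \<in> snd c ` fst c\<close> by blast
    show ?thesis using quotient_point.inj_\<psi>D[OF q] unfolding y quotient_point.\<psi>_def[OF q, abs_def] .
  qed
  fix P assume P: "P \<in> fst c"
  show m: "pr_metric para_hyperbolic c P u w = trace_form (fd (\<lambda>y. orbit_tens (chart_inv c y)) (snd c P) u)
      (fd (\<lambda>y. orbit_tens (chart_inv c y)) (snd c P) w)" for u w
    by (rule para_hyperbolic_metric[OF c P])
  obtain z k where z: "P = pi_minus z" and q: "quotient_point c k z" using qp[OF P] by blast
  show "nondegenerate_form (pr_metric para_hyperbolic c P)"
    unfolding nondegenerate_form_def m
    using quotient_point.\<psi>D_nondegenerate[OF q] unfolding z quotient_point.\<psi>_def[OF q, abs_def] by blast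
qed (fact bounded_bilinear_trace_form trace_form_sym)+

lemma para_hyperbolic_tangent:
  assumes "c \<in> charts para_hyperbolic" "z \<in> hyp_set" "pi_minus z \<in> fst c"
  shows "range (fd (\<lambda>y. orbit_tens (chart_inv c y)) (snd c (pi_minus z))) = dtens z ` horizontal z"
proof -
  obtain k where q: "quotient_point c k z" using quotient_point_exists[OF assms(1,3,2)] by blast
  show ?thesis using quotient_point.range_\<psi>D[OF q] unfolding quotient_point.\<psi>_def[OF q, abs_def] .
qed

section \<open>The conormal map\<close>

lemma inj_imp_surj_DIM:
  fixes h :: "'a::euclidean_space \<Rightarrow> 'b::euclidean_space"
  assumes "linear h" "inj h" "DIM('a) = DIM('b)"
  shows "surj h"
proof -
  have "dim (range h) = DIM('b)"
    using dim_image_eq[OF assms(1), of UNIV] assms(2,3) by (simp add: inj_on_subset dim_UNIV)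
  then show ?thesis
    using dim_eq_full[of "range h"] span_eq_iff[of "range h"] linear_subspace_image[OF assms(1) subspace_UNIV] by simp
qed

lemma smooth_on_sum: "open U \<Longrightarrow> (\<And>i. i \<in> I \<Longrightarrow> smooth_on U (F i)) \<Longrightarrow> smooth_on U (\<lambda>x. \<Sum>i\<in>I. F i x)"
  by (rule smooth_onI, rule Ck_on_sum) (auto intro: smooth_onD)

section \<open>The lift of a dual pair and its two second fundamental forms\<close>

context dual_pair
begin

text \<open>The counterpart of \<open>G_\<nu>2\<close> with the roles of \<open>\<xi>\<close> and
  \<open>\<nu>\<close> exchanged. The equality of the two values is what removes the component along
  the orbit.\<close>

lemma \<nu>_\<xi>2: assumes x: "x \<in> U" shows "\<nu> x \<bullet> \<xi>2 x u w = G x u w"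
  using fd_inner_const[where a=\<nu> and b="\<lambda>y. fd \<xi> y w", OF x \<nu>d\<xi> diff(1)[OF x] diff(4)[OF x], of u]
  by (simp add: G_def \<xi>2_def)

lemma span_\<xi>: assumes x: "x \<in> U" shows "\<exists>u a. w = fd \<xi> x u + a *\<^sub>R \<xi> x"
proof -
  let ?h = "\<lambda>y. fd \<xi> x (fst y) + snd y *\<^sub>R \<xi> x"
  have l: "linear ?h"
    by (auto intro!: linearI simp: linear_add[OF lin(2)[OF x]] linear_cmul[OF lin(2)[OF x]] algebra_simps)
  have "inj ?h"
  proof (subst linear_injective_0[OF l], intro allI impI)
    fix y :: "(real^'n) \<times> real" assume y: "?h y = 0"
    have "\<nu> x \<bullet> ?h y = snd y" by (simp add: inner_add_right \<nu>d\<xi>[OF x] \<nu>\<xi>[OF x])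
    then have "snd y = 0" using y by simp
    then have "fd \<nu> x u \<bullet> fd \<xi> x (fst y) = 0" for u using y by simp
    then have "fst y = 0" using nondegenerate[OF x] by blast
    then show "y = 0" using \<open>snd y = 0\<close> by (simp add: prod_eq_iff)
  qed
  then have "surj ?h" by (rule inj_imp_surj_DIM[OF l]) simp
  then obtain y where "w = ?h y" by (rule surjE)
  then show ?thesis by blast
qed

lemma inj_\<nu>: assumes x: "x \<in> U" and u: "fd \<nu> x u = 0" shows "u = 0"
proof -
  have "G x w u = 0" for w using u G_sym[OF x, of w u] by (simp add: G_def)
  then show "u = 0" using G_nondegenerate[OF x] by blast
qed

lemma span_\<nu>: assumes x: "x \<in> U" shows "\<exists>u a. w = fd \<nu> x u + a *\<^sub>R \<nu> x"
proof -
  let ?h = "\<lambda>y. fd \<nu> x (fst y) + snd y *\<^sub>R \<nu> x"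
  have l: "linear ?h"
    by (auto intro!: linearI simp: linear_add[OF lin(1)[OF x]] linear_cmul[OF lin(1)[OF x]] algebra_simps)
  have "inj ?h"
  proof (subst linear_injective_0[OF l], intro allI impI)
    fix y :: "(real^'n) \<times> real" assume y: "?h y = 0"
    have "?h y \<bullet> \<xi> x = snd y" by (simp add: inner_add_left d\<nu>\<xi>[OF x] \<nu>\<xi>[OF x])
    then have "snd y = 0" using y by simp
    then have "fst y = 0" using y inj_\<nu>[OF x] by simp
    then show "y = 0" using \<open>snd y = 0\<close> by (simp add: prod_eq_iff)
  qed
  then have "surj ?h" by (rule inj_imp_surj_DIM[OF l]) simp
  then obtain y where "w = ?h y" by (rule surjE)
  then show ?thesis by blast
qed

definition \<sigma> where "\<sigma> y = (- \<xi> y, \<nu> y)"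

lemma \<sigma>_hyp: "x \<in> U \<Longrightarrow> \<sigma> x \<in> hyp_set"
  by (simp add: \<sigma>_def hyp_set_def \<nu>\<xi>)

lemma smooth_\<sigma>: "smooth_on U \<sigma>"
  unfolding \<sigma>_def[abs_def] by (intro smooth_on_Pair smooth_on_minus open_U smooth_\<xi> smooth_\<nu>)

lemma fd_\<sigma>: "x \<in> U \<Longrightarrow> fd \<sigma> x u = (- fd \<xi> x u, fd \<nu> x u)"
  unfolding \<sigma>_def[abs_def]
  by (rule fd_eq[THEN fun_cong]) (intro has_derivative_Pair has_derivative_minus fd_works diff)

lemma fd2_\<sigma>: assumes x: "x \<in> U" shows "fd (\<lambda>y. fd \<sigma> y w) x u = (- \<xi>2 x u w, \<nu>2 x u w)"
proof -
  have "fd (\<lambda>y. fd \<sigma> y w) x = fd (\<lambda>y. (- fd \<xi> y w, fd \<nu> y w)) x"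
    by (rule fd_cong[OF open_U x]) (rule fd_\<sigma>)
  also have "\<dots> = (\<lambda>u. (- \<xi>2 x u w, \<nu>2 x u w))"
    unfolding \<xi>2_def \<nu>2_def
    by (rule fd_eq) (intro has_derivative_Pair has_derivative_minus fd_works diff x)
  finally show ?thesis by simp
qed

lemma fd_\<sigma>_horizontal: "x \<in> U \<Longrightarrow> fd \<sigma> x u \<in> horizontal (\<sigma> x)"
  by (simp add: horizontal_iff fd_\<sigma>) (simp add: \<sigma>_def d\<nu>\<xi> \<nu>d\<xi>)

lemma ghat_fd_\<sigma>: "x \<in> U \<Longrightarrow> ghat (fd \<sigma> x u) (fd \<sigma> x w) = G x u w"
  using G_sym[of x w u] by (simp add: fd_\<sigma> ghat_def G_def)

text \<open>Horizontality removes the components along \<open>\<xi>\<close> and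
  \<open>\<nu>\<close>, which leaves \<open>(fd \<xi> x u, fd \<nu> x w)\<close>. Orthogonality to
  the tangent vectors then reads \<open>G x e (w - u) = 0\<close> for all \<open>e\<close>, so
  \<open>u = w\<close>.\<close>

lemma normal_horizontal:
  assumes x: "x \<in> U" and h: "h \<in> horizontal (\<sigma> x)" and n: "\<And>e. ghat h (fd \<sigma> x e) = 0"
  shows "\<exists>e. h = (fd \<xi> x e, fd \<nu> x e)"
proof -
  obtain u a where u: "fst h = fd \<xi> x u + a *\<^sub>R \<xi> x" using span_\<xi>[OF x] by blast
  obtain w b where w: "snd h = fd \<nu> x w + b *\<^sub>R \<nu> x" using span_\<nu>[OF x] by blast
  have "a = 0" using h u by (simp add: horizontal_iff \<sigma>_def inner_add_right \<nu>d\<xi>[OF x] \<nu>\<xi>[OF x])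
  moreover have "b = 0" using h w by (simp add: horizontal_iff \<sigma>_def inner_add_left d\<nu>\<xi>[OF x] \<nu>\<xi>[OF x])
  ultimately have h2: "h = (fd \<xi> x u, fd \<nu> x w)" using u w by (simp add: prod_eq_iff)
  have "G x e (w - u) = 0" for e
    using n[of e] G_sym[OF x, of w e] linear_diff[OF G_bilinear(2)[OF x], of e w u]
    by (simp add: h2 fd_\<sigma>[OF x] ghat_def G_def)
  then have "w - u = 0" using G_nondegenerate[OF x] by blast
  then show ?thesis using h2 by auto
qed

lemma normal_is_normal:
  assumes x: "x \<in> U"
  shows "(fd \<xi> x z, fd \<nu> x z) \<in> horizontal (\<sigma> x)" "ghat (fd \<xi> x z, fd \<nu> x z) (fd \<sigma> x e) = 0"
proof -
  show "(fd \<xi> x z, fd \<nu> x z) \<in> horizontal (\<sigma> x)"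
    by (simp add: horizontal_iff \<sigma>_def d\<nu>\<xi>[OF x] \<nu>d\<xi>[OF x])
  show "ghat (fd \<xi> x z, fd \<nu> x z) (fd \<sigma> x e) = 0"
    using G_sym[OF x, of z e] by (simp add: fd_\<sigma>[OF x] ghat_def G_def)
qed

text \<open>Paired with the direction of the orbit, the two components of the second derivative each
  give \<open>G\<close>, with opposite signs.\<close>

lemma ghat_second:
  assumes x: "x \<in> U"
  shows "ghat (fd (\<lambda>y. fd \<sigma> y w) x u) (fd \<xi> x z, fd \<nu> x z) = - cubic x u w z / 2"
    and "ghat (fd (\<lambda>y. fd \<sigma> y w) x u) (vertical (\<sigma> x)) = 0"
proof -
  show "ghat (fd (\<lambda>y. fd \<sigma> y w) x u) (fd \<xi> x z, fd \<nu> x z) = - cubic x u w z / 2"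
    by (simp add: fd2_\<sigma>[OF x] ghat_def cubic_def)
  show "ghat (fd (\<lambda>y. fd \<sigma> y w) x u) (vertical (\<sigma> x)) = 0"
    using G_\<nu>2[OF x, of w u] \<nu>_\<xi>2[OF x, of u w] G_sym[OF x, of u w]
    by (simp add: fd2_\<sigma>[OF x] ghat_def vertical_def \<sigma>_def)
qed

definition \<rho> where "\<rho> y = tensz (\<sigma> y)"

lemma fd_\<rho>: "x \<in> U \<Longrightarrow> fd \<rho> x u = dtens (\<sigma> x) (fd \<sigma> x u)"
proof -
  assume x: "x \<in> U"
  have d: "tensz differentiable (at (\<sigma> x))" using has_derivative_tensz unfolding differentiable_def by blast
  show "fd \<rho> x u = dtens (\<sigma> x) (fd \<sigma> x u)"
    unfolding \<rho>_def[abs_def]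
    by (simp only: fd_compose[OF smooth_on_differentiable[OF smooth_\<sigma> x] d] fd_eq[OF has_derivative_tensz])
qed

lemma fd2_\<rho>:
  assumes x: "x \<in> U"
  shows "fd (\<lambda>y. fd \<rho> y w) x u = - (tens (\<xi>2 x u w) (\<nu> x) + tens (fd \<xi> x w) (fd \<nu> x u)
      + tens (fd \<xi> x u) (fd \<nu> x w) + tens (\<xi> x) (\<nu>2 x u w))"
proof -
  have "fd (\<lambda>y. fd \<rho> y w) x = fd (\<lambda>y. - (tens (fd \<xi> y w) (\<nu> y) + tens (\<xi> y) (fd \<nu> y w))) x"
  proof (rule fd_cong[OF open_U x])
    fix y assume "y \<in> U"
    then show "fd \<rho> y w = - (tens (fd \<xi> y w) (\<nu> y) + tens (\<xi> y) (fd \<nu> y w))"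
      by (simp add: fd_\<rho> dtens_def fd_\<sigma>) (simp add: \<sigma>_def tens.minus_left)
  qed
  also have "\<dots> = (\<lambda>u. - ((tens (fd \<xi> x w) (fd \<nu> x u) + tens (\<xi>2 x u w) (\<nu> x))
      + (tens (\<xi> x) (\<nu>2 x u w) + tens (fd \<xi> x u) (fd \<nu> x w))))"
    unfolding \<xi>2_def \<nu>2_def
    by (rule fd_eq) (intro has_derivative_minus has_derivative_add tens.FDERIV fd_works diff x)
  finally show ?thesis by (simp add: algebra_simps)
qed

text \<open>The mixed products of first derivatives pair to zero with a normal, because each pairing
  contains a vanishing product of \<open>\<nu>\<close> with \<open>fd \<xi>\<close> or of
  \<open>fd \<nu>\<close> with \<open>\<xi>\<close>. The pure second derivatives survive with the
  factor \<nu> \<bullet> \<xi> = 1.\<close>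

lemma trace_form_second:
  assumes x: "x \<in> U"
  shows "trace_form (fd (\<lambda>y. fd \<rho> y w) x u) (dtens (\<sigma> x) (fd \<xi> x z, fd \<nu> x z)) = - cubic x u w z / 2"
proof -
  have "dtens (\<sigma> x) (fd \<xi> x z, fd \<nu> x z) = tens (fd \<xi> x z) (\<nu> x) - tens (\<xi> x) (fd \<nu> x z)"
    by (simp add: dtens_def \<sigma>_def tens.minus_left)
  then show ?thesis
    unfolding fd2_\<rho>[OF x] cubic_def
    by (simp only:) (simp add: trf.add_left trf.diff_left trf.diff_right trf.minus_left trace_form_tens
        \<nu>\<xi>[OF x] \<nu>d\<xi>[OF x] d\<nu>\<xi>[OF x] inner_commute[of "\<xi> x"] inner_commute[of "fd \<xi> x _"]
        inner_commute[of "\<xi>2 x _ _"] field_simps)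
qed

text \<open>A normal in pseudohyperbolic space is a horizontal normal plus a multiple of the
  vertical vector, and the second summand does not change the sum.\<close>

lemma trace_condition_pseudohyperbolic:
  assumes x: "x \<in> U"
  shows "(\<forall>X\<in>{X. ghat X (\<sigma> x) = 0}. (\<forall>e. ghat X (fd \<sigma> x e) = 0) \<longrightarrow>
      (\<Sum>i\<in>UNIV. \<Sum>j\<in>UNIV. matrix_inv (gram (\<lambda>u w. ghat (fd \<sigma> x u) (fd \<sigma> x w))) $ i $ j *
        ghat (fd (\<lambda>y. fd \<sigma> y (axis j 1)) x (axis i 1)) X) = 0)
    \<longleftrightarrow> (\<forall>z. trace_cubic x z = 0)" (is "(\<forall>X\<in>_. _ \<longrightarrow> ?S X = 0) \<longleftrightarrow> _")
proof -
  interpret gh: bounded_bilinear ghat by (rule bounded_bilinear_ghat)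
  have G: "(\<lambda>u w. ghat (fd \<sigma> x u) (fd \<sigma> x w)) = G x" by (intro ext) (rule ghat_fd_\<sigma>[OF x])
  have S: "?S ((fd \<xi> x z, fd \<nu> x z) + a *\<^sub>R vertical (\<sigma> x)) = - trace_cubic x z / 2" for a z
    unfolding G gh.add_right gh.scaleR_right ghat_second[OF x] trace_cubic_def
    by (simp add: sum_negf sum_divide_distrib)
  show ?thesis
  proof
    assume A: "\<forall>X\<in>{X. ghat X (\<sigma> x) = 0}. (\<forall>e. ghat X (fd \<sigma> x e) = 0) \<longrightarrow> ?S X = 0"
    show "\<forall>z. trace_cubic x z = 0"
    proof
      fix z
      have "?S (fd \<xi> x z, fd \<nu> x z) = 0"
        using A normal_is_normal[OF x] horizontal_ghat(1) by blast
      then show "trace_cubic x z = 0" using S[of z 0] by simp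
    qed
  next
    assume B: "\<forall>z. trace_cubic x z = 0"
    show "\<forall>X\<in>{X. ghat X (\<sigma> x) = 0}. (\<forall>e. ghat X (fd \<sigma> x e) = 0) \<longrightarrow> ?S X = 0"
    proof (intro ballI impI)
      fix X assume "X \<in> {X. ghat X (\<sigma> x) = 0}" and n: "\<forall>e. ghat X (fd \<sigma> x e) = 0"
      then have X: "ghat X (\<sigma> x) = 0" by simp
      define a where "a = snd X \<bullet> fst (\<sigma> x)"
      have h: "X - a *\<^sub>R vertical (\<sigma> x) \<in> horizontal (\<sigma> x)"
        unfolding a_def by (rule tangent_decomposition[OF \<sigma>_hyp[OF x] X])
      have "ghat (X - a *\<^sub>R vertical (\<sigma> x)) (fd \<sigma> x e) = 0" for e
        using n horizontal_ghat(2)[OF fd_\<sigma>_horizontal[OF x, of e]]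
        by (simp add: gh.diff_left gh.scaleR_left ghat_sym[of "vertical (\<sigma> x)"])
      from normal_horizontal[OF x h this] obtain z where "X - a *\<^sub>R vertical (\<sigma> x) = (fd \<xi> x z, fd \<nu> x z)" by blast
      then have "X = (fd \<xi> x z, fd \<nu> x z) + a *\<^sub>R vertical (\<sigma> x)" by (simp add: algebra_simps)
      then show "?S X = 0" using S[of z a] B by simp
    qed
  qed
qed

lemma trace_condition_para_hyperbolic:
  assumes x: "x \<in> U"
  shows "(\<forall>X\<in>dtens (\<sigma> x) ` horizontal (\<sigma> x). (\<forall>e. trace_form X (fd \<rho> x e) = 0) \<longrightarrow>
      (\<Sum>i\<in>UNIV. \<Sum>j\<in>UNIV. matrix_inv (gram (\<lambda>u w. trace_form (fd \<rho> x u) (fd \<rho> x w))) $ i $ j *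
        trace_form (fd (\<lambda>y. fd \<rho> y (axis j 1)) x (axis i 1)) X) = 0)
    \<longleftrightarrow> (\<forall>z. trace_cubic x z = 0)" (is "(\<forall>X\<in>_. _ \<longrightarrow> ?S X = 0) \<longleftrightarrow> _")
proof -
  have tf: "trace_form (dtens (\<sigma> x) h) (fd \<rho> x e) = ghat h (fd \<sigma> x e)" if "h \<in> horizontal (\<sigma> x)" for h e
    unfolding fd_\<rho>[OF x] by (rule trace_form_dtens[OF \<sigma>_hyp[OF x] that fd_\<sigma>_horizontal[OF x]])
  have "trace_form (fd \<rho> x u) (fd \<rho> x w) = G x u w" for u w
    using tf[OF fd_\<sigma>_horizontal[OF x, of u], of w] ghat_fd_\<sigma>[OF x] by (simp add: fd_\<rho>[OF x])
  then have G: "(\<lambda>u w. trace_form (fd \<rho> x u) (fd \<rho> x w)) = G x" by (intro ext)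
  have S: "?S (dtens (\<sigma> x) (fd \<xi> x z, fd \<nu> x z)) = - trace_cubic x z / 2" for z
    unfolding G trace_form_second[OF x] trace_cubic_def
    by (simp add: sum_negf sum_divide_distrib)
  show ?thesis
  proof
    assume A: "\<forall>X\<in>dtens (\<sigma> x) ` horizontal (\<sigma> x). (\<forall>e. trace_form X (fd \<rho> x e) = 0) \<longrightarrow> ?S X = 0"
    show "\<forall>z. trace_cubic x z = 0"
    proof
      fix z
      have "\<forall>e. trace_form (dtens (\<sigma> x) (fd \<xi> x z, fd \<nu> x z)) (fd \<rho> x e) = 0"
        using tf[OF normal_is_normal(1)[OF x]] normal_is_normal(2)[OF x] by simp
      then have "?S (dtens (\<sigma> x) (fd \<xi> x z, fd \<nu> x z)) = 0"
        using bspec[OF A imageI[OF normal_is_normal(1)[OF x]]] by blast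
      then show "trace_cubic x z = 0" using S[of z] by simp
    qed
  next
    assume B: "\<forall>z. trace_cubic x z = 0"
    show "\<forall>X\<in>dtens (\<sigma> x) ` horizontal (\<sigma> x). (\<forall>e. trace_form X (fd \<rho> x e) = 0) \<longrightarrow> ?S X = 0"
    proof (intro ballI impI)
      fix X assume "X \<in> dtens (\<sigma> x) ` horizontal (\<sigma> x)" and n: "\<forall>e. trace_form X (fd \<rho> x e) = 0"
      then obtain h where h: "h \<in> horizontal (\<sigma> x)" "X = dtens (\<sigma> x) h" by blast
      have "ghat h (fd \<sigma> x e) = 0" for e using n tf[OF h(1), of e] h(2) by simp
      from normal_horizontal[OF x h(1) this] obtain z where "h = (fd \<xi> x z, fd \<nu> x z)" by blast
      then show "?S X = 0" using S[of z] B h(2) by simp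
    qed
  qed
qed

end

section \<open>Components of affine immersions and the conormal map in charts\<close>

text \<open>A covector that annihilates the tangent vectors and is 1 on the transversal one reads
  off both components. This is used twice: for (f, \<xi>) with the covector \<nu>, and for (\<nu>, r
  \<nu>) with the covector \<xi> / r.\<close>

lemma affine_parts:
  assumes dec: "\<And>v. \<exists>!(u, a). v = push c f p u + a *\<^sub>R \<xi> p"
    and \<alpha>: "\<alpha> \<bullet> \<xi> p = 1" "\<And>u. \<alpha> \<bullet> push c f p u = 0"
  shows "transversal_part c f \<xi> p v = \<alpha> \<bullet> v"
    and "push c f p (tangential_part c f \<xi> p v) = v - (\<alpha> \<bullet> v) *\<^sub>R \<xi> p"
    and "v = push c f p u + a *\<^sub>R \<xi> p \<Longrightarrow> tangential_part c f \<xi> p v = u"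
proof -
  have a: "a = \<alpha> \<bullet> v" if "v = push c f p u + a *\<^sub>R \<xi> p" for a u v
    using that \<alpha> by (simp add: inner_add_right)
  obtain u0 a0 where 0: "v = push c f p u0 + a0 *\<^sub>R \<xi> p" using dec[of v] by auto
  have uniq: "u1 = u2" if "v = push c f p u1 + a1 *\<^sub>R \<xi> p" "v = push c f p u2 + a2 *\<^sub>R \<xi> p" for u1 u2 a1 a2 v
  proof -
    have "(u1, a1) = (u2, a2)"
      using dec[of v] that by (metis (mono_tags, lifting) case_prodI2 prod.inject split_conv)
    then show ?thesis by simp
  qed
  show "transversal_part c f \<xi> p v = \<alpha> \<bullet> v"
    unfolding transversal_part_def
  proof (rule the_equality)
    show "\<exists>u. v = push c f p u + (\<alpha> \<bullet> v) *\<^sub>R \<xi> p" by (rule exI[of _ u0], subst a[OF 0, symmetric], rule 0)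
  qed (use a in blast)
  have t: "tangential_part c f \<xi> p v = u" if v: "v = push c f p u + a *\<^sub>R \<xi> p" for u a v
    unfolding tangential_part_def
  proof (rule the_equality)
    show "\<exists>a. v = push c f p u + a *\<^sub>R \<xi> p" using v by blast
  qed (use uniq v in blast)
  then show "v = push c f p u + a *\<^sub>R \<xi> p \<Longrightarrow> tangential_part c f \<xi> p v = u" .
  show "push c f p (tangential_part c f \<xi> p v) = v - (\<alpha> \<bullet> v) *\<^sub>R \<xi> p"
    unfolding t[OF 0] a[OF 0, symmetric] by (subst 0) simp
qed

lemma push_change_chart:
  assumes M: "smooth_manifold M" and cd: "c \<in> charts_at M p" "d \<in> charts_at M p" and F: "smooth_vmap M F"
  shows "push d F p u = push c F p (push d (snd c) p u)"
proof -
  have c: "c \<in> charts M" "p \<in> fst c" and d: "d \<in> charts M" "p \<in> fst d"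
    using cd by (auto simp: charts_at_def)
  let ?V = "snd d ` (fst d \<inter> fst c)"
  note rc = regular_chart_manifold[OF M c(1)] and rd = regular_chart_manifold[OF M d(1)]
  have V: "open ?V"
    by (rule open_chart_image[OF manifold_chartD(4,3)[OF M d(1)]
          openin_Int[OF manifold_chartD(1)[OF M d(1)] manifold_chartD(1)[OF M c(1)]] Int_lower1])
  have pV: "snd d p \<in> ?V" using c(2) d(2) by blast
  have t: "smooth_on ?V (\<lambda>x. snd c (chart_inv d x))"
  proof -
    have "\<forall>c\<in>charts M. \<forall>d\<in>charts M. smooth_on (snd c ` (fst c \<inter> fst d)) (snd d \<circ> chart_inv c)"
      using M unfolding smooth_manifold_def by blast
    from bspec[OF bspec[OF this d(1)] c(1)] show ?thesis by (simp add: o_def)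
  qed
  have "smooth_on (snd c ` fst c) (\<lambda>x. F (chart_inv c x))"
    using bspec[OF F[unfolded smooth_vmap_def] c(1)] by (simp add: o_def)
  then have dF: "(\<lambda>x. F (chart_inv c x)) differentiable (at (snd c (chart_inv d (snd d p))))"
    using c(2) chart_inv_left[OF rd d(2)] by (intro smooth_on_differentiable) auto
  have "fd (\<lambda>x. F (chart_inv d x)) (snd d p) = fd (\<lambda>x. F (chart_inv c (snd c (chart_inv d x)))) (snd d p)"
    by (rule fd_cong[OF V pV]) (auto simp: chart_inv_left[OF rc] chart_inv_left[OF rd])
  then show ?thesis
    using fd_compose[OF smooth_on_differentiable[OF t pV] dF, of u]
    by (simp add: push_fd chart_inv_left[OF rd d(2)])
qed

lemma smooth_vmap_chart:
  "smooth_vmap M F \<Longrightarrow> c \<in> charts M \<Longrightarrow> smooth_on (snd c ` fst c) (\<lambda>x. F (chart_inv c x))"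
  unfolding smooth_vmap_def o_def by (rule bspec)

lemma sum_axis_component: "(\<Sum>j\<in>UNIV. h j *\<^sub>R axis j (1::real)) $ i = h i"
  by (simp add: axis_def if_distrib sum.delta' cong: if_cong)

locale equiaffine_immersion =
  fixes M :: "('m, real^'n::finite) manifold" and f \<xi> :: "'m \<Rightarrow> 'n rvec"
  assumes M: "smooth_manifold M" and eq: "equiaffine M f \<xi>" and nd: "nondegenerate_affine M f \<xi>"
    and detS: "\<forall>p\<in>topspace (mtop M). \<forall>c\<in>charts_at M p. det (matrix (affine_shape c f \<xi> p)) \<noteq> 0"
begin

lemma chart_at:
  assumes "p \<in> topspace (mtop M)" "c \<in> charts_at M p"
  shows "c \<in> charts M" "p \<in> fst c" "regular_chart c" "snd c p \<in> snd c ` fst c" "chart_inv c (snd c p) = p"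
proof -
  show 1: "c \<in> charts M" "p \<in> fst c" using assms by (auto simp: charts_at_def)
  show 2: "regular_chart c" using regular_chart_manifold[OF M 1(1)] .
  show "snd c p \<in> snd c ` fst c" using 1(2) by blast
  show "chart_inv c (snd c p) = p" using chart_inv_left[OF 2 1(2)] .
qed

lemma chart_point:
  assumes "c \<in> charts M" "x \<in> snd c ` fst c"
  shows "chart_inv c x \<in> topspace (mtop M)" "c \<in> charts_at M (chart_inv c x)" "snd c (chart_inv c x) = x"
  using assms chart_inv_in[OF assms(2)] chart_inv_right[OF assms(2)] manifold_chartD(2)[OF M assms(1)]
  by (auto simp: charts_at_def)

lemma charts_at_exist: "p \<in> topspace (mtop M) \<Longrightarrow> charts_at M p \<noteq> {}"
  using M unfolding smooth_manifold_def charts_at_def by blast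

lemma smooth_f: "smooth_vmap M f" and smooth_\<xi>: "smooth_vmap M \<xi>"
  and decomposition: "p \<in> topspace (mtop M) \<Longrightarrow> c \<in> charts_at M p \<Longrightarrow> \<exists>!(u, a). v = push c f p u + a *\<^sub>R \<xi> p"
  and inj_f: "p \<in> topspace (mtop M) \<Longrightarrow> c \<in> charts_at M p \<Longrightarrow> inj (push c f p)"
  using eq unfolding equiaffine_def affine_immersion_def by blast+

lemma linear_push:
  assumes "p \<in> topspace (mtop M)" "c \<in> charts_at M p" "smooth_vmap M F"
  shows "linear (push c F p)"
  unfolding push_fd
  using smooth_on_linear_fd[OF smooth_vmap_chart[OF assms(3) chart_at(1)[OF assms(1,2)]] chart_at(4)[OF assms(1,2)]] .

definition \<nu> :: "'m \<Rightarrow> 'n rvec" where "\<nu> = conormal M f \<xi>"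

lemma conormal_unique:
  assumes p: "p \<in> topspace (mtop M)" and c: "c \<in> charts_at M p"
    and \<alpha>: "\<alpha> \<bullet> \<xi> p = 0" "\<And>u. \<alpha> \<bullet> push c f p u = 0"
  shows "\<alpha> = 0"
proof -
  obtain u a where "\<alpha> = push c f p u + a *\<^sub>R \<xi> p" using decomposition[OF p c, of \<alpha>] by auto
  from arg_cong[OF this, of "inner \<alpha>"] have "\<alpha> \<bullet> \<alpha> = 0" using \<alpha> by (simp add: inner_add_right)
  then show ?thesis by simp
qed

text \<open>\<open>g\<close> inverts the decomposition, and its scalar component, written as an
  inner product, is the conormal. The conditions in all other charts follow because differentials in
  two charts differ by a linear substitution.\<close>

lemma conormal_ex1:
  assumes p: "p \<in> topspace (mtop M)"
  shows "\<exists>!\<alpha>. \<alpha> \<bullet> \<xi> p = 1 \<and> (\<forall>c\<in>charts_at M p. \<forall>u. \<alpha> \<bullet> push c f p u = 0)"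
proof -
  obtain c where c: "c \<in> charts_at M p" using charts_at_exist[OF p] by blast
  let ?h = "\<lambda>y. push c f p (fst y) + snd y *\<^sub>R \<xi> p"
  note l = linear_push[OF p c smooth_f]
  have lh: "linear ?h"
    by (auto intro!: linearI simp: linear_add[OF l] linear_cmul[OF l] algebra_simps)
  have "inj ?h"
  proof (rule injI)
    fix y y' assume e: "?h y = ?h y'"
    then show "y = y'"
      using decomposition[OF p c, of "?h y"] by (metis (mono_tags, lifting) case_prod_unfold prod.collapse)
  qed
  then obtain g where g: "linear g" "g \<circ> ?h = id" using linear_injective_left_inverse[OF lh] by blast
  have gh: "g (?h y) = y" for y using fun_cong[OF g(2), of y] by simp
  define \<alpha> where "\<alpha> = (\<Sum>b\<in>Basis. snd (g b) *\<^sub>R b)"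
  have \<alpha>v: "\<alpha> \<bullet> v = snd (g v)" for v
  proof -
    have "g v = (\<Sum>b\<in>Basis. (v \<bullet> b) *\<^sub>R g b)" by (rule linear_eq_sum_Basis[OF g(1)])
    then show ?thesis by (simp add: \<alpha>_def inner_sum_left snd_sum inner_commute[of v] mult.commute)
  qed
  have 1: "\<alpha> \<bullet> \<xi> p = 1" using \<alpha>v[of "\<xi> p"] gh[of "(0, 1)"] linear_0[OF l] by simp
  have 2: "\<alpha> \<bullet> push c f p u = 0" for u using \<alpha>v[of "push c f p u"] gh[of "(u, 0)"] by simp
  show ?thesis
  proof (rule ex1I[of _ \<alpha>])
    have "\<alpha> \<bullet> push d f p u = 0" if "d \<in> charts_at M p" for d u
      unfolding push_change_chart[OF M c that smooth_f] by (rule 2)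
    then show "\<alpha> \<bullet> \<xi> p = 1 \<and> (\<forall>c\<in>charts_at M p. \<forall>u. \<alpha> \<bullet> push c f p u = 0)" using 1 by blast
    fix \<beta> assume \<beta>: "\<beta> \<bullet> \<xi> p = 1 \<and> (\<forall>c\<in>charts_at M p. \<forall>u. \<beta> \<bullet> push c f p u = 0)"
    have "\<beta> \<bullet> push c f p u = 0" for u using \<beta> c by blast
    then have "\<beta> - \<alpha> = 0"
      using 1 2 \<beta> by (intro conormal_unique[OF p c]) (simp_all add: inner_diff_left)
    then show "\<beta> = \<alpha>" by simp
  qed
qed

lemma \<nu>_\<xi>: "p \<in> topspace (mtop M) \<Longrightarrow> \<nu> p \<bullet> \<xi> p = 1"
  and \<nu>_push: "p \<in> topspace (mtop M) \<Longrightarrow> c \<in> charts_at M p \<Longrightarrow> \<nu> p \<bullet> push c f p u = 0"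
  using theI'[OF conormal_ex1, of p] unfolding \<nu>_def conormal_def by blast+

text \<open>The conormal solves an injective linear system whose coefficients are
  \<open>\<xi>\<close> and the first derivatives of \<open>f\<close>.\<close>

lemma smooth_\<nu>: "smooth_vmap M \<nu>"
  unfolding smooth_vmap_def o_def
proof
  fix c assume c: "c \<in> charts M"
  let ?U = "snd c ` fst c" and ?\<xi> = "\<lambda>x. \<xi> (chart_inv c x)" and ?f = "\<lambda>x. f (chart_inv c x)"
  have U: "open ?U" by (rule manifold_chartD(3)[OF M c])
  note sf = smooth_vmap_chart[OF smooth_f c] and sx = smooth_vmap_chart[OF smooth_\<xi> c]
  let ?A = "\<lambda>x \<alpha>. (\<alpha> \<bullet> ?\<xi> x, \<Sum>j\<in>UNIV. (\<alpha> \<bullet> fd ?f x (axis j 1)) *\<^sub>R axis j 1) :: real \<times> (real^'n)"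
  show "smooth_on ?U (\<lambda>x. \<nu> (chart_inv c x))"
  proof (rule smooth_on_linear_solve[where A="?A" and b="\<lambda>x. (1, 0)", OF _ _ U])
    show lin: "linear (?A x)" for x
      by (auto intro!: linearI simp: inner_add_left scaleR_left_distrib sum.distrib scaleR_sum_right)
    show "smooth_on ?U (\<lambda>x. ?A x e)" for e
      by (intro smooth_on_Pair[OF U] smooth_on_inner[OF U] smooth_on_sum[OF U] smooth_on_scaleR[OF U]
          smooth_on_const sx smooth_on_fd[OF sf])
    show "smooth_on ?U (\<lambda>x. (1, 0) :: real \<times> (real^'n))" by (rule smooth_on_const)
    fix x assume x: "x \<in> ?U"
    note p = chart_point[OF c x]
    have fp: "fd ?f x = push c f (chart_inv c x)" by (simp add: push_fd p(3))
    show "?A x (\<nu> (chart_inv c x)) = (1, 0)"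
      unfolding fp using \<nu>_\<xi>[OF p(1)] \<nu>_push[OF p(1,2)] by simp
    show "inj (?A x)"
    proof (subst linear_injective_0[OF lin], intro allI impI)
      fix \<alpha> assume A: "?A x \<alpha> = 0"
      have s0: "(\<Sum>j\<in>UNIV. (\<alpha> \<bullet> fd ?f x (axis j 1)) *\<^sub>R axis j (1::real)) = 0"
        using A by (simp only: zero_prod_def prod.inject)
      have j: "\<alpha> \<bullet> push c f (chart_inv c x) (axis j 1) = 0" for j
        using sum_axis_component[of "\<lambda>j. \<alpha> \<bullet> fd ?f x (axis j 1)" j] unfolding s0 by (simp add: fp)
      have "\<alpha> \<bullet> push c f (chart_inv c x) u = 0" for u
      proof -
        have "linear (\<lambda>u. \<alpha> \<bullet> push c f (chart_inv c x) u)"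
          using linear_push[OF p(1,2) smooth_f] by (auto intro!: linearI simp: linear_add linear_cmul inner_add_right)
        from bilinear_eq_gram[of "\<lambda>_ u. \<alpha> \<bullet> push c f (chart_inv c x) u", OF this] show ?thesis by (simp add: j)
      qed
      moreover have "\<alpha> \<bullet> \<xi> (chart_inv c x) = 0" using A by (simp add: zero_prod_def)
      ultimately show "\<alpha> = 0" using conormal_unique[OF p(1,2)] by blast
    qed
  qed
qed

lemma parts:
  assumes "p \<in> topspace (mtop M)" "c \<in> charts_at M p"
  shows "transversal_part c f \<xi> p v = \<nu> p \<bullet> v"
    and "push c f p (tangential_part c f \<xi> p v) = v - (\<nu> p \<bullet> v) *\<^sub>R \<xi> p"
  by (rule affine_parts(1,2)[where c=c and f=f and p=p and \<xi>=\<xi> and \<alpha>="\<nu> p",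
        OF decomposition[OF assms] \<nu>_\<xi>[OF assms(1)] \<nu>_push[OF assms]])+

lemma \<nu>_push_\<xi>:
  assumes "p \<in> topspace (mtop M)" "c \<in> charts_at M p"
  shows "\<nu> p \<bullet> push c \<xi> p u = 0"
proof -
  have "transversal_form c f \<xi> p u = 0" using eq assms unfolding equiaffine_def by blast
  then show ?thesis by (simp add: transversal_form_def parts[OF assms])
qed

lemma push_f_shape:
  assumes "p \<in> topspace (mtop M)" "c \<in> charts_at M p"
  shows "push c f p (affine_shape c f \<xi> p u) = - push c \<xi> p u"
proof -
  have "push c f p (affine_shape c f \<xi> p u) = - push c f p (tangential_part c f \<xi> p (push c \<xi> p u))"
    unfolding affine_shape_def by (rule linear_neg[OF linear_push[OF assms smooth_f]])
  then show ?thesis by (simp add: parts[OF assms] \<nu>_push_\<xi>[OF assms])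
qed

text \<open>The hypothesis on the determinant speaks of a matrix, so the shape operator has to be
  linear first; this is inherited from \<open>push c \<xi> p\<close> through the injective
  differential of \<open>f\<close>.\<close>

lemma shape_injective:
  assumes pc: "p \<in> topspace (mtop M)" "c \<in> charts_at M p" and 0: "affine_shape c f \<xi> p w = 0"
  shows "w = 0"
proof -
  let ?S = "affine_shape c f \<xi> p"
  note l = linear_push[OF pc smooth_f] and lx = linear_push[OF pc smooth_\<xi>]
  have "linear ?S"
  proof (rule linearI)
    fix u v r
    show "?S (u + v) = ?S u + ?S v"
      by (rule injD[OF inj_f[OF pc]]) (simp add: linear_add[OF l] push_f_shape[OF pc] linear_add[OF lx])
    show "?S (r *\<^sub>R u) = r *\<^sub>R ?S u"
      by (rule injD[OF inj_f[OF pc]]) (simp add: linear_cmul[OF l] push_f_shape[OF pc] linear_cmul[OF lx])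
  qed
  then have "matrix ?S *v w = 0" using 0 by (simp add: matrix_works)
  moreover have "invertible (matrix ?S)" using detS pc invertible_det_nz by blast
  ultimately show ?thesis using matrix_left_invertible_ker invertible_left_inverse by blast
qed

text \<open>For the nondegeneracy, -d\<xi>(w) is the image of S w under the differential of f, and
  differentiating \<nu> \<bullet> df = 0 gives G(u, w) = -h(S w, u). So vanishing for all u forces S
  w = 0, hence w = 0.\<close>

lemma dual_pair:
  assumes c: "c \<in> charts M"
  shows "dual_pair (snd c ` fst c) (\<lambda>x. \<xi> (chart_inv c x)) (\<lambda>x. \<nu> (chart_inv c x))"
proof -
  let ?U = "snd c ` fst c" and ?\<xi> = "\<lambda>x. \<xi> (chart_inv c x)" and ?\<nu> = "\<lambda>x. \<nu> (chart_inv c x)"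
    and ?f = "\<lambda>x. f (chart_inv c x)"
  have U: "open ?U" by (rule manifold_chartD(3)[OF M c])
  note sf = smooth_vmap_chart[OF smooth_f c] and sx = smooth_vmap_chart[OF smooth_\<xi> c]
    and sn = smooth_vmap_chart[OF smooth_\<nu> c]
  have zero: "?\<nu> x \<bullet> fd b x u + fd ?\<nu> x u \<bullet> b x = 0"
    if x: "x \<in> ?U" and k: "\<And>y. y \<in> ?U \<Longrightarrow> ?\<nu> y \<bullet> b y = k" and b: "smooth_on ?U b"
    for x u and b :: "real^'n \<Rightarrow> 'n rvec" and k :: real
  proof -
    have "fd (\<lambda>y. ?\<nu> y \<bullet> b y) x u = fd (\<lambda>y. k) x u" by (rule fun_cong[OF fd_cong[OF U x k]])
    then show ?thesis
      using fd_inner[OF smooth_on_differentiable[OF sn x] smooth_on_differentiable[OF b x], of u] by simp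
  qed
  have nx: "?\<nu> x \<bullet> ?\<xi> x = 1" if "x \<in> ?U" for x by (rule \<nu>_\<xi>[OF chart_point(1)[OF c that]])
  have ndx: "?\<nu> x \<bullet> fd ?\<xi> x u = 0" if "x \<in> ?U" for x u
    using \<nu>_push_\<xi>[OF chart_point(1,2)[OF c that], of u] by (simp add: push_fd chart_point(3)[OF c that])
  have ndf: "?\<nu> x \<bullet> fd ?f x u = 0" if "x \<in> ?U" for x u
    using \<nu>_push[OF chart_point(1,2)[OF c that], of u] by (simp add: push_fd chart_point(3)[OF c that])
  show ?thesis
  proof (rule dual_pair.intro[OF U sx sn nx _ ndx])
    show "fd ?\<nu> x u \<bullet> ?\<xi> x = 0" if "x \<in> ?U" for x u
      using zero[OF that nx sx, of u] ndx[OF that, of u] by simp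
    fix x w assume x: "x \<in> ?U" and 0: "\<forall>u. fd ?\<nu> x u \<bullet> fd ?\<xi> x w = 0"
    note p = chart_point[OF c x]
    let ?s = "affine_shape c f \<xi> (chart_inv c x) w"
    have s: "fd ?f x ?s = - fd ?\<xi> x w"
      using push_f_shape[OF p(1,2), of w] by (simp add: push_fd p(3))
    have "affine_metric c f \<xi> (chart_inv c x) ?s u = 0" for u
    proof -
      have "affine_metric c f \<xi> (chart_inv c x) ?s u = ?\<nu> x \<bullet> fd (\<lambda>y. fd ?f y u) x ?s"
        using chart_at(3)[OF p(1,2)] chart_inv_in[OF x]
        by (simp add: affine_metric_def parts[OF p(1,2)] push2_fd p(3))
      also have "fd (\<lambda>y. fd ?f y u) x ?s = fd (\<lambda>y. fd ?f y ?s) x u"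
        by (rule second_derivative_symmetric[OF U x sf])
      also have "?\<nu> x \<bullet> fd (\<lambda>y. fd ?f y ?s) x u = - (fd ?\<nu> x u \<bullet> fd ?f x ?s)"
        using zero[where b="\<lambda>y. fd ?f y ?s" and u=u, OF x ndf smooth_on_fd[OF sf]] by simp
      also have "\<dots> = 0" using 0 by (simp add: s)
      finally show ?thesis .
    qed
    moreover have "nondegenerate_form (affine_metric c f \<xi> (chart_inv c x))"
      using nd p(1,2) unfolding nondegenerate_affine_def by blast
    ultimately have "?s = 0" unfolding nondegenerate_form_def by blast
    then show "w = 0" by (rule shape_injective[OF p(1,2)])
  qed
qed

text \<open>The common middle term of the three equivalences, quantified over coordinate points as
  the argument with Q needs it; \<open>trace_condition_at\<close> is the version over points of the
  manifold.\<close>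

definition trace_condition :: bool where
  "trace_condition \<longleftrightarrow> (\<forall>c\<in>charts M. \<forall>x\<in>snd c ` fst c. \<forall>z.
    dual_pair.trace_cubic (\<lambda>x. \<xi> (chart_inv c x)) (\<lambda>x. \<nu> (chart_inv c x)) x z = 0)"

lemma trace_condition_at:
  "trace_condition \<longleftrightarrow> (\<forall>p\<in>topspace (mtop M). \<forall>c\<in>charts_at M p. \<forall>z.
    dual_pair.trace_cubic (\<lambda>x. \<xi> (chart_inv c x)) (\<lambda>x. \<nu> (chart_inv c x)) (snd c p) z = 0)"
  unfolding trace_condition_def
proof (intro iffI ballI allI)
  fix p c z assume A: "\<forall>c\<in>charts M. \<forall>x\<in>snd c ` fst c. \<forall>z.
    dual_pair.trace_cubic (\<lambda>x. \<xi> (chart_inv c x)) (\<lambda>x. \<nu> (chart_inv c x)) x z = 0"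
    and pc: "p \<in> topspace (mtop M)" "c \<in> charts_at M p"
  show "dual_pair.trace_cubic (\<lambda>x. \<xi> (chart_inv c x)) (\<lambda>x. \<nu> (chart_inv c x)) (snd c p) z = 0"
    using bspec[OF bspec[OF A chart_at(1)[OF pc]] chart_at(4)[OF pc]] by simp
next
  fix c x z assume A: "\<forall>p\<in>topspace (mtop M). \<forall>c\<in>charts_at M p. \<forall>z.
    dual_pair.trace_cubic (\<lambda>x. \<xi> (chart_inv c x)) (\<lambda>x. \<nu> (chart_inv c x)) (snd c p) z = 0"
    and c: "c \<in> charts M" and x: "x \<in> snd c ` fst c"
  show "dual_pair.trace_cubic (\<lambda>x. \<xi> (chart_inv c x)) (\<lambda>x. \<nu> (chart_inv c x)) x z = 0"
    using bspec[OF bspec[OF A chart_point(1)[OF c x]] chart_point(2)[OF c x]] by (simp add: chart_point(3)[OF c x])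
qed

lemma continuous_map_vmap:
  assumes F: "smooth_vmap M F"
  shows "continuous_map (mtop M) euclidean F"
proof -
  have "openin (mtop M) {p \<in> topspace (mtop M). F p \<in> O'}" (is "openin _ ?S") if O': "open O'" for O'
  proof (subst openin_subopen, intro ballI)
    fix p assume "p \<in> ?S"
    then have p: "p \<in> topspace (mtop M)" "F p \<in> O'" by auto
    obtain c where c: "c \<in> charts_at M p" using charts_at_exist[OF p(1)] by blast
    note C = chart_at[OF p(1) c]
    have top: "topspace (subtopology (mtop M) (fst c)) = fst c"
      using manifold_chartD(2)[OF M C(1)] by (simp add: Int_absorb1)
    have "continuous_map (subtopology (mtop M) (fst c)) (top_of_set (snd c ` fst c)) (snd c)"
      using homeomorphic_imp_continuous_map[OF manifold_chartD(4)[OF M C(1)]] .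
    moreover have "continuous_map (top_of_set (snd c ` fst c)) euclidean (\<lambda>x. F (chart_inv c x))"
      using smooth_on_continuous_on[OF smooth_vmap_chart[OF F C(1)]] by simp
    ultimately have "continuous_map (subtopology (mtop M) (fst c)) euclidean ((\<lambda>x. F (chart_inv c x)) \<circ> snd c)"
      by (rule continuous_map_compose)
    then have "continuous_map (subtopology (mtop M) (fst c)) euclidean F"
      by (rule continuous_map_eq) (simp add: chart_inv_left[OF C(3)])
    from openin_continuous_map_preimage[OF this, of O']
    have "openin (subtopology (mtop M) (fst c)) {q \<in> fst c. F q \<in> O'}" using O' unfolding top by simp
    then have "openin (mtop M) {q \<in> fst c. F q \<in> O'}"
      using manifold_chartD(1)[OF M C(1)] openin_open_subtopology by blast
    then show "\<exists>T. openin (mtop M) T \<and> p \<in> T \<and> T \<subseteq> ?S"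
      using p C(2) manifold_chartD(2)[OF M C(1)] by (intro exI[of _ "{q \<in> fst c. F q \<in> O'}"]) auto
  qed
  then show ?thesis by (simp add: continuous_map)
qed

end

lemma (in dual_pair) trace_form_fd_\<rho>: "x \<in> U \<Longrightarrow> trace_form (fd \<rho> x u) (fd \<rho> x w) = G x u w"
  by (simp only: fd_\<rho> trace_form_dtens[OF \<sigma>_hyp fd_\<sigma>_horizontal fd_\<sigma>_horizontal] ghat_fd_\<sigma>)

section \<open>Maximality in terms of the cubic form\<close>

context equiaffine_immersion
begin

definition \<sigma> :: "'m \<Rightarrow> 'n rvec \<times> 'n rvec" where "\<sigma> = sigma_minus M f \<xi>"

lemma \<sigma>_eq: "\<sigma> p = (- \<xi> p, \<nu> p)"
  by (simp add: \<sigma>_def sigma_minus_def \<nu>_def)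

lemma smooth_vmap_\<sigma>: "smooth_vmap M \<sigma>"
  unfolding smooth_vmap_def o_def
proof
  fix c assume c: "c \<in> charts M"
  show "smooth_on (snd c ` fst c) (\<lambda>x. \<sigma> (chart_inv c x))"
    using dual_pair.smooth_\<sigma>[OF dual_pair[OF c]] by (simp add: dual_pair.\<sigma>_def[OF dual_pair[OF c], abs_def] \<sigma>_eq)
qed

lemma smooth_vmap_tensz_\<sigma>: "smooth_vmap M (\<lambda>p. tensz (\<sigma> p))"
  unfolding smooth_vmap_def o_def
proof
  fix c assume c: "c \<in> charts M"
  show "smooth_on (snd c ` fst c) (\<lambda>x. tensz (\<sigma> (chart_inv c x)))"
    by (rule smooth_tensz[OF manifold_chartD(3)[OF M c] smooth_vmap_chart[OF smooth_vmap_\<sigma> c]])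
qed

lemma \<sigma>_hyp: "p \<in> topspace (mtop M) \<Longrightarrow> \<sigma> p \<in> hyp_set"
  by (simp add: \<sigma>_eq hyp_set_def \<nu>_\<xi>)

lemma continuous_map_\<sigma>: "continuous_map (mtop M) (top_of_set hyp_set) \<sigma>"
  using continuous_map_vmap[OF smooth_vmap_\<sigma>] \<sigma>_hyp by (auto simp: continuous_map_in_subtopology)

lemma push_\<sigma>:
  assumes "p \<in> topspace (mtop M)" "c \<in> charts_at M p"
  shows "push c \<sigma> p = fd (dual_pair.\<sigma> (\<lambda>x. \<xi> (chart_inv c x)) (\<lambda>x. \<nu> (chart_inv c x))) (snd c p)"
    and "push2 c \<sigma> p u w =
      fd (\<lambda>y. fd (dual_pair.\<sigma> (\<lambda>x. \<xi> (chart_inv c x)) (\<lambda>x. \<nu> (chart_inv c x))) y w) (snd c p) u"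
    and "dual_pair.\<sigma> (\<lambda>x. \<xi> (chart_inv c x)) (\<lambda>x. \<nu> (chart_inv c x)) (snd c p) = \<sigma> p"
    and "push c (\<lambda>p. tensz (\<sigma> p)) p = fd (dual_pair.\<rho> (\<lambda>x. \<xi> (chart_inv c x)) (\<lambda>x. \<nu> (chart_inv c x))) (snd c p)"
    and "push2 c (\<lambda>p. tensz (\<sigma> p)) p u w =
      fd (\<lambda>y. fd (dual_pair.\<rho> (\<lambda>x. \<xi> (chart_inv c x)) (\<lambda>x. \<nu> (chart_inv c x))) y w) (snd c p) u"
proof -
  note C = chart_at[OF assms]
  interpret D: dual_pair "snd c ` fst c" "\<lambda>x. \<xi> (chart_inv c x)" "\<lambda>x. \<nu> (chart_inv c x)"
    by (rule dual_pair[OF C(1)])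
  have s: "D.\<sigma> = (\<lambda>x. \<sigma> (chart_inv c x))" by (simp add: fun_eq_iff D.\<sigma>_def \<sigma>_eq)
  have r: "D.\<rho> = (\<lambda>x. tensz (\<sigma> (chart_inv c x)))" by (simp add: fun_eq_iff D.\<rho>_def s)
  show "push c \<sigma> p = fd D.\<sigma> (snd c p)" "push2 c \<sigma> p u w = fd (\<lambda>y. fd D.\<sigma> y w) (snd c p) u"
    "D.\<sigma> (snd c p) = \<sigma> p"
    unfolding s by (simp_all add: push_fd push2_fd[OF C(3,2)] C(5))
  show "push c (\<lambda>p. tensz (\<sigma> p)) p = fd D.\<rho> (snd c p)"
    "push2 c (\<lambda>p. tensz (\<sigma> p)) p u w = fd (\<lambda>y. fd D.\<rho> y w) (snd c p) u"
    unfolding r by (simp_all add: push_fd push2_fd[OF C(3,2)])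
qed

lemma G_zero:
  assumes "p \<in> topspace (mtop M)" "c \<in> charts_at M p"
    and 0: "\<forall>w. dual_pair.G (\<lambda>x. \<xi> (chart_inv c x)) (\<lambda>x. \<nu> (chart_inv c x)) (snd c p) u w = 0"
  shows "u = 0"
proof -
  note C = chart_at[OF assms(1,2)]
  interpret D: dual_pair "snd c ` fst c" "\<lambda>x. \<xi> (chart_inv c x)" "\<lambda>x. \<nu> (chart_inv c x)"
    by (rule dual_pair[OF C(1)])
  have "\<forall>w. D.G (snd c p) w u = 0" using 0 D.G_sym[OF C(4)] by simp
  then show ?thesis by (rule D.G_nondegenerate[OF C(4)])
qed

lemma maximal_pseudohyperbolic_iff: "maximal_immersion M pseudohyperbolic \<sigma> \<longleftrightarrow> trace_condition"
proof -
  have nd: "u = 0" if pc: "p \<in> topspace (mtop M)" "c \<in> charts_at M p"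
    and 0: "\<forall>w. ghat (push c \<sigma> p u) (push c \<sigma> p w) = 0" for p c u
    using 0 unfolding push_\<sigma>(1)[OF pc] dual_pair.ghat_fd_\<sigma>[OF dual_pair[OF chart_at(1)[OF pc]] chart_at(4)[OF pc]]
    by (rule G_zero[OF pc])
  have cm: "continuous_map (mtop M) (mtop pseudohyperbolic) \<sigma>"
    using continuous_map_\<sigma> by (simp add: pseudohyperbolic_simps)
  show ?thesis
    unfolding trace_condition_at
  proof (rule flat_target.maximal_immersion_iff[OF flat_target_pseudohyperbolic M cm smooth_vmap_\<sigma>, THEN trans],
      rule nd, assumption+, intro ball_cong refl)
    fix p c assume pc: "p \<in> topspace (mtop M)" "c \<in> charts_at M p"
    note C = chart_at[OF pc]
    interpret D: dual_pair "snd c ` fst c" "\<lambda>x. \<xi> (chart_inv c x)" "\<lambda>x. \<nu> (chart_inv c x)"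
      by (rule dual_pair[OF C(1)])
    let ?P = "\<lambda>X. (\<forall>e. ghat X (push c \<sigma> p e) = 0) \<longrightarrow>
        (\<Sum>i\<in>UNIV. \<Sum>j\<in>UNIV. matrix_inv (gram (\<lambda>u w. ghat (push c \<sigma> p u) (push c \<sigma> p w))) $ i $ j *
          ghat (push2 c \<sigma> p (axis i 1) (axis j 1)) X) = 0"
    have R: "range (fd (\<lambda>y. chart_inv k y) (snd k (\<sigma> p))) = {X. ghat X (\<sigma> p) = 0}"
      if "k \<in> charts_at pseudohyperbolic (\<sigma> p)" for k
      using that by (intro tangent_pseudohyperbolic) (auto simp: charts_at_def pseudohyperbolic_simps)
    \<comment> \<open>The tangent space is the same for every \<open>k\<close> and some
      \<open>k\<close> exists, so the quantifier over charts of the target disappears.\<close>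
    have "(\<forall>k\<in>charts_at pseudohyperbolic (\<sigma> p). \<forall>X\<in>range (fd (\<lambda>y. chart_inv k y) (snd k (\<sigma> p))). ?P X)
        \<longleftrightarrow> (\<forall>X\<in>{X. ghat X (\<sigma> p) = 0}. ?P X)"
      using pseudohyperbolic_charts_nonempty[OF \<sigma>_hyp[OF pc(1)]] R by auto
    also have "\<dots> \<longleftrightarrow> (\<forall>z. D.trace_cubic (snd c p) z = 0)"
      using D.trace_condition_pseudohyperbolic[OF C(4)] unfolding push_\<sigma>(1,2,3)[OF pc] .
    finally show "(\<forall>k\<in>charts_at pseudohyperbolic (\<sigma> p). \<forall>X\<in>range (fd (\<lambda>y. chart_inv k y) (snd k (\<sigma> p))). ?P X)
        \<longleftrightarrow> (\<forall>z. D.trace_cubic (snd c p) z = 0)" .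
  qed
qed

lemma maximal_para_hyperbolic_iff: "maximal_immersion M para_hyperbolic (pi_minus \<circ> \<sigma>) \<longleftrightarrow> trace_condition"
proof -
  have \<iota>: "(\<lambda>p. orbit_tens ((pi_minus \<circ> \<sigma>) p)) = (\<lambda>p. tensz (\<sigma> p))" by (simp add: orbit_tens_pi)
  have nd: "u = 0" if pc: "p \<in> topspace (mtop M)" "c \<in> charts_at M p"
    and 0: "\<forall>w. trace_form (push c (\<lambda>p. orbit_tens ((pi_minus \<circ> \<sigma>) p)) p u) (push c (\<lambda>p. orbit_tens ((pi_minus \<circ> \<sigma>) p)) p w) = 0" for p c u
    using 0 unfolding \<iota> push_\<sigma>(4)[OF pc] dual_pair.trace_form_fd_\<rho>[OF dual_pair[OF chart_at(1)[OF pc]] chart_at(4)[OF pc]]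
    by (rule G_zero[OF pc])
  have cm: "continuous_map (mtop M) (mtop para_hyperbolic) (pi_minus \<circ> \<sigma>)"
    using continuous_map_compose[OF continuous_map_\<sigma> continuous_map_pi_minus] .
  have sm: "smooth_vmap M (\<lambda>p. orbit_tens ((pi_minus \<circ> \<sigma>) p))"
    unfolding \<iota> by (rule smooth_vmap_tensz_\<sigma>)
  show ?thesis
    unfolding trace_condition_at
  proof (rule flat_target.maximal_immersion_iff[OF flat_target_para_hyperbolic M cm sm, THEN trans],
      rule nd, assumption+, unfold \<iota>, intro ball_cong refl)
    fix p c assume pc: "p \<in> topspace (mtop M)" "c \<in> charts_at M p"
    note C = chart_at[OF pc]
    interpret D: dual_pair "snd c ` fst c" "\<lambda>x. \<xi> (chart_inv c x)" "\<lambda>x. \<nu> (chart_inv c x)"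
      by (rule dual_pair[OF C(1)])
    let ?t = "\<lambda>p. tensz (\<sigma> p)"
    let ?P = "\<lambda>X. (\<forall>e. trace_form X (push c ?t p e) = 0) \<longrightarrow>
        (\<Sum>i\<in>UNIV. \<Sum>j\<in>UNIV. matrix_inv (gram (\<lambda>u w. trace_form (push c ?t p u) (push c ?t p w))) $ i $ j *
          trace_form (push2 c ?t p (axis i 1) (axis j 1)) X) = 0"
    let ?K = "charts_at para_hyperbolic ((pi_minus \<circ> \<sigma>) p)"
    have R: "range (fd (\<lambda>y. orbit_tens (chart_inv k y)) (snd k ((pi_minus \<circ> \<sigma>) p))) = dtens (\<sigma> p) ` horizontal (\<sigma> p)"
      if "k \<in> ?K" for k
      unfolding o_def using that by (intro para_hyperbolic_tangent \<sigma>_hyp[OF pc(1)]) (auto simp: charts_at_def)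
    have "(pi_minus \<circ> \<sigma>) p \<in> topspace (mtop para_hyperbolic)"
      using cm pc(1) by (auto simp: continuous_map_def)
    then have "?K \<noteq> {}" by (rule flat_target.charts_nonempty[OF flat_target_para_hyperbolic])
    then have "(\<forall>k\<in>?K. \<forall>X\<in>range (fd (\<lambda>y. orbit_tens (chart_inv k y)) (snd k ((pi_minus \<circ> \<sigma>) p))). ?P X)
        \<longleftrightarrow> (\<forall>X\<in>dtens (\<sigma> p) ` horizontal (\<sigma> p). ?P X)"
      using R by auto
    also have "\<dots> \<longleftrightarrow> (\<forall>z. D.trace_cubic (snd c p) z = 0)"
      using D.trace_condition_para_hyperbolic[OF C(4)] unfolding push_\<sigma>(3,4,5)[OF pc] .
    finally show "(\<forall>k\<in>?K. \<forall>X\<in>range (fd (\<lambda>y. orbit_tens (chart_inv k y)) (snd k ((pi_minus \<circ> \<sigma>) p))). ?P X)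
        \<longleftrightarrow> (\<forall>z. D.trace_cubic (snd c p) z = 0)" .
  qed
qed

end

section \<open>The conormal map as an affine sphere\<close>

lemma det_gram_scale:
  fixes b :: "real^'n::finite \<Rightarrow> real^'n \<Rightarrow> real"
  shows "det (gram (\<lambda>u w. b u w / r)) = det (gram b) / r ^ CARD('n)"
proof -
  have "gram (\<lambda>u w. b u w / r) = (\<chi> i. inverse r *s (gram b $ i))"
    by (simp add: gram_def vec_eq_iff divide_inverse)
  then have "det (gram (\<lambda>u w. b u w / r)) = (\<Prod>i\<in>(UNIV :: 'n set). inverse r) * det (\<chi> i. gram b $ i)"
    using det_rows_mul[of "\<lambda>_. inverse r" "\<lambda>i. gram b $ i"] by simp
  then show ?thesis by (simp add: power_inverse divide_inverse)
qed

text \<open>Here \<open>N\<close> and \<open>F\<close> are the determinants of the two frames, with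
  product det G. Squaring the equality of volumes gives the exponent: two powers of \<open>r\<close>
  come from the transversal vector r \<nu>, and \<open>m\<close> from the determinant of the metric
  G / r.\<close>

lemma volume_scaling:
  fixes N F r :: real
  assumes "N \<noteq> 0" "F \<noteq> 0" "r \<noteq> 0"
  shows "(\<exists>\<epsilon>\<in>{1, - 1}. \<forall>X::'n::finite \<Rightarrow> real^'n. r * det (\<chi> i. X i) * N = \<epsilon> * (sqrt \<bar>N * F / r ^ m\<bar> * det (\<chi> i. X i)))
    \<longleftrightarrow> \<bar>N / F\<bar> * \<bar>r\<bar> ^ (m + 2) = 1" (is "?L \<longleftrightarrow> ?R")
proof -
  let ?s = "sqrt \<bar>N * F / r ^ m\<bar>"
  have "?L \<longleftrightarrow> \<bar>r * N\<bar> = ?s"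
  proof
    assume ?L
    then obtain \<epsilon> :: real where \<epsilon>: "\<epsilon> \<in> {1, - 1}"
      "\<And>X::'n \<Rightarrow> real^'n. r * det (\<chi> i. X i) * N = \<epsilon> * (?s * det (\<chi> i. X i))" by blast
    \<comment> \<open>Both sides are multiples of det X, so testing on the standard basis compares
      the factors.\<close>
    have "(\<chi> i. axis i (1::real)) = (mat 1 :: real^'n^'n)" by (simp add: vec_eq_iff axis_def mat_def)
    then have "r * N = \<epsilon> * ?s" using \<epsilon>(2)[of "\<lambda>i. axis i 1"] by simp
    then show "\<bar>r * N\<bar> = ?s" using \<epsilon>(1) by (auto simp: abs_mult)
  next
    assume s: "\<bar>r * N\<bar> = ?s"
    show ?L
    proof (cases "r * N \<ge> 0")
      case True
      then have "r * N = ?s" using s by simp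
      then have "r * d * N = 1 * (?s * d)" for d by (metis mult.commute mult.left_commute mult_1)
      then show ?thesis by blast
    next
      case False
      then have "- (r * N) = ?s" using s by simp
      then have "r * d * N = - 1 * (?s * d)" for d
        by (metis (no_types, opaque_lifting) mult.commute mult.left_commute mult_1 mult_minus_left minus_minus)
      then show ?thesis by blast
    qed
  qed
  also have "\<dots> \<longleftrightarrow> \<bar>r * N\<bar>\<^sup>2 = \<bar>N * F / r ^ m\<bar>"
    by (metis abs_ge_zero real_sqrt_abs real_sqrt_eq_iff abs_abs real_sqrt_pow2)
  also have "\<dots> \<longleftrightarrow> (\<bar>r\<bar> * \<bar>N\<bar>)\<^sup>2 * \<bar>r\<bar> ^ m = \<bar>N\<bar> * \<bar>F\<bar>"
    using assms by (simp add: abs_mult power_abs field_simps)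
  also have "\<dots> \<longleftrightarrow> \<bar>N\<bar> * \<bar>r\<bar> ^ (m + 2) = \<bar>F\<bar>"
  proof -
    have "(\<bar>r\<bar> * \<bar>N\<bar>)\<^sup>2 * \<bar>r\<bar> ^ m = \<bar>N\<bar> * (\<bar>N\<bar> * \<bar>r\<bar> ^ (m + 2))"
      by (simp add: power2_eq_square power_add algebra_simps)
    show ?thesis unfolding \<open>(\<bar>r\<bar> * \<bar>N\<bar>)\<^sup>2 * \<bar>r\<bar> ^ m = _\<close> using assms(1) by simp
  qed
  also have "\<dots> \<longleftrightarrow> ?R" using assms by (auto simp: field_simps)
  finally show ?thesis .
qed

context equiaffine_immersion
begin

abbreviation Qc :: "('m, real^'n) chart \<Rightarrow> real^'n \<Rightarrow> real" where
  "Qc c \<equiv> dual_pair.Q (\<lambda>x. \<xi> (chart_inv c x)) (\<lambda>x. \<nu> (chart_inv c x))"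

lemma push_dual:
  assumes "p \<in> topspace (mtop M)" "c \<in> charts_at M p"
  shows "push c \<nu> p = fd (\<lambda>x. \<nu> (chart_inv c x)) (snd c p)" "push c \<xi> p = fd (\<lambda>x. \<xi> (chart_inv c x)) (snd c p)"
  by (simp_all add: push_fd)

lemma \<xi>_push_\<nu>:
  assumes "p \<in> topspace (mtop M)" "c \<in> charts_at M p"
  shows "\<xi> p \<bullet> push c \<nu> p u = 0"
proof -
  note C = chart_at[OF assms]
  from dual_pair.d\<nu>\<xi>[OF dual_pair[OF C(1)] C(4), of u] show ?thesis
    by (simp add: push_dual[OF assms] C(5) inner_commute)
qed

lemma Qc_frames:
  assumes "p \<in> topspace (mtop M)" "c \<in> charts_at M p"
  shows "Qc c (snd c p) = det (frame (\<nu> p) (\<lambda>j. push c \<nu> p (axis j 1))) / det (frame (\<xi> p) (\<lambda>j. - push c \<xi> p (axis j 1)))"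
proof -
  note C = chart_at[OF assms]
  interpret D: dual_pair "snd c ` fst c" "\<lambda>x. \<xi> (chart_inv c x)" "\<lambda>x. \<nu> (chart_inv c x)"
    by (rule dual_pair[OF C(1)])
  show ?thesis by (simp add: D.Q_def D.Nf_def D.Ff_def C(5) push_dual[OF assms])
qed

text \<open>A change of chart multiplies both frame determinants by the determinant of the
  transition map, which cancels in the quotient.\<close>

lemma Qc_change_chart:
  assumes p: "p \<in> topspace (mtop M)" and c: "c \<in> charts_at M p" and d: "d \<in> charts_at M p"
  shows "Qc d (snd d p) = Qc c (snd c p)"
proof -
  define X where "X = (\<lambda>j::'n. push d (snd c) p (axis j 1))"
  note l\<nu> = linear_push[OF p c smooth_\<nu>] and l\<xi> = linear_push[OF p c smooth_\<xi>]
  have "linear (\<lambda>u. - push c \<xi> p u)"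
    using l\<xi> by (auto intro!: linearI simp: linear_add linear_cmul)
  from det_frame[OF this, of 1 "\<xi> p" X]
  have F: "det (frame (\<xi> p) (\<lambda>j. - push d \<xi> p (axis j 1))) = det (\<chi> i. X i) * det (frame (\<xi> p) (\<lambda>j. - push c \<xi> p (axis j 1)))"
    by (simp add: X_def push_change_chart[OF M c d smooth_\<xi>])
  from det_frame[OF l\<nu>, of 1 "\<nu> p" X]
  have N: "det (frame (\<nu> p) (\<lambda>j. push d \<nu> p (axis j 1))) = det (\<chi> i. X i) * det (frame (\<nu> p) (\<lambda>j. push c \<nu> p (axis j 1)))"
    by (simp add: X_def push_change_chart[OF M c d smooth_\<nu>])
  \<comment> \<open>The Jacobian is nonzero since otherwise both determinants in the chart
    \<open>d\<close>, and with them \<open>Qc d\<close>, would be 0.\<close>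
  have "Qc d (snd d p) \<noteq> 0" using dual_pair.det_nz(3)[OF dual_pair chart_at(4)[OF p d]] chart_at(1)[OF p d] by blast
  then have "det (\<chi> i. X i) \<noteq> 0" unfolding Qc_frames[OF p d] N F by auto
  then show ?thesis unfolding Qc_frames[OF p d] Qc_frames[OF p c] N F by simp
qed

section \<open>The Blaschke condition for locally constant multiples of the conormal\<close>

context
  fixes r :: "'m \<Rightarrow> real"
  assumes lc: "locally_constant (mtop M) r" and nz: "\<And>p. p \<in> topspace (mtop M) \<Longrightarrow> r p \<noteq> 0"
begin

lemma locally_constant_chart:
  assumes p: "p \<in> topspace (mtop M)" and c: "c \<in> charts_at M p"
  shows "\<exists>V. open V \<and> snd c p \<in> V \<and> V \<subseteq> snd c ` fst c \<and> (\<forall>y\<in>V. r (chart_inv c y) = r p)"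
proof -
  note C = chart_at[OF p c]
  obtain W where W: "openin (mtop M) W" "p \<in> W" "\<forall>q\<in>W. r q = r p"
    using lc p unfolding locally_constant_def by blast
  have o: "open (snd c ` (fst c \<inter> W))"
    by (rule open_chart_image[OF manifold_chartD(4,3)[OF M C(1)] openin_Int[OF manifold_chartD(1)[OF M C(1)] W(1)] Int_lower1])
  have "r (chart_inv c y) = r p" if y: "y \<in> snd c ` (fst c \<inter> W)" for y
  proof -
    obtain q where "q \<in> fst c" "q \<in> W" "y = snd c q" using y by blast
    then show ?thesis using W(3) chart_inv_left[OF C(3)] by simp
  qed
  moreover have "snd c p \<in> snd c ` (fst c \<inter> W)" using W(2) C(2) by blast
  ultimately show ?thesis using o by (intro exI[of _ "snd c ` (fst c \<inter> W)"] conjI ballI) (assumption | blast)+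
qed

lemma smooth_scaled: "smooth_vmap M (\<lambda>p. r p *\<^sub>R \<nu> p)"
  unfolding smooth_vmap_def o_def
proof
  fix c assume c: "c \<in> charts M"
  show "smooth_on (snd c ` fst c) (\<lambda>x. r (chart_inv c x) *\<^sub>R \<nu> (chart_inv c x))"
  proof (rule smooth_on_local)
    fix x assume x: "x \<in> snd c ` fst c"
    note p = chart_point[OF c x]
    obtain V where V: "open V" "x \<in> V" "V \<subseteq> snd c ` fst c" "\<forall>y\<in>V. r (chart_inv c y) = r (chart_inv c x)"
      using locally_constant_chart[OF p(1,2)] unfolding p(3) by blast
    have "smooth_on V (\<lambda>y. r (chart_inv c x) *\<^sub>R \<nu> (chart_inv c y))"
      by (intro smooth_on_scaleR V(1) smooth_on_const smooth_on_subset[OF smooth_vmap_chart[OF smooth_\<nu> c] V(3)])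
    then have "smooth_on V (\<lambda>x. r (chart_inv c x) *\<^sub>R \<nu> (chart_inv c x))"
      by (rule smooth_on_cong[OF V(1), rotated]) (use V(4) in simp)
    then show "\<exists>V. open V \<and> x \<in> V \<and> smooth_on V (\<lambda>x. r (chart_inv c x) *\<^sub>R \<nu> (chart_inv c x))"
      using V(1,2) by blast
  qed
qed

lemma push_scaled:
  assumes p: "p \<in> topspace (mtop M)" and c: "c \<in> charts_at M p"
  shows "push c (\<lambda>p. r p *\<^sub>R \<nu> p) p u = r p *\<^sub>R push c \<nu> p u"
proof -
  note C = chart_at[OF p c]
  obtain V where V: "open V" "snd c p \<in> V" "\<forall>y\<in>V. r (chart_inv c y) = r p"
    using locally_constant_chart[OF p c] by blast
  have "fd (\<lambda>x. r (chart_inv c x) *\<^sub>R \<nu> (chart_inv c x)) (snd c p) = fd (\<lambda>x. r p *\<^sub>R \<nu> (chart_inv c x)) (snd c p)"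
    by (rule fd_cong[OF V(1,2)]) (use V(3) in simp)
  then show ?thesis
    unfolding push_fd
    using fd_bounded_linear[OF bounded_linear_scaleR_right[of "r p"]
        smooth_on_differentiable[OF smooth_vmap_chart[OF smooth_\<nu> C(1)] C(4)], of u] by simp
qed

lemma decomposition_scaled:
  assumes p: "p \<in> topspace (mtop M)" and c: "c \<in> charts_at M p"
  shows "\<exists>!(u, a). v = push c \<nu> p u + a *\<^sub>R (r p *\<^sub>R \<nu> p)"
proof -
  note C = chart_at[OF p c]
  interpret D: dual_pair "snd c ` fst c" "\<lambda>x. \<xi> (chart_inv c x)" "\<lambda>x. \<nu> (chart_inv c x)"
    by (rule dual_pair[OF C(1)])
  note l = linear_push[OF p c smooth_\<nu>]
  obtain u b where u: "v = push c \<nu> p u + b *\<^sub>R \<nu> p"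
    using D.span_\<nu>[OF C(4), of v] unfolding push_dual[OF p c] C(5) by blast
  show ?thesis
  proof (rule ex1I[of _ "(u, b / r p)"])
    show "case (u, b / r p) of (u, a) \<Rightarrow> v = push c \<nu> p u + a *\<^sub>R (r p *\<^sub>R \<nu> p)"
      using u nz[OF p] by simp
    fix y :: "(real^'n) \<times> real" assume "case y of (u, a) \<Rightarrow> v = push c \<nu> p u + a *\<^sub>R (r p *\<^sub>R \<nu> p)"
    then have y: "v = push c \<nu> p (fst y) + snd y *\<^sub>R (r p *\<^sub>R \<nu> p)" by (simp add: case_prod_unfold)
    have \<xi>\<nu>: "\<xi> p \<bullet> \<nu> p = 1" using \<nu>_\<xi>[OF p] by (simp add: inner_commute)
    have "\<xi> p \<bullet> v = snd y * r p"
      unfolding y by (simp add: inner_add_right \<xi>_push_\<nu>[OF p c] \<xi>\<nu>)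
    moreover have "\<xi> p \<bullet> v = b"
      unfolding u by (simp add: inner_add_right \<xi>_push_\<nu>[OF p c] \<xi>\<nu>)
    ultimately have b: "snd y * r p = b" by simp
    then have "push c \<nu> p (fst y - u) = 0" using y u by (simp add: linear_diff[OF l])
    then have "fst y - u = 0" unfolding push_dual[OF p c] by (rule D.inj_\<nu>[OF C(4)])
    then show "y = (u, b / r p)" using b nz[OF p] by (simp add: prod_eq_iff field_simps)
  qed
qed

lemma inj_push_\<nu>:
  assumes p: "p \<in> topspace (mtop M)" and c: "c \<in> charts_at M p"
  shows "inj (push c \<nu> p)"
proof (subst linear_injective_0[OF linear_push[OF p c smooth_\<nu>]], intro allI impI)
  note C = chart_at[OF p c]
  fix u assume "push c \<nu> p u = 0"
  then show "u = 0" unfolding push_dual[OF p c] by (rule dual_pair.inj_\<nu>[OF dual_pair[OF C(1)] C(4)])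
qed

lemma affine_immersion_scaled: "affine_immersion M \<nu> (\<lambda>p. r p *\<^sub>R \<nu> p)"
  unfolding affine_immersion_def
  using smooth_\<nu> smooth_scaled inj_push_\<nu> decomposition_scaled by blast

lemma parts_scaled:
  assumes p: "p \<in> topspace (mtop M)" and c: "c \<in> charts_at M p"
  shows "transversal_part c \<nu> (\<lambda>p. r p *\<^sub>R \<nu> p) p v = (\<xi> p \<bullet> v) / r p"
    and "tangential_part c \<nu> (\<lambda>p. r p *\<^sub>R \<nu> p) p (push c \<nu> p u) = u"
proof -
  have 1: "(\<xi> p /\<^sub>R r p) \<bullet> (r p *\<^sub>R \<nu> p) = 1"
    using nz[OF p] \<nu>_\<xi>[OF p] by (simp add: inner_commute[of "\<xi> p"])
  have 2: "(\<xi> p /\<^sub>R r p) \<bullet> push c \<nu> p u = 0" for u by (simp add: \<xi>_push_\<nu>[OF p c])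
  note A = affine_parts[where c=c and f=\<nu> and p=p and \<xi>="\<lambda>p. r p *\<^sub>R \<nu> p" and \<alpha>="\<xi> p /\<^sub>R r p",
      OF decomposition_scaled[OF p c] 1 2]
  show "transversal_part c \<nu> (\<lambda>p. r p *\<^sub>R \<nu> p) p v = (\<xi> p \<bullet> v) / r p"
    unfolding A(1) by (simp add: divide_inverse mult.commute)
  show "tangential_part c \<nu> (\<lambda>p. r p *\<^sub>R \<nu> p) p (push c \<nu> p u) = u"
    by (rule A(3)[of _ _ 0]) simp
qed

text \<open>\<open>\<xi> p / r p\<close> is the dual covector of the pair (\<nu>, r \<nu>), and the
  pairing of \<open>\<xi>\<close> with the second derivative of \<open>\<nu>\<close> is
  \<open>G\<close>.\<close>

lemma affine_metric_scaled:
  assumes p: "p \<in> topspace (mtop M)" and c: "c \<in> charts_at M p"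
  shows "affine_metric c \<nu> (\<lambda>p. r p *\<^sub>R \<nu> p) p u w =
    dual_pair.G (\<lambda>x. \<xi> (chart_inv c x)) (\<lambda>x. \<nu> (chart_inv c x)) (snd c p) u w / r p"
proof -
  note C = chart_at[OF p c]
  interpret D: dual_pair "snd c ` fst c" "\<lambda>x. \<xi> (chart_inv c x)" "\<lambda>x. \<nu> (chart_inv c x)"
    by (rule dual_pair[OF C(1)])
  have "\<xi> p \<bullet> push2 c \<nu> p u w = D.G (snd c p) u w"
    using D.G_\<nu>2[OF C(4), of w u] D.G_sym[OF C(4), of u w]
    by (simp add: push2_fd[OF C(3,2)] D.\<nu>2_def C(5) inner_commute[of "\<xi> p"])
  then show ?thesis by (simp add: affine_metric_def parts_scaled[OF p c])
qed

lemma equiaffine_scaled: "equiaffine M \<nu> (\<lambda>p. r p *\<^sub>R \<nu> p)"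
  unfolding equiaffine_def transversal_form_def
  using affine_immersion_scaled by (simp add: parts_scaled push_scaled \<xi>_push_\<nu>)

lemma nondegenerate_scaled: "nondegenerate_affine M \<nu> (\<lambda>p. r p *\<^sub>R \<nu> p)"
  unfolding nondegenerate_affine_def nondegenerate_form_def
proof (intro conjI ballI allI impI affine_immersion_scaled)
  fix p c u assume pc: "p \<in> topspace (mtop M)" "c \<in> charts_at M p"
    and 0: "\<forall>w. affine_metric c \<nu> (\<lambda>p. r p *\<^sub>R \<nu> p) p u w = 0"
  show "u = 0"
    by (rule G_zero[OF pc]) (use 0 nz[OF pc(1)] in \<open>simp add: affine_metric_scaled[OF pc]\<close>)
qed

lemma shape_scaled:
  assumes p: "p \<in> topspace (mtop M)" and c: "c \<in> charts_at M p"
  shows "affine_shape c \<nu> (\<lambda>p. r p *\<^sub>R \<nu> p) p u = - (r p *\<^sub>R u)"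
  unfolding affine_shape_def push_scaled[OF p c] linear_cmul[OF linear_push[OF p c smooth_\<nu>], symmetric]
    parts_scaled(2)[OF p c] ..

lemma volume_scaled_iff:
  assumes p: "p \<in> topspace (mtop M)" and c: "c \<in> charts_at M p"
  shows "(\<exists>\<epsilon>\<in>{1, - 1}. \<forall>X. theta_form c \<nu> (\<lambda>p. r p *\<^sub>R \<nu> p) p X =
      \<epsilon> * volume_form (affine_metric c \<nu> (\<lambda>p. r p *\<^sub>R \<nu> p) p) X)
    \<longleftrightarrow> \<bar>Qc c (snd c p)\<bar> * \<bar>r p\<bar> ^ (CARD('n) + 2) = 1"
proof -
  note C = chart_at[OF p c]
  interpret D: dual_pair "snd c ` fst c" "\<lambda>x. \<xi> (chart_inv c x)" "\<lambda>x. \<nu> (chart_inv c x)"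
    by (rule dual_pair[OF C(1)])
  let ?x = "snd c p"
  have th: "theta_form c \<nu> (\<lambda>p. r p *\<^sub>R \<nu> p) p X = r p * det (\<chi> i. X i) * det (D.Nf ?x)" for X
  proof -
    have "theta_form c \<nu> (\<lambda>p. r p *\<^sub>R \<nu> p) p X = det (frame (r p *\<^sub>R \<nu> p) (\<lambda>j. push c \<nu> p (X j)))"
      by (simp add: theta_form_def frame_def)
    moreover have "D.Nf ?x = frame (\<nu> p) (\<lambda>j. push c \<nu> p (axis j 1))"
      by (simp add: D.Nf_def push_dual[OF p c] C(5))
    ultimately show ?thesis using det_frame[OF linear_push[OF p c smooth_\<nu>]] by simp
  qed
  have "affine_metric c \<nu> (\<lambda>p. r p *\<^sub>R \<nu> p) p = (\<lambda>u w. D.G ?x u w / r p)"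
    by (intro ext) (rule affine_metric_scaled[OF p c])
  then have vol: "volume_form (affine_metric c \<nu> (\<lambda>p. r p *\<^sub>R \<nu> p) p) X =
      sqrt \<bar>det (D.Nf ?x) * det (D.Ff ?x) / r p ^ CARD('n)\<bar> * det (\<chi> i. X i)" for X
    by (simp only: volume_form_def det_gram_scale D.det_Nf_Ff[OF C(4)])
  show ?thesis
    unfolding th vol D.Q_def by (rule volume_scaling[OF D.det_nz(1,2)[OF C(4)] nz[OF p]])
qed

text \<open>Since r is locally constant, d(r \<nu>) = r d\<nu>, so the shape operator is -r Id and
  \<open>l = r\<close> is the witness. With equiaffinity and nondegeneracy also established, only
  the volume condition is left.\<close>

lemma proper_affine_sphere_scaled_iff:
  "proper_affine_sphere M \<nu> (\<lambda>p. r p *\<^sub>R \<nu> p) \<longleftrightarrow>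
    (\<forall>p\<in>topspace (mtop M). \<forall>c\<in>charts_at M p. \<bar>Qc c (snd c p)\<bar> * \<bar>r p\<bar> ^ (CARD('n) + 2) = 1)"
proof -
  have "\<exists>l. \<forall>p\<in>topspace (mtop M). l p \<noteq> 0 \<and>
      (\<forall>c\<in>charts_at M p. \<forall>u. affine_shape c \<nu> (\<lambda>p. r p *\<^sub>R \<nu> p) p u = - (l p *\<^sub>R u))"
    using nz shape_scaled by (intro exI[of _ r]) blast
  then show ?thesis
    unfolding proper_affine_sphere_def blaschke_def
    using equiaffine_scaled nondegenerate_scaled volume_scaled_iff by auto
qed

end

lemma affine_immersion_\<nu>: "affine_immersion M \<nu> \<nu>"
proof -
  have "locally_constant (mtop M) (\<lambda>_. 1 :: real)" unfolding locally_constant_def by blast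
  from affine_immersion_scaled[OF this] show ?thesis by simp
qed

text \<open>The volume condition fixes only the absolute value of Q where \<open>r\<close> is
  constant; continuity of Q excludes a change of sign nearby, so Q itself is locally
  constant.\<close>

lemma sphere_imp_trace_condition:
  assumes lc: "locally_constant (mtop M) r" and nz: "\<And>p. p \<in> topspace (mtop M) \<Longrightarrow> r p \<noteq> 0"
    and R: "\<And>p c. p \<in> topspace (mtop M) \<Longrightarrow> c \<in> charts_at M p \<Longrightarrow>
      \<bar>Qc c (snd c p)\<bar> * \<bar>r p\<bar> ^ (CARD('n) + 2) = 1"
  shows trace_condition
  unfolding trace_condition_def
proof (intro ballI allI)
  fix c x z assume c: "c \<in> charts M" and x: "x \<in> snd c ` fst c"
  interpret D: dual_pair "snd c ` fst c" "\<lambda>x. \<xi> (chart_inv c x)" "\<lambda>x. \<nu> (chart_inv c x)"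
    by (rule dual_pair[OF c])
  note p = chart_point[OF c x]
  obtain V where V: "open V" "x \<in> V" "V \<subseteq> snd c ` fst c" "\<forall>y\<in>V. r (chart_inv c y) = r (chart_inv c x)"
    using locally_constant_chart[OF lc nz p(1,2)] unfolding p(3) by blast
  have abs: "\<bar>D.Q y\<bar> = \<bar>D.Q x\<bar>" if "y \<in> V" for y
  proof -
    have y: "y \<in> snd c ` fst c" using that V(3) by blast
    have "\<bar>D.Q y\<bar> * \<bar>r (chart_inv c x)\<bar> ^ (CARD('n) + 2) = \<bar>D.Q x\<bar> * \<bar>r (chart_inv c x)\<bar> ^ (CARD('n) + 2)"
      using R[OF chart_point(1,2)[OF c y]] R[OF p(1,2)] V(4) that
      unfolding chart_point(3)[OF c y] p(3) by metis
    then show ?thesis using nz[OF p(1)] by simp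
  qed
  have "isCont D.Q x" using D.has_derivative_Q[OF x] has_derivative_continuous by blast
  \<comment> \<open>Within this distance Q stays nearer to \<open>D.Q x\<close> than
    \<open>D.Q x\<close> is to 0, so it cannot take the value \<open>- D.Q x\<close>.\<close>
  then obtain e where e: "e > 0" "\<forall>y. dist y x < e \<longrightarrow> dist (D.Q y) (D.Q x) < \<bar>D.Q x\<bar>"
    unfolding continuous_at_eps_delta using D.det_nz(3)[OF x] by (metis zero_less_abs_iff)
  have eq: "D.Q y = D.Q x" if "y \<in> V \<inter> ball x e" for y
  proof -
    have "dist y x < e" using that by (simp add: dist_commute)
    then have "\<bar>D.Q y - D.Q x\<bar> < \<bar>D.Q x\<bar>" using e(2) by (simp add: dist_real_def)
    moreover have "\<bar>D.Q y\<bar> = \<bar>D.Q x\<bar>" using abs that by blast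
    ultimately show ?thesis by linarith
  qed
  have "open (V \<inter> ball x e)" "x \<in> V \<inter> ball x e" using V(1,2) e(1) by auto
  from D.trace_cubic_zero[OF x this eq] show "D.trace_cubic x z = 0" .
qed

lemma trace_condition_imp_sphere:
  assumes t: trace_condition
  shows "\<exists>r. locally_constant (mtop M) r \<and> (\<forall>p\<in>topspace (mtop M). r p \<noteq> 0) \<and>
    (\<forall>p\<in>topspace (mtop M). \<forall>c\<in>charts_at M p. \<bar>Qc c (snd c p)\<bar> * \<bar>r p\<bar> ^ (CARD('n) + 2) = 1)"
proof -
  \<comment> \<open>The chosen chart is immaterial by \<open>Qc_change_chart\<close>, so
    \<open>q\<close> is the absolute value of Q as a function on the manifold.\<close>
  define q where "q p = \<bar>Qc (SOME c. c \<in> charts_at M p) (snd (SOME c. c \<in> charts_at M p) p)\<bar>" for p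
  \<comment> \<open>The positive solution of q r^(n+2) = 1, where n is the dimension of the
    manifold.\<close>
  define r where "r p = inverse (root (CARD('n) + 2) (q p))" for p
  have q: "q p = \<bar>Qc c (snd c p)\<bar>" if "p \<in> topspace (mtop M)" "c \<in> charts_at M p" for p c
  proof -
    have "(SOME c. c \<in> charts_at M p) \<in> charts_at M p" using that(2) by (rule someI)
    from Qc_change_chart[OF that this] show ?thesis by (simp add: q_def)
  qed
  have q0: "q p > 0" if p: "p \<in> topspace (mtop M)" for p
  proof -
    obtain c where c: "c \<in> charts_at M p" using charts_at_exist[OF p] by blast
    then show ?thesis
      using dual_pair.det_nz(3)[OF dual_pair[OF chart_at(1)[OF p c]] chart_at(4)[OF p c]] by (simp add: q[OF p c])
  qed
  have "locally_constant (mtop M) r"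
    unfolding locally_constant_def
  proof
    fix p assume p: "p \<in> topspace (mtop M)"
    obtain c where c: "c \<in> charts_at M p" using charts_at_exist[OF p] by blast
    note C = chart_at[OF p c]
    interpret D: dual_pair "snd c ` fst c" "\<lambda>x. \<xi> (chart_inv c x)" "\<lambda>x. \<nu> (chart_inv c x)"
      by (rule dual_pair[OF C(1)])
    have "\<forall>x\<in>snd c ` fst c. \<forall>z. D.trace_cubic x z = 0"
      using t C(1) unfolding trace_condition_def by blast
    from D.Q_locally_constant[OF this C(4)] obtain V where V: "open V" "snd c p \<in> V" "V \<subseteq> snd c ` fst c"
      "\<forall>y\<in>V. D.Q y = D.Q (snd c p)" by blast
    let ?W = "{w \<in> fst c. snd c w \<in> V}"
    have top: "topspace (subtopology (mtop M) (fst c)) = fst c"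
      using manifold_chartD(2)[OF M C(1)] by (simp add: Int_absorb1)
    have "continuous_map (subtopology (mtop M) (fst c)) euclidean (snd c)"
      using homeomorphic_imp_continuous_map[OF manifold_chartD(4)[OF M C(1)]] continuous_map_into_fulltopology by blast
    from openin_continuous_map_preimage[OF this, of V]
    have "openin (subtopology (mtop M) (fst c)) ?W" using V(1) unfolding top by simp
    then have W: "openin (mtop M) ?W"
      using manifold_chartD(1)[OF M C(1)] openin_open_subtopology by blast
    have "r w = r p" if w: "w \<in> ?W" for w
    proof -
      have wt: "w \<in> topspace (mtop M)" "c \<in> charts_at M w"
        using w C(1) manifold_chartD(2)[OF M C(1)] by (auto simp: charts_at_def)
      have "q w = q p" using w V(4) by (simp add: q[OF wt] q[OF p c])
      then show ?thesis by (simp add: r_def)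
    qed
    then show "\<exists>W. openin (mtop M) W \<and> p \<in> W \<and> (\<forall>w\<in>W. r w = r p)"
      using W C(2) V(2) by (intro exI[of _ ?W]) blast
  qed
  moreover have "r p \<noteq> 0" if "p \<in> topspace (mtop M)" for p
    using q0[OF that] by (simp add: r_def)
  moreover have "\<bar>Qc c (snd c p)\<bar> * \<bar>r p\<bar> ^ (CARD('n) + 2) = 1"
    if "p \<in> topspace (mtop M)" "c \<in> charts_at M p" for p c
  proof -
    have "\<bar>r p\<bar> ^ (CARD('n) + 2) = inverse (q p)"
      using q0[OF that(1)] real_root_pow_pos2[of "CARD('n) + 2" "q p"] by (simp add: r_def power_inverse del: power_Suc)
    then show ?thesis using q0[OF that(1)] by (simp add: q[OF that, symmetric])
  qed
  ultimately show ?thesis by blast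
qed

lemma sphere_iff: "centroaffine_proper_affine_sphere M \<nu> \<longleftrightarrow> trace_condition"
proof
  assume "centroaffine_proper_affine_sphere M \<nu>"
  then obtain r :: "'m \<Rightarrow> real" where r: "locally_constant (mtop M) r" "\<forall>p\<in>topspace (mtop M). r p \<noteq> 0"
    "proper_affine_sphere M \<nu> (\<lambda>p. r p *\<^sub>R \<nu> p)" unfolding centroaffine_proper_affine_sphere_def by blast
  have nz: "r p \<noteq> 0" if "p \<in> topspace (mtop M)" for p using r(2) that by blast
  have "\<forall>p\<in>topspace (mtop M). \<forall>c\<in>charts_at M p. \<bar>Qc c (snd c p)\<bar> * \<bar>r p\<bar> ^ (CARD('n) + 2) = 1"
    using r(3) by (rule proper_affine_sphere_scaled_iff[OF r(1), THEN iffD1, rotated]) (rule nz)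
  then show trace_condition by (intro sphere_imp_trace_condition[OF r(1) nz]) blast+
next
  assume trace_condition
  from trace_condition_imp_sphere[OF this] obtain r where r: "locally_constant (mtop M) r" "\<forall>p\<in>topspace (mtop M). r p \<noteq> 0"
    "\<forall>p\<in>topspace (mtop M). \<forall>c\<in>charts_at M p. \<bar>Qc c (snd c p)\<bar> * \<bar>r p\<bar> ^ (CARD('n) + 2) = 1" by blast
  have nz: "r p \<noteq> 0" if "p \<in> topspace (mtop M)" for p using r(2) that by blast
  have "proper_affine_sphere M \<nu> (\<lambda>p. r p *\<^sub>R \<nu> p)"
    using r(3) by (rule proper_affine_sphere_scaled_iff[OF r(1), THEN iffD2, rotated]) (rule nz)
  then show "centroaffine_proper_affine_sphere M \<nu>"
    unfolding centroaffine_proper_affine_sphere_def using affine_immersion_\<nu> r(1,2) by blast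
qed

end

theorem corollaryB:
  fixes M :: "('m, real^'n::finite) manifold"
    and f \<xi> :: "'m \<Rightarrow> 'n rvec"
  assumes "smooth_manifold M" and "oriented M"
    and "equiaffine M f \<xi>" and "nondegenerate_affine M f \<xi>"
    and "\<forall>p\<in>topspace (mtop M). \<forall>c\<in>charts_at M p. det (matrix (affine_shape c f \<xi> p)) \<noteq> 0"
  shows "(maximal_immersion M pseudohyperbolic (sigma_minus M f \<xi>)
            \<longleftrightarrow> maximal_immersion M para_hyperbolic (pi_minus \<circ> sigma_minus M f \<xi>))
       \<and> (maximal_immersion M para_hyperbolic (pi_minus \<circ> sigma_minus M f \<xi>)
            \<longleftrightarrow> centroaffine_proper_affine_sphere M (conormal M f \<xi>))"
proof -
  interpret equiaffine_immersion M f \<xi>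
    using assms(1,3,4,5) by (rule equiaffine_immersion.intro)
  show ?thesis
    using maximal_pseudohyperbolic_iff maximal_para_hyperbolic_iff sphere_iff
    unfolding \<sigma>_def \<nu>_def by simp
qed

end
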